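(* Let $H$ be a computable Hilbert space and let $(f_k)$ be a computable frame for $H$ with analysis operator $T^*:H\to\ell^2(\mathbb{N})$, $T^*f=(\langle f,f_k\rangle)_k$. Then a sequence $(g_k)$ in $H$ is a computable dual frame of $(f_k)$ if and only if $(g_k)=(V\delta_k)$ for some operator $V:\ell^2(\mathbb{N})\to H$ that is a computable left inverse of $T^*$ (i.e. $V$ is computable and $VT^*f=f$ for all $f\in H$), where $(\delta_k)$ is the standard computable orthonormal basis of $\ell^2(\mathbb{N})$.
   Context: Computability conventions (representation-based computable analysis). $\Sigma$ is a finite alphabet containing $0,1$. A partial function $F:\subseteq\Sigma^\omega\to\Sigma^\omega$ is computable if a Turing machine, running forever with a one-way output tape, transforms each $p\in\mathrm{dom}(F)$ on its input tape into $F(p)$. A representation of a set $X$ is a surjective partial map $\delta:\subseteq\Sigma^\omega\to X$; $p$ with $\delta(p)=x$ is a $\delta$-name of $x$. A partial function $f:\subseteq X\to Y$ between represented spaces $(X,\delta),(Y,\delta')$ is computable (or $(\delta,\delta')$-computable) if there is a computable $F$ with $\delta'F(p)=f\delta(p)$ for all $p\in\mathrm{dom}(f\delta)$. $\mathbb{N}$ is represented by $\delta_{\mathbb N}(1^n0^\omega)=n$; a computable sequence in $X$ is a computable function $\mathbb{N}\to X$. A computable metric space $(X,d,\alpha)$ is a metric space with a dense sequence $\alpha:\mathbb{N}\to X$ such that $d\circ(\alpha\times\alpha)$ is a computable double sequence of reals; it is represented by its Cauchy representation $\delta_X(01^{n_0+1}01^{n_1+1}\dots)=\lim_i\alpha(n_i)$,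 defined when $(\alpha(n_i))$ converges and $d(\alpha(n_i),\alpha(n_j))<2^{-i}$ for all $j>i$. $\mathbb{R}$ carries the Cauchy representation for the standard numbering of $\mathbb{Q}$ (similarly $\mathbb{C}$ with $\mathbb{Q}[i]$). With $\mathbb{F}\in\{\mathbb{R},\mathbb{C}\}$, a computable Hilbert space over $\mathbb{F}$ is a separable Hilbert space $H$ with a sequence $e:\mathbb{N}\to H$ with dense linear span such that $H$ with the norm metric and the dense sequence $\alpha_e$, $\alpha_e\langle k,\langle n_0,\dots,n_k\rangle\rangle=\sum_{i=0}^k\alpha_{\mathbb F}(n_i)e_i$ ($\alpha_{\mathbb F}$ a standard numbering of $\mathbb{Q}$, resp. $\mathbb{Q}[i]$, and $\langle\cdot\rangle$ Cantor tupling), is a computable metric space; its Cauchy representation is $\delta_H$. The space $\ell^2(\mathbb{N})$ is a computable Hilbert space with its standard orthonormal basis. "Operator" means linear operator; a computable operator is one computable with respect to Cauchy representations. A computable frame for $H$ is a computable sequence $(f_i)$ in $H$ that is a frame, i.e. there are constants $A,B>0$ with $A\|f\|^2\le\sum_i|\langle f,f_i\rangle|^2\le B\|f\|^2$ for all $f\in H$. A computable dual frame of a computable frame $(f_i)$ is a computable frame $(g_i)$ for $H$ such that $f=\sum_{i=1}^\infty\langle f,g_i\rangle f_i$ for all $f\in H$ (equivalently $f=\sum_{i=1}^\infty\langle f,f_i\rangle g_i$ for all $f\in H$). *)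

theory Defs
  imports "HOL-Analysis.Analysis" "HOL-Library.Nat_Bijection"
begin

section \<open>Turing machines on infinite words\<close>

text \<open>
  The finite alphabet \<open>\<Sigma>\<close> containing 0 and 1 is a type \<open>'s\<close> of sort
  \<open>{finite, zero_neq_one}\<close>; infinite words are functions \<^typ>\<open>nat \<Rightarrow> 's\<close>.
  A machine has a read-only input tape, finitely many two-way infinite work tapes over the
  finite alphabet \<open>{0..<symbols}\<close> with blank 0, and a one-way output tape. Its states are
  \<open>{0..<states}\<close>, with initial state 0.  There is no halting state: a machine that is
  to stop loops without writing output.
\<close>

datatype direction = Left | Stay | Right

record 's machine =
  states :: nat
  work_tapes :: nat
  symbols :: nat
  transition :: "nat \<Rightarrow> 's \<Rightarrow> nat list \<Rightarrow> nat \<times> direction \<times> (nat \<times> direction) list \<times> 's option"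

text \<open>
  From the state, the scanned input symbol and the scanned symbols of the work tapes, the
  transition yields the new state, the move of the input head, for each work tape the symbol
  to write followed by the head move, and possibly a symbol to append to the output.
\<close>

definition machine :: "'s machine \<Rightarrow> bool" where
  "machine M \<longleftrightarrow> 0 < states M \<and> 0 < symbols M \<and>
     (\<forall>q a w. q < states M \<and> length w = work_tapes M \<and> set w \<subseteq> {..<symbols M} \<longrightarrow>
        (case transition M q a w of (q', d, acts, out) \<Rightarrow>
           q' < states M \<and> length acts = work_tapes M \<and> fst ` set acts \<subseteq> {..<symbols M}))"

text \<open>A work tape is recorded relative to its head, which is always at position 0.\<close>

type_synonym tape = "int \<Rightarrow> nat"

fun move_tape :: "direction \<Rightarrow> tape \<Rightarrow> tape" where
  "move_tape Left t = (\<lambda>i. t (i - 1))"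
| "move_tape Stay t = t"
| "move_tape Right t = (\<lambda>i. t (i + 1))"

text \<open>The input tape has a first cell; moving left from it has no effect.\<close>

fun move_input :: "direction \<Rightarrow> nat \<Rightarrow> nat" where
  "move_input Left i = i - 1"
| "move_input Stay i = i"
| "move_input Right i = i + 1"

record 's configuration =
  state :: nat
  input_pos :: nat
  tapes :: "tape list"
  written :: "'s list"

definition initial :: "'s machine \<Rightarrow> 's configuration" where
  "initial M = \<lparr>state = 0, input_pos = 0, tapes = replicate (work_tapes M) (\<lambda>_. 0), written = []\<rparr>"

definition step :: "'s machine \<Rightarrow> (nat \<Rightarrow> 's) \<Rightarrow> 's configuration \<Rightarrow> 's configuration" where
  "step M p c =
     (case transition M (state c) (p (input_pos c)) (map (\<lambda>t. t 0) (tapes c)) of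
        (q, d, acts, out) \<Rightarrow>
          \<lparr>state = q,
           input_pos = move_input d (input_pos c),
           tapes = map2 (\<lambda>t (a, d'). move_tape d' (t(0 := a))) (tapes c) acts,
           written = written c @ (case out of None \<Rightarrow> [] | Some a \<Rightarrow> [a])\<rparr>)"

definition output_after :: "'s machine \<Rightarrow> (nat \<Rightarrow> 's) \<Rightarrow> nat \<Rightarrow> 's list" where
  "output_after M p t = written ((step M p ^^ t) (initial M))"

definition transforms :: "'s machine \<Rightarrow> (nat \<Rightarrow> 's) \<Rightarrow> (nat \<Rightarrow> 's) \<Rightarrow> bool" where
  "transforms M p q \<longleftrightarrow> (\<forall>n. \<exists>t. n < length (output_after M p t) \<and> output_after M p t ! n = q n)"

definition computable_word_function ::
    "((nat \<Rightarrow> 's::{finite, zero_neq_one}) \<rightharpoonup> (nat \<Rightarrow> 's)) \<Rightarrow> bool" where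
  "computable_word_function F \<longleftrightarrow>
     (\<exists>M. machine M \<and> (\<forall>p q. F p = Some q \<longrightarrow> transforms M p q))"


section \<open>Representations\<close>

text \<open>
  A representation of \<open>'x\<close> is a partial map from infinite words; for \<open>p\<close> with
  \<open>\<delta> p = Some x\<close>, \<open>p\<close> is a \<open>\<delta>\<close>-name of \<open>x\<close>.
\<close>

definition computable_map ::
    "((nat \<Rightarrow> 's::{finite, zero_neq_one}) \<rightharpoonup> 'x) \<Rightarrow> ((nat \<Rightarrow> 's) \<rightharpoonup> 'y) \<Rightarrow> ('x \<rightharpoonup> 'y) \<Rightarrow> bool" where
  "computable_map \<delta> \<delta>' f \<longleftrightarrow>
     (\<exists>F. computable_word_function F \<and> (\<forall>p \<in> dom (f \<circ>\<^sub>m \<delta>). (\<delta>' \<circ>\<^sub>m F) p = (f \<circ>\<^sub>m \<delta>) p))"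

definition nat_rep :: "(nat \<Rightarrow> 's::{finite, zero_neq_one}) \<rightharpoonup> nat" where
  "nat_rep p =
     (if \<exists>n. p = (\<lambda>i. if i < n then 1 else 0)
      then Some (THE n. p = (\<lambda>i. if i < n then 1 else 0)) else None)"

text \<open>The usual product representation, on interleaved names.\<close>

definition prod_rep ::
    "((nat \<Rightarrow> 's::{finite, zero_neq_one}) \<rightharpoonup> 'x) \<Rightarrow> ((nat \<Rightarrow> 's) \<rightharpoonup> 'y) \<Rightarrow> ((nat \<Rightarrow> 's) \<rightharpoonup> 'x \<times> 'y)" where
  "prod_rep \<delta> \<delta>' p =
     (case (\<delta> (\<lambda>i. p (2 * i)), \<delta>' (\<lambda>i. p (2 * i + 1))) of
        (Some x, Some y) \<Rightarrow> Some (x, y) | _ \<Rightarrow> None)"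

definition computable_sequence :: "((nat \<Rightarrow> 's::{finite, zero_neq_one}) \<rightharpoonup> 'x) \<Rightarrow> (nat \<Rightarrow> 'x) \<Rightarrow> bool" where
  "computable_sequence \<delta> g \<longleftrightarrow> computable_map nat_rep \<delta> (Some \<circ> g)"

text \<open>
  \<open>codes p n\<close> says that \<open>p\<close> is the word with blocks \<open>0 1^(n i + 1)\<close>, \<open>i = 0, 1, \<dots>\<close>;
  the block of index \<open>i\<close> has length \<open>n i + 2\<close>.
\<close>

definition codes :: "(nat \<Rightarrow> 's::{finite, zero_neq_one}) \<Rightarrow> (nat \<Rightarrow> nat) \<Rightarrow> bool" where
  "codes p n \<longleftrightarrow>
     (\<forall>i. p (\<Sum>j<i. n j + 2) = 0 \<and> (\<forall>k \<le> n i. p ((\<Sum>j<i. n j + 2) + 1 + k) = 1))"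

definition cauchy_name ::
    "(nat \<Rightarrow> 'x::metric_space) \<Rightarrow> (nat \<Rightarrow> 's::{finite, zero_neq_one}) \<Rightarrow> 'x \<Rightarrow> bool" where
  "cauchy_name \<alpha> p x \<longleftrightarrow>
     (\<exists>n. codes p n \<and> (\<forall>i j. i < j \<longrightarrow> dist (\<alpha> (n i)) (\<alpha> (n j)) < 1 / 2 ^ i) \<and>
          (\<lambda>i. \<alpha> (n i)) \<longlonglongrightarrow> x)"

definition cauchy_rep ::
    "(nat \<Rightarrow> 'x::metric_space) \<Rightarrow> ((nat \<Rightarrow> 's::{finite, zero_neq_one}) \<rightharpoonup> 'x)" where
  "cauchy_rep \<alpha> p = (if \<exists>x. cauchy_name \<alpha> p x then Some (THE x. cauchy_name \<alpha> p x) else None)"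


section \<open>The scalar fields\<close>

text \<open>
  A class covering exactly the two cases \<open>\<real>\<close> (where \<open>imag_unit = 0\<close>) and \<open>\<complex>\<close>
  (where \<open>imag_unit = \<i>\<close>), up to isomorphism.
\<close>

class rc_field = real_normed_field + banach +
  fixes imag_unit :: 'a and conjugate :: "'a \<Rightarrow> 'a"
  assumes imag_unit_cases: "imag_unit = 0 \<or> imag_unit * imag_unit = - 1"
    and scaleR_exhaust: "\<exists>a b. x = a *\<^sub>R 1 + b *\<^sub>R imag_unit"
    and conjugate_scaleR: "conjugate (a *\<^sub>R 1 + b *\<^sub>R imag_unit) = a *\<^sub>R 1 - b *\<^sub>R imag_unit"
    and mult_conjugate_self: "x * conjugate x = (norm x)\<^sup>2 *\<^sub>R 1"

instantiation real :: rc_field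
begin

definition "imag_unit = (0::real)"
definition "conjugate (x::real) = x"

instance
  by standard (auto simp: imag_unit_real_def conjugate_real_def power2_eq_square)

end

instantiation complex :: rc_field
begin

definition "imag_unit = \<i>"
definition "conjugate = cnj"

instance
proof
  fix x :: complex and a b :: real
  show "imag_unit = (0::complex) \<or> imag_unit * imag_unit = (- 1::complex)"
    by (simp add: imag_unit_complex_def)
  have "x = Re x *\<^sub>R 1 + Im x *\<^sub>R imag_unit"
    by (simp add: complex_eq_iff imag_unit_complex_def)
  then show "\<exists>a b. x = a *\<^sub>R 1 + b *\<^sub>R imag_unit"
    by blast
  show "conjugate (a *\<^sub>R 1 + b *\<^sub>R imag_unit :: complex) = a *\<^sub>R 1 - b *\<^sub>R imag_unit"
    by (simp add: complex_eq_iff imag_unit_complex_def conjugate_complex_def)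
  show "x * conjugate x = (norm x)\<^sup>2 *\<^sub>R 1"
    using complex_norm_square[of x] by (simp add: conjugate_complex_def scaleR_conv_of_real)
qed

end

lemma re_im_exhaust: "\<exists>a b. (x::'f::rc_field) = of_real a + of_real b * imag_unit"
  using scaleR_exhaust[of x] by (simp add: scaleR_conv_of_real)

lemma conj_re_im:
  "conjugate (of_real a + of_real b * imag_unit) = (of_real a - of_real b * imag_unit :: 'f::rc_field)"
  using conjugate_scaleR[of a b] by (simp add: scaleR_conv_of_real)

lemma mult_conj_self: "x * conjugate x = (of_real ((norm x)\<^sup>2) :: 'f::rc_field)"
  using mult_conjugate_self[of x] by (simp add: scaleR_conv_of_real)

text \<open>
  \<open>\<alpha>\<^sub>\<real>\<langle>i,j,k\<rangle> = (i - j) / (k + 1)\<close> with Cantor tuples, and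
  \<open>\<alpha>\<^sub>\<complex>\<langle>a,b\<rangle> = \<alpha>\<^sub>\<real>(a) + \<i> \<alpha>\<^sub>\<real>(b)\<close>.
\<close>

definition rat_num :: "nat \<Rightarrow> real" where
  "rat_num m =
     (case prod_decode m of (i, m') \<Rightarrow> case prod_decode m' of (j, k) \<Rightarrow>
        (real i - real j) / (real k + 1))"

definition scalar_num :: "nat \<Rightarrow> 'f::rc_field" where
  "scalar_num m =
     (if imag_unit = (0::'f) then of_real (rat_num m)
      else (case prod_decode m of (a, b) \<Rightarrow> of_real (rat_num a) + of_real (rat_num b) * imag_unit))"

definition real_rep :: "(nat \<Rightarrow> 's::{finite, zero_neq_one}) \<rightharpoonup> real" where
  "real_rep = cauchy_rep rat_num"

definition computable_metric_space ::
    "'s::{finite, zero_neq_one} itself \<Rightarrow> (nat \<Rightarrow> 'x::metric_space) \<Rightarrow> bool" where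
  "computable_metric_space _ \<alpha> \<longleftrightarrow>
     closure (range \<alpha>) = UNIV \<and>
     computable_map (prod_rep nat_rep nat_rep :: (nat \<Rightarrow> 's) \<rightharpoonup> nat \<times> nat) real_rep
       (\<lambda>(m, n). Some (dist (\<alpha> m) (\<alpha> n)))"


section \<open>Computable Hilbert spaces\<close>

text \<open>
  The underlying real Banach space is given by the type \<open>'h\<close>; the scalar multiplication and
  the inner product, linear in the first argument, over \<open>'f\<close> are parameters.
\<close>

locale hilbert_space = vector_space smul
  for smul :: "'f::rc_field \<Rightarrow> 'h::banach \<Rightarrow> 'h" +
  fixes ip :: "'h \<Rightarrow> 'h \<Rightarrow> 'f"
  assumes scale_of_real: "smul (of_real r) x = r *\<^sub>R x"
    and ip_add_left: "ip (x + y) z = ip x z + ip y z"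
    and ip_scale_left: "ip (smul a x) y = a * ip x y"
    and ip_conj: "ip y x = conjugate (ip x y)"
    and ip_self: "ip x x = of_real ((norm x)\<^sup>2)"

text \<open>
  \<open>untuple k m\<close> is the list \<open>[n\<^sub>0, \<dots>, n\<^sub>k]\<close> with Cantor code
  \<open>m = \<langle>n\<^sub>0, \<langle>n\<^sub>1, \<dots>, n\<^sub>k\<rangle>\<rangle>\<close>.
\<close>

primrec untuple :: "nat \<Rightarrow> nat \<Rightarrow> nat list" where
  "untuple 0 m = [m]"
| "untuple (Suc k) m = (case prod_decode m of (n, m') \<Rightarrow> n # untuple k m')"

definition span_num :: "('f::rc_field \<Rightarrow> 'h::real_normed_vector \<Rightarrow> 'h) \<Rightarrow> (nat \<Rightarrow> 'h) \<Rightarrow> nat \<Rightarrow> 'h" where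
  "span_num smul e m =
     (case prod_decode m of (k, t) \<Rightarrow> \<Sum>i\<le>k. smul (scalar_num (untuple k t ! i)) (e i))"

definition hilbert_rep ::
    "('f::rc_field \<Rightarrow> 'h::real_normed_vector \<Rightarrow> 'h) \<Rightarrow> (nat \<Rightarrow> 'h)
       \<Rightarrow> ((nat \<Rightarrow> 's::{finite, zero_neq_one}) \<rightharpoonup> 'h)" where
  "hilbert_rep smul e = cauchy_rep (span_num smul e)"

text \<open>Separability need not be required: it follows from the density of the span of \<open>e\<close>.\<close>

definition computable_hilbert_space ::
    "'s::{finite, zero_neq_one} itself \<Rightarrow> ('f::rc_field \<Rightarrow> 'h::banach \<Rightarrow> 'h) \<Rightarrow> ('h \<Rightarrow> 'h \<Rightarrow> 'f)
       \<Rightarrow> (nat \<Rightarrow> 'h) \<Rightarrow> bool" where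
  "computable_hilbert_space S smul ip e \<longleftrightarrow>
     hilbert_space smul ip \<and>
     closure (module.span smul (range e)) = UNIV \<and>
     computable_metric_space S (span_num smul e)"

definition computable_operator ::
    "'s::{finite, zero_neq_one} itself
       \<Rightarrow> ('f::rc_field \<Rightarrow> 'g::real_normed_vector \<Rightarrow> 'g) \<Rightarrow> (nat \<Rightarrow> 'g)
       \<Rightarrow> ('f \<Rightarrow> 'h::real_normed_vector \<Rightarrow> 'h) \<Rightarrow> (nat \<Rightarrow> 'h) \<Rightarrow> ('g \<Rightarrow> 'h) \<Rightarrow> bool" where
  "computable_operator _ smul e smul' e' V \<longleftrightarrow>
     Vector_Spaces.linear smul smul' V \<and>
     computable_map (hilbert_rep smul e :: (nat \<Rightarrow> 's) \<rightharpoonup> 'g) (hilbert_rep smul' e') (Some \<circ> V)"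


section \<open>The space of square-summable sequences\<close>

typedef (overloaded) 'f ell2 = "{c :: nat \<Rightarrow> 'f::rc_field. summable (\<lambda>i. (norm (c i))\<^sup>2)}"
  morphisms coord Abs_ell2
  by (rule exI[of _ "\<lambda>_. 0"]) simp

setup_lifting type_definition_ell2

lemma summable_coord: "summable (\<lambda>i. (norm (coord c i))\<^sup>2)"
  using coord[of c] by simp

lemma square_summable_add:
  fixes a b :: "nat \<Rightarrow> 'a::real_normed_vector"
  assumes "summable (\<lambda>i. (norm (a i))\<^sup>2)" "summable (\<lambda>i. (norm (b i))\<^sup>2)"
  shows "summable (\<lambda>i. (norm (a i + b i))\<^sup>2)"
proof (rule summable_comparison_test[OF exI[of _ 0]])
  show "summable (\<lambda>i. 2 * (norm (a i))\<^sup>2 + 2 * (norm (b i))\<^sup>2)"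
    by (intro summable_add summable_mult assms)
  show "\<forall>i\<ge>0. norm ((norm (a i + b i))\<^sup>2) \<le> 2 * (norm (a i))\<^sup>2 + 2 * (norm (b i))\<^sup>2"
  proof (intro allI impI)
    fix i
    have "(norm (a i + b i))\<^sup>2 \<le> (norm (a i) + norm (b i))\<^sup>2"
      by (intro power_mono norm_triangle_ineq norm_ge_zero)
    also have "\<dots> \<le> 2 * (norm (a i))\<^sup>2 + 2 * (norm (b i))\<^sup>2"
      using zero_le_power2[of "norm (a i) - norm (b i)"] by (simp add: power2_eq_square algebra_simps)
    finally show "norm ((norm (a i + b i))\<^sup>2) \<le> 2 * (norm (a i))\<^sup>2 + 2 * (norm (b i))\<^sup>2"
      by simp
  qed
qed

lift_definition scale_ell2 :: "'f::rc_field \<Rightarrow> 'f ell2 \<Rightarrow> 'f ell2" is "\<lambda>a c i. a * c i"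
  by (simp add: norm_mult power_mult_distrib summable_mult)

instantiation ell2 :: (rc_field) real_vector
begin

lift_definition zero_ell2 :: "'a ell2" is "\<lambda>_. 0"
  by simp

lift_definition plus_ell2 :: "'a ell2 \<Rightarrow> 'a ell2 \<Rightarrow> 'a ell2" is "\<lambda>c d i. c i + d i"
  by (rule square_summable_add)

lift_definition uminus_ell2 :: "'a ell2 \<Rightarrow> 'a ell2" is "\<lambda>c i. - c i"
  by simp

lift_definition minus_ell2 :: "'a ell2 \<Rightarrow> 'a ell2 \<Rightarrow> 'a ell2" is "\<lambda>c d i. c i - d i"
  subgoal for c d using square_summable_add[of c "\<lambda>i. - d i"] by simp
  done

lift_definition scaleR_ell2 :: "real \<Rightarrow> 'a ell2 \<Rightarrow> 'a ell2" is "\<lambda>r c i. r *\<^sub>R c i"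
  by (simp add: power_mult_distrib summable_mult)

instance
  by standard (transfer; auto simp: algebra_simps)+

end

instantiation ell2 :: (rc_field) real_normed_vector
begin

definition norm_ell2_def:
  "norm (c :: 'a ell2) = sqrt (\<Sum>i. (norm (coord c i))\<^sup>2)"

definition dist_ell2_def:
  "dist (c :: 'a ell2) d = norm (c - d)"

definition sgn_ell2_def:
  "sgn (c :: 'a ell2) = inverse (norm c) *\<^sub>R c"

definition uniformity_ell2_def:
  "(uniformity :: ('a ell2 \<times> 'a ell2) filter) =
     (INF e\<in>{0 <..}. principal {(x, y). dist x y < e})"

definition open_ell2_def:
  "open (U :: 'a ell2 set) \<longleftrightarrow> (\<forall>x\<in>U. eventually (\<lambda>(x', y). x' = x \<longrightarrow> y \<in> U) uniformity)"

lemma L2_set_coord_le: "L2_set (\<lambda>i. norm (coord c i)) {..<n} \<le> norm c"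
  unfolding L2_set_def norm_ell2_def
  by (intro real_sqrt_le_mono sum_le_suminf summable_coord) auto

lemma norm_ell2_leI:
  assumes "\<And>n. L2_set (\<lambda>i. norm (coord c i)) {..<n} \<le> B"
  shows "norm c \<le> B"
proof -
  have B: "0 \<le> B" using assms[of 0] by simp
  have "(\<Sum>i. (norm (coord c i))\<^sup>2) \<le> B\<^sup>2"
  proof (rule suminf_le_const[OF summable_coord])
    fix n
    show "(\<Sum>i<n. (norm (coord c i))\<^sup>2) \<le> B\<^sup>2"
      using assms[of n] B unfolding L2_set_def
      by (metis real_sqrt_le_iff real_sqrt_abs abs_of_nonneg)
  qed
  then show ?thesis
    unfolding norm_ell2_def using B by (simp add: real_le_lsqrt)
qed

instance
proof
  fix x y :: "'a ell2" and a :: real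
  show "(norm x = 0) = (x = 0)"
  proof
    assume "norm x = 0"
    then have "(\<Sum>i. (norm (coord x i))\<^sup>2) = 0"
      by (simp add: norm_ell2_def)
    then have "\<forall>i. (norm (coord x i))\<^sup>2 = 0"
      using suminf_eq_zero_iff[OF summable_coord[of x]] by simp
    then show "x = 0"
      by (auto simp: coord_inject[symmetric] zero_ell2.rep_eq)
  qed (simp add: norm_ell2_def zero_ell2.rep_eq)
  show "norm (x + y) \<le> norm x + norm y"
  proof (rule norm_ell2_leI)
    fix n
    have "L2_set (\<lambda>i. norm (coord (x + y) i)) {..<n}
        \<le> L2_set (\<lambda>i. norm (coord x i) + norm (coord y i)) {..<n}"
      by (intro L2_set_mono) (auto simp: plus_ell2.rep_eq norm_triangle_ineq)
    also have "\<dots> \<le> L2_set (\<lambda>i. norm (coord x i)) {..<n} + L2_set (\<lambda>i. norm (coord y i)) {..<n}"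
      by (rule L2_set_triangle_ineq)
    also have "\<dots> \<le> norm x + norm y"
      by (intro add_mono L2_set_coord_le)
    finally show "L2_set (\<lambda>i. norm (coord (x + y) i)) {..<n} \<le> norm x + norm y" .
  qed
  show "norm (a *\<^sub>R x) = \<bar>a\<bar> * norm x"
    by (simp add: norm_ell2_def scaleR_ell2.rep_eq power_mult_distrib
        suminf_mult[OF summable_coord] real_sqrt_mult)
qed (simp_all add: dist_ell2_def sgn_ell2_def uniformity_ell2_def open_ell2_def)

end

lemma norm_coord_le: "norm (coord c i) \<le> norm c"
proof -
  have "norm (coord c i) \<le> L2_set (\<lambda>i. norm (coord c i)) {..<Suc i}"
    by (rule member_le_L2_set) auto
  also have "\<dots> \<le> norm c" by (rule L2_set_coord_le)
  finally show ?thesis .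
qed

instance ell2 :: (rc_field) banach
proof
  fix X :: "nat \<Rightarrow> 'a ell2"
  assume X: "Cauchy X"
  have "Cauchy (\<lambda>n. coord (X n) i)" for i
  proof (rule metric_CauchyI)
    fix e :: real assume "0 < e"
    then obtain N where N: "\<forall>m\<ge>N. \<forall>n\<ge>N. dist (X m) (X n) < e"
      using metric_CauchyD[OF X] by blast
    have "dist (coord (X m) i) (coord (X n) i) \<le> dist (X m) (X n)" for m n
      using norm_coord_le[of "X m - X n" i] by (simp add: dist_norm minus_ell2.rep_eq)
    then show "\<exists>M. \<forall>m\<ge>M. \<forall>n\<ge>M. dist (coord (X m) i) (coord (X n) i) < e"
      using N by (meson le_less_trans)
  qed
  then have "\<exists>l. (\<lambda>n. coord (X n) i) \<longlonglongrightarrow> l" for i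
    using Cauchy_convergent_iff convergent_def by blast
  then obtain l where l: "\<And>i. (\<lambda>n. coord (X n) i) \<longlonglongrightarrow> l i"
    by metis
  have bound: "L2_set (\<lambda>i. norm (coord (X m) i - l i)) {..<k} \<le> e"
    if "\<forall>n\<ge>N. dist (X m) (X n) < e" for m N k and e :: real
  proof (rule LIMSEQ_le_const2)
    show "(\<lambda>n. L2_set (\<lambda>i. norm (coord (X m) i - coord (X n) i)) {..<k})
        \<longlonglongrightarrow> L2_set (\<lambda>i. norm (coord (X m) i - l i)) {..<k}"
      unfolding L2_set_def by (intro tendsto_intros l)
    show "\<exists>N. \<forall>n\<ge>N. L2_set (\<lambda>i. norm (coord (X m) i - coord (X n) i)) {..<k} \<le> e"
    proof (intro exI[of _ N] allI impI)
      fix n assume "N \<le> n"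
      then have "norm (X m - X n) < e" using that by (simp add: dist_norm)
      then show "L2_set (\<lambda>i. norm (coord (X m) i - coord (X n) i)) {..<k} \<le> e"
        using L2_set_coord_le[of "X m - X n" k] by (simp add: minus_ell2.rep_eq)
    qed
  qed
  have diff: "summable (\<lambda>i. (norm (coord (X m) i - l i))\<^sup>2)"
    if "\<forall>n\<ge>N. dist (X m) (X n) < e" for m N and e :: real
  proof (rule summableI_nonneg_bounded)
    fix k
    have "0 \<le> e" using bound[OF that, of 0] by simp
    then show "(\<Sum>i<k. (norm (coord (X m) i - l i))\<^sup>2) \<le> e\<^sup>2"
      using bound[OF that, of k] unfolding L2_set_def
      by (metis real_sqrt_le_iff real_sqrt_abs abs_of_nonneg)
  qed simp
  obtain M where M: "\<forall>n\<ge>M. dist (X M) (X n) < 1"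
    using metric_CauchyD[OF X, of 1] by (meson le_refl zero_less_one)
  have "summable (\<lambda>i. (norm (coord (X M) i + - (coord (X M) i - l i)))\<^sup>2)"
    by (intro square_summable_add summable_coord) (simp only: norm_minus_cancel diff[OF M])
  then have lsum: "summable (\<lambda>i. (norm (l i))\<^sup>2)" by simp
  define L where "L = Abs_ell2 l"
  have L: "coord L = l"
    using lsum by (simp add: L_def Abs_ell2_inverse)
  have "X \<longlonglongrightarrow> L"
  proof (rule metric_LIMSEQ_I)
    fix r :: real assume "0 < r"
    then obtain N where N: "\<forall>m\<ge>N. \<forall>n\<ge>N. dist (X m) (X n) < r / 2"
      using metric_CauchyD[OF X, of "r / 2"] by auto
    have "dist (X m) L \<le> r / 2" if "N \<le> m" for m
      unfolding dist_norm
      by (rule norm_ell2_leI) (use bound[of N m "r / 2"] N that in \<open>simp add: minus_ell2.rep_eq L\<close>)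
    then show "\<exists>N. \<forall>n\<ge>N. dist (X n) L < r"
      using \<open>0 < r\<close> by (intro exI[of _ N]) fastforce
  qed
  then show "convergent X" by (auto simp: convergent_def)
qed

definition ip_ell2 :: "'f::rc_field ell2 \<Rightarrow> 'f ell2 \<Rightarrow> 'f" where
  "ip_ell2 c d = (\<Sum>i. coord c i * conjugate (coord d i))"

lift_definition unit_ell2 :: "nat \<Rightarrow> 'f::rc_field ell2" is "\<lambda>k i. if i = k then 1 else 0"
  subgoal for k by (rule summable_finite[of "{k}"]) auto
  done

lemma conj_of_re_im:
  fixes x y :: "'f::rc_field"
  shows conj_add: "conjugate (x + y) = conjugate x + conjugate y"
    and conj_mult: "conjugate (x * y) = conjugate x * conjugate y"
    and conj_conj: "conjugate (conjugate x) = x"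
    and norm_conj: "norm (conjugate x) = norm x"
proof -
  obtain a b c d where x: "x = of_real a + of_real b * imag_unit"
    and y: "y = of_real c + of_real d * imag_unit"
    using re_im_exhaust by metis
  have cx: "conjugate x = of_real a - of_real b * imag_unit"
    and cy: "conjugate y = of_real c - of_real d * imag_unit"
    by (simp_all add: x y conj_re_im)
  have "x + y = of_real (a + c) + of_real (b + d) * imag_unit"
    by (simp add: x y algebra_simps)
  then have "conjugate (x + y) = of_real (a + c) - of_real (b + d) * imag_unit"
    by (simp only: conj_re_im)
  then show "conjugate (x + y) = conjugate x + conjugate y"
    by (simp add: cx cy algebra_simps)
  have "conjugate x = of_real a + of_real (- b) * imag_unit"
    by (simp add: cx)
  then have "conjugate (conjugate x) = of_real a - of_real (- b) * imag_unit"
    by (simp only: conj_re_im)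
  then show cc: "conjugate (conjugate x) = x"
    by (simp add: x)
  have "(of_real ((norm (conjugate x))\<^sup>2) :: 'f) = of_real ((norm x)\<^sup>2)"
    using mult_conj_self[of x] mult_conj_self[of "conjugate x"] cc by (simp add: mult.commute)
  then have "(norm (conjugate x))\<^sup>2 = (norm x)\<^sup>2"
    by (simp only: of_real_eq_iff)
  then show "norm (conjugate x) = norm x"
    by simp
  show "conjugate (x * y) = conjugate x * conjugate y"
  proof (cases "imag_unit = (0::'f)")
    case True
    then have "z = conjugate z" for z :: 'f
      using re_im_exhaust[of z] conj_re_im by (metis add.right_neutral diff_zero mult_zero_right)
    then show ?thesis by metis
  next
    case False
    then have i: "imag_unit * imag_unit = (- 1 :: 'f)"
      using imag_unit_cases by blast
    have i': "imag_unit * (imag_unit * z) = - z" for z :: 'f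
      using i by (metis mult.assoc mult_minus1)
    have "x * y = of_real (a * c - b * d) + of_real (a * d + b * c) * imag_unit"
      by (simp add: x y algebra_simps i i')
    then have "conjugate (x * y) = of_real (a * c - b * d) - of_real (a * d + b * c) * imag_unit"
      by (simp only: conj_re_im)
    then show ?thesis
      by (simp add: cx cy algebra_simps i i')
  qed
qed

lemma bounded_linear_conj: "bounded_linear (conjugate :: 'f::rc_field \<Rightarrow> 'f)"
proof (rule bounded_linear_intro)
  fix r and x :: 'f
  have "conjugate (of_real r :: 'f) = of_real r"
    using conj_re_im[of r 0] by simp
  then show "conjugate (r *\<^sub>R x) = r *\<^sub>R conjugate x"
    by (simp add: scaleR_conv_of_real conj_mult)
qed (auto simp: conj_add norm_conj intro: order_eq_refl[of _ "_ * 1"])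

lemma summable_ip_ell2: "summable (\<lambda>i. coord c i * conjugate (coord d i))"
proof (rule summable_comparison_test[OF exI[of _ 0]])
  show "summable (\<lambda>i. (norm (coord c i))\<^sup>2 + (norm (coord d i))\<^sup>2)"
    by (intro summable_add summable_coord)
  show "\<forall>i\<ge>0. norm (coord c i * conjugate (coord d i)) \<le> (norm (coord c i))\<^sup>2 + (norm (coord d i))\<^sup>2"
  proof (intro allI impI)
    fix i
    show "norm (coord c i * conjugate (coord d i)) \<le> (norm (coord c i))\<^sup>2 + (norm (coord d i))\<^sup>2"
      using sum_squares_bound[of "norm (coord c i)" "norm (coord d i)"]
        mult_nonneg_nonneg[OF norm_ge_zero[of "coord c i"] norm_ge_zero[of "coord d i"]]
      by (simp only: norm_mult norm_conj)
  qed
qed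

lemma hilbert_space_ell2: "hilbert_space scale_ell2 ip_ell2"
proof
  fix a b :: 'a and x y z :: "'a ell2" and r :: real
  show "scale_ell2 a (x + y) = scale_ell2 a x + scale_ell2 a y"
    by transfer (simp add: algebra_simps)
  show "scale_ell2 (a + b) x = scale_ell2 a x + scale_ell2 b x"
    by transfer (simp add: algebra_simps)
  show "scale_ell2 a (scale_ell2 b x) = scale_ell2 (a * b) x"
    by transfer (simp add: algebra_simps)
  show "scale_ell2 1 x = x"
    by transfer simp
  show "scale_ell2 (of_real r) x = r *\<^sub>R x"
    by transfer (simp add: scaleR_conv_of_real)
  show "ip_ell2 (x + y) z = ip_ell2 x z + ip_ell2 y z"
    unfolding ip_ell2_def
    by (simp add: plus_ell2.rep_eq distrib_right suminf_add summable_ip_ell2)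
  show "ip_ell2 (scale_ell2 a x) y = a * ip_ell2 x y"
    unfolding ip_ell2_def
    by (simp add: scale_ell2.rep_eq mult.assoc suminf_mult summable_ip_ell2)
  show "ip_ell2 y x = conjugate (ip_ell2 x y)"
    unfolding ip_ell2_def bounded_linear.suminf[OF bounded_linear_conj summable_ip_ell2]
    by (simp add: conj_mult conj_conj mult.commute)
  show "ip_ell2 x x = of_real ((norm x)\<^sup>2)"
    by (simp add: ip_ell2_def norm_ell2_def mult_conj_self suminf_of_real summable_coord suminf_nonneg
        del: of_real_power)
qed


section \<open>Frames\<close>

definition frame :: "('h::real_normed_vector \<Rightarrow> 'h \<Rightarrow> 'f::rc_field) \<Rightarrow> (nat \<Rightarrow> 'h) \<Rightarrow> bool" where
  "frame ip f \<longleftrightarrow>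
     (\<exists>A>0. \<exists>B>0. \<forall>x.
        summable (\<lambda>i. (norm (ip x (f i)))\<^sup>2) \<and>
        A * (norm x)\<^sup>2 \<le> (\<Sum>i. (norm (ip x (f i)))\<^sup>2) \<and>
        (\<Sum>i. (norm (ip x (f i)))\<^sup>2) \<le> B * (norm x)\<^sup>2)"

definition computable_frame ::
    "'s::{finite, zero_neq_one} itself \<Rightarrow> ('f::rc_field \<Rightarrow> 'h::banach \<Rightarrow> 'h) \<Rightarrow> ('h \<Rightarrow> 'h \<Rightarrow> 'f)
       \<Rightarrow> (nat \<Rightarrow> 'h) \<Rightarrow> (nat \<Rightarrow> 'h) \<Rightarrow> bool" where
  "computable_frame _ smul ip e f \<longleftrightarrow>
     computable_sequence (hilbert_rep smul e :: (nat \<Rightarrow> 's) \<rightharpoonup> 'h) f \<and> frame ip f"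

definition computable_dual_frame ::
    "'s::{finite, zero_neq_one} itself \<Rightarrow> ('f::rc_field \<Rightarrow> 'h::banach \<Rightarrow> 'h) \<Rightarrow> ('h \<Rightarrow> 'h \<Rightarrow> 'f)
       \<Rightarrow> (nat \<Rightarrow> 'h) \<Rightarrow> (nat \<Rightarrow> 'h) \<Rightarrow> (nat \<Rightarrow> 'h) \<Rightarrow> bool" where
  "computable_dual_frame S smul ip e f g \<longleftrightarrow>
     computable_frame S smul ip e g \<and> (\<forall>x. (\<lambda>i. smul (ip x (g i)) (f i)) sums x)"

text \<open>The upper frame bound makes the sequence below square-summable.\<close>

definition analysis :: "('h \<Rightarrow> 'h \<Rightarrow> 'f::rc_field) \<Rightarrow> (nat \<Rightarrow> 'h) \<Rightarrow> 'h \<Rightarrow> 'f ell2" where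
  "analysis ip f x = Abs_ell2 (\<lambda>k. ip x (f k))"

lemma coord_analysis: "frame ip f \<Longrightarrow> coord (analysis ip f x) = (\<lambda>k. ip x (f k))"
  unfolding analysis_def frame_def by (intro Abs_ell2_inverse) auto

end

theory Submission
  imports Defs "HOL-Library.Countable"
begin

text \<open>
  On the functional analytic side, a dual frame \<open>g\<close> and a left inverse \<open>V\<close> of the analysis
  operator of \<open>f\<close> determine each other by \<open>V c = (\<Sum>k. c\<^sub>k g\<^sub>k)\<close> and \<open>g\<^sub>k = V \<delta>\<^sub>k\<close>. If \<open>g\<close> is
  a dual frame, then the upper frame bound makes the series converge and \<open>V\<close> bounded, and
  \<open>V (T\<^sup>* x) = (\<Sum>k. \<langle>x, f\<^sub>k\<rangle> g\<^sub>k) = x\<close> because the roles of the two frames in a duality can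
  be exchanged (\<open>dual_frame_swap\<close>). Conversely, let \<open>V\<close> be a bounded left inverse. Then
  \<open>x = (\<Sum>k. \<langle>x, f\<^sub>k\<rangle> V \<delta>\<^sub>k)\<close>; the bound of \<open>V\<close> gives the upper frame bound of \<open>(V \<delta>\<^sub>k)\<close>, and
  this expansion together with the upper bound of \<open>f\<close> gives the lower one
  (\<open>frame_of_left_inverse\<close>). The boundedness of \<open>V\<close> follows from its computability: a
  machine has read only a finite part of the name of \<open>0\<close> when it commits itself to the first
  approximation of \<open>V 0\<close>, and every small vector has a name that begins with this part
  (\<open>computable_linear_bounded\<close>).

  It remains to compute \<open>V\<close> from \<open>g\<close> and \<open>g\<close> from \<open>V\<close>. All names involved are sequences of
  natural numbers, so the work is done with recursive functions on natural numbers, for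
  which two bridges to Turing machines are built. On the one hand, a recursive function of
  the position and of the current input number can be applied by a machine that reads and
  writes such sequences (\<open>machine_on_codes\<close>, \<open>machine_on_unary_words\<close>): recursive functions
  are computed by while programs on counters, and a counter is a work tape with one marked
  cell. On the other hand, the numbers that a machine writes on recursively given inputs
  form a recursive function (\<open>recursive_machine_output\<close>), because configurations can be
  coded and the transition table is finite. Instead of composing machines, one therefore
  composes functions.

  Thus a sequence is computable if and only if codes of its approximations are a recursive
  function of index and precision (\<open>computable_sequence_cauchy_rep\<close>). Given such codes for
  \<open>g\<close> and a rational vector \<open>c\<close> of finite support, \<open>V c\<close> is a finite linear combination, and
  a code of an approximation to it is found by rational arithmetic with a precision that
  depends on the coefficients (\<open>computable_synthesis\<close>); as \<open>V\<close> is bounded, approximations of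
  \<open>c\<close> are good enough. Given \<open>V\<close>, its machine is simulated on constant names of the unit
  vectors (\<open>computable_sequence_image_units\<close>).
\<close>

section \<open>Recursive functions\<close>

abbreviation pair :: "nat \<Rightarrow> nat \<Rightarrow> nat" where "pair a b \<equiv> prod_encode (a, b)"
abbreviation left :: "nat \<Rightarrow> nat" where "left x \<equiv> fst (prod_decode x)"
abbreviation right :: "nat \<Rightarrow> nat" where "right x \<equiv> snd (prod_decode x)"

text \<open>
  Unary functions suffice, since Cantor pairs pack several arguments into one. Every
  function in the class is total: a loop is admitted only if it ends from all its start
  values \<open>a x\<close>. Other values are exempt because, for instance, a search for a zero would not
  end if it were started beyond the last zero.
\<close>

inductive recursive :: "(nat \<Rightarrow> nat) \<Rightarrow> bool" where
  zero: "recursive (\<lambda>x. 0)"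
| Suc: "recursive (\<lambda>x. Suc x)"
| pred: "recursive (\<lambda>x. x - 1)"
| left: "recursive (\<lambda>x. left x)"
| right: "recursive (\<lambda>x. right x)"
| pair: "recursive f \<Longrightarrow> recursive g \<Longrightarrow> recursive (\<lambda>x. pair (f x) (g x))"
| comp: "recursive f \<Longrightarrow> recursive g \<Longrightarrow> recursive (\<lambda>x. f (g x))"
| loop: "recursive f \<Longrightarrow> recursive c \<Longrightarrow> recursive a \<Longrightarrow> (\<And>x. \<exists>n. c ((f ^^ n) (a x)) = 0) \<Longrightarrow>
    recursive (\<lambda>x. (f ^^ (LEAST n. c ((f ^^ n) (a x)) = 0)) (a x))"

named_theorems rec_intros

lemma recursive_id [rec_intros]: "recursive (\<lambda>x. x)"
  using recursive.pair[OF recursive.left recursive.right] by simp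

lemma recursive_Suc [rec_intros]: "recursive f \<Longrightarrow> recursive (\<lambda>x. Suc (f x))"
  and recursive_pred [rec_intros]: "recursive f \<Longrightarrow> recursive (\<lambda>x. f x - 1)"
  and recursive_left [rec_intros]: "recursive f \<Longrightarrow> recursive (\<lambda>x. left (f x))"
  and recursive_right [rec_intros]: "recursive f \<Longrightarrow> recursive (\<lambda>x. right (f x))"
  by (erule recursive.comp[rotated], rule recursive.intros)+

lemmas [rec_intros] = recursive.pair

lemma recursive_const [rec_intros]: "recursive (\<lambda>x. k)"
  by (induction k) (auto intro: recursive.zero recursive_Suc)

lemma recursive_binary:
  assumes "recursive (\<lambda>x. h (left x) (right x))" "recursive f" "recursive g"
  shows "recursive (\<lambda>x. h (f x) (g x))"
  using recursive.comp[OF assms(1) recursive.pair[OF assms(2,3)]] by simp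

text \<open>
  The pair of the current value and a countdown turns the conditional loop into a counted
  one.
\<close>

lemma recursive_funpow:
  assumes f: "recursive f" and a: "recursive a" and b: "recursive b"
  shows "recursive (\<lambda>x. (f ^^ b x) (a x))"
proof -
  define s where "s = (\<lambda>z. pair (f (left z)) (right z - 1))"
  have s: "recursive s"
    unfolding s_def by (intro rec_intros recursive.comp[OF f])
  have iter: "(s ^^ n) (pair y m) = pair ((f ^^ n) y) (m - n)" for n y m
    by (induction n) (simp_all add: s_def)
  have least: "(LEAST n. m - n = 0) = m" for m :: nat
    by (rule Least_equality) auto
  have "recursive (\<lambda>x. (s ^^ (LEAST n. right ((s ^^ n) (pair (a x) (b x))) = 0)) (pair (a x) (b x)))"
    by (rule recursive.loop[OF s recursive.right recursive.pair[OF a b]])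
      (auto simp: iter)
  from recursive_left[OF this] show ?thesis
    unfolding iter using least by simp
qed

text \<open>
  Primitive recursion is the iteration of \<open>\<langle>x, \<langle>n, y\<rangle>\<rangle> \<mapsto> \<langle>x, \<langle>n + 1, h x n y\<rangle>\<rangle>\<close>.
\<close>

lemma recursive_rec_nat:
  assumes "recursive (\<lambda>z. h (left z) (left (right z)) (right (right z)))"
    and a: "recursive a" and b: "recursive b"
  shows "recursive (\<lambda>x. rec_nat (a x) (h x) (b x))"
proof -
  define s where "s = (\<lambda>z. pair (left z) (pair (Suc (left (right z))) (h (left z) (left (right z)) (right
      (right z)))))"
  have s: "recursive s"
    unfolding s_def by (intro rec_intros assms)
  have iter: "(s ^^ n) (pair x (pair 0 y)) = pair x (pair n (rec_nat y (h x) n))" for n x y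
    by (induction n) (simp_all add: s_def)
  have "recursive (\<lambda>x. (s ^^ b x) (pair x (pair 0 (a x))))"
    by (intro recursive_funpow s b rec_intros a)
  from recursive_right[OF recursive_right[OF this]] show ?thesis
    unfolding iter by simp
qed

lemma recursive_if_zero:
  assumes c: "recursive c" and f: "recursive f" and g: "recursive g"
  shows "recursive (\<lambda>x. if c x = 0 then f x else g x)"
proof -
  have eq: "(if n = 0 then a else b) = rec_nat a (\<lambda>_ _. b) n" for n and a b :: nat
    by (cases n) auto
  show ?thesis
    unfolding eq by (rule recursive_rec_nat[OF recursive.comp[OF g recursive.left] f c])
qed

lemma recursive_add [rec_intros]: "recursive f \<Longrightarrow> recursive g \<Longrightarrow> recursive (\<lambda>x. f x + g x)"
proof -
  have "m + n = (Suc ^^ n) m" for m n by (induction n) auto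
  then show "recursive f \<Longrightarrow> recursive g \<Longrightarrow> recursive (\<lambda>x. f x + g x)"
    using recursive_funpow[OF recursive.Suc] by simp
qed

lemma recursive_diff [rec_intros]: "recursive f \<Longrightarrow> recursive g \<Longrightarrow> recursive (\<lambda>x. f x - g x)"
proof -
  have "((\<lambda>x. x - 1) ^^ n) m = m - n" for m n :: nat by (induction n) auto
  then show "recursive f \<Longrightarrow> recursive g \<Longrightarrow> recursive (\<lambda>x. f x - g x)"
    using recursive_funpow[OF recursive.pred, of f g] by simp
qed

lemma recursive_mult [rec_intros]:
  assumes "recursive f" "recursive g" shows "recursive (\<lambda>x. f x * g x)"
proof -
  have "m * n = rec_nat 0 (\<lambda>_ y. y + m) n" for m n :: nat by (induction n) auto
  then have "(\<lambda>x. f x * g x) = (\<lambda>x. rec_nat 0 (\<lambda>_ y. y + f x) (g x))" by auto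
  then show ?thesis
    using recursive_rec_nat[of "\<lambda>x _ y. y + f x" "\<lambda>_. 0" g] assms
    by (simp add: rec_intros recursive.comp[OF assms(1) recursive.left])
qed

lemma recursive_if_eq [rec_intros]:
  assumes "recursive c" "recursive d" "recursive f" "recursive g"
  shows "recursive (\<lambda>x. if c x = d x then f x else g x)"
proof -
  have "(c x = d x) = ((c x - d x) + (d x - c x) = 0)" for x by auto
  then show ?thesis
    by (simp only:) (intro recursive_if_zero assms rec_intros)
qed

lemma recursive_if_le [rec_intros]:
  assumes "recursive c" "recursive d" "recursive f" "recursive g"
  shows "recursive (\<lambda>x. if c x \<le> d x then f x else g x)"
proof -
  have "(c x \<le> d x) = (c x - d x = 0)" for x by auto
  then show ?thesis
    by (simp only:) (intro recursive_if_zero assms rec_intros)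
qed

lemma recursive_sum [rec_intros]:
  assumes "recursive (\<lambda>z. h (left z) (right z))" "recursive b"
  shows "recursive (\<lambda>x. \<Sum>i<b x. h x i)"
proof -
  have "(\<Sum>i<n. h x i) = rec_nat 0 (\<lambda>i y. y + h x i) n" for x n
    by (induction n) auto
  then show ?thesis
    using recursive_rec_nat[of "\<lambda>x i y. y + h x i" "\<lambda>_. 0" b] assms
    by (simp add: rec_intros recursive_binary[OF assms(1)])
qed

lemma recursive_Least:
  assumes h: "recursive (\<lambda>z. h (left z) (right z))" and ex: "\<And>x. \<exists>n. h x n = 0"
  shows "recursive (\<lambda>x. LEAST n. h x n = 0)"
proof -
  define s where "s = (\<lambda>z. pair (left z) (Suc (right z)))"
  have s: "recursive s"
    unfolding s_def by (intro rec_intros)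
  have iter: "(s ^^ n) (pair x 0) = pair x n" for n x
    by (induction n) (simp_all add: s_def)
  have "recursive (\<lambda>x. (s ^^ (LEAST n. h (left ((s ^^ n) (pair x 0))) (right ((s ^^ n) (pair x 0))) =
      0)) (pair x 0))"
    by (rule recursive.loop[OF s h]) (auto simp: iter ex intro!: rec_intros)
  from recursive_right[OF this] show ?thesis
    by (simp add: iter)
qed

lemma recursive_finite_support:
  assumes "\<And>x. N \<le> x \<Longrightarrow> f x = 0"
  shows "recursive f"
  using assms
proof (induction N arbitrary: f)
  case 0
  then have "f = (\<lambda>x. 0)" by auto
  then show ?case by (simp add: recursive.zero)
next
  case (Suc N)
  have "recursive (\<lambda>x. if x = N then f N else (f(N := 0)) x)"
    by (intro rec_intros Suc.IH) (use Suc.prems in \<open>auto simp: Suc_le_eq\<close>)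
  moreover have "(\<lambda>x. if x = N then f N else (f(N := 0)) x) = f" by auto
  ultimately show ?case by (simp only:)
qed

text \<open>
  This applies to the transition function of a machine, which has finitely many relevant
  arguments.
\<close>

lemma recursive_finite_table:
  assumes "finite S" "\<And>x. x \<notin> S \<Longrightarrow> f x = 0"
  shows "recursive f"
proof (rule recursive_finite_support)
  fix x assume "Suc (Max (insert 0 S)) \<le> x"
  then have "x \<notin> S"
    using assms(1) Max_ge[of "insert 0 S" x] by fastforce
  then show "f x = 0" by (rule assms)
qed

section \<open>While programs\<close>

text \<open>
  Programs act on registers for natural numbers. The only information they take from the
  input is whether the scanned symbol is 1, which is all that is needed to read numbers
  written in unary.
\<close>

datatype test = Nonzero nat | Input_one

datatype 's com =
    Skip | Inc nat | Dec nat | Out 's | Move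
  | Seq "'s com" "'s com"
  | If test "'s com" "'s com"
  | While test "'s com"

type_synonym 's store = "(nat \<Rightarrow> nat) \<times> nat \<times> 's list"

fun holds :: "(nat \<Rightarrow> 's::{finite, zero_neq_one}) \<Rightarrow> test \<Rightarrow> 's store \<Rightarrow> bool" where
  "holds p (Nonzero r) (R, i, w) \<longleftrightarrow> R r \<noteq> 0"
| "holds p Input_one (R, i, w) \<longleftrightarrow> p i = 1"

inductive exec :: "(nat \<Rightarrow> 's::{finite, zero_neq_one}) \<Rightarrow> 's com \<Rightarrow> 's store \<Rightarrow> 's store \<Rightarrow> bool"
  for p where
  Skip: "exec p Skip s s"
| Inc: "exec p (Inc r) (R, i, w) (R(r := Suc (R r)), i, w)"
| Dec: "exec p (Dec r) (R, i, w) (R(r := R r - 1), i, w)"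
| Out: "exec p (Out a) (R, i, w) (R, i, w @ [a])"
| Move: "exec p Move (R, i, w) (R, Suc i, w)"
| Seq: "exec p c s s' \<Longrightarrow> exec p d s' s'' \<Longrightarrow> exec p (Seq c d) s s''"
| IfT: "holds p b s \<Longrightarrow> exec p c s s' \<Longrightarrow> exec p (If b c d) s s'"
| IfF: "\<not> holds p b s \<Longrightarrow> exec p d s s' \<Longrightarrow> exec p (If b c d) s s'"
| WhileF: "\<not> holds p b s \<Longrightarrow> exec p (While b c) s s"
| WhileT: "holds p b s \<Longrightarrow> exec p c s s' \<Longrightarrow> exec p (While b c) s' s'' \<Longrightarrow> exec p (While b c) s s''"

text \<open>
  Describing the store after every round replaces an induction in each later use of a loop.
\<close>

lemma exec_while:
  assumes "\<And>k. k < n \<Longrightarrow> holds p b (S k) \<and> exec p c (S k) (S (Suc k))" "\<not> holds p b (S n)"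
  shows "exec p (While b c) (S 0) (S n)"
proof -
  have "exec p (While b c) (S (n - k)) (S n)" if "k \<le> n" for k
    using that
  proof (induction k)
    case 0
    then show ?case using assms(2) by (auto intro: exec.intros)
  next
    case (Suc k)
    then have "exec p (While b c) (S (Suc (n - Suc k))) (S n)" by (simp add: Suc_diff_Suc)
    with assms(1)[of "n - Suc k"] Suc.prems show ?case
      by (auto intro: exec.WhileT)
  qed
  from this[of n] show ?thesis by simp
qed

section \<open>Compilation\<close>

text \<open>
  \<open>JF b m\<close> continues at address \<open>m\<close> if the test \<open>b\<close> fails.
\<close>

datatype 's instr = INC nat | DEC nat | OUT 's | MOVE | JF test nat | JMP nat

fun istep :: "(nat \<Rightarrow> 's::{finite, zero_neq_one}) \<Rightarrow> 's instr \<Rightarrow> nat \<times> 's store \<Rightarrow> nat \<times> 's store" where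
  "istep p (INC r) (n, R, i, w) = (Suc n, R(r := Suc (R r)), i, w)"
| "istep p (DEC r) (n, R, i, w) = (Suc n, R(r := R r - 1), i, w)"
| "istep p (OUT a) (n, R, i, w) = (Suc n, R, i, w @ [a])"
| "istep p MOVE (n, R, i, w) = (Suc n, R, Suc i, w)"
| "istep p (JF b m) (n, s) = (if holds p b s then Suc n else m, s)"
| "istep p (JMP m) (n, s) = (m, s)"

text \<open>
  Execution rests at the end of the program. Capping the addresses there leaves only
  finitely many of them, which will be the states of a machine.
\<close>

definition pstep :: "(nat \<Rightarrow> 's::{finite, zero_neq_one}) \<Rightarrow> 's instr list \<Rightarrow> nat \<times> 's store \<Rightarrow> nat \<times> 's store" where
  "pstep p P c = (if fst c < length P then apfst (min (length P)) (istep p (P ! fst c) c) else c)"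

fun csize :: "'s com \<Rightarrow> nat" where
  "csize Skip = 0"
| "csize (Inc r) = 1"
| "csize (Dec r) = 1"
| "csize (Out a) = 1"
| "csize Move = 1"
| "csize (Seq c d) = csize c + csize d"
| "csize (If b c d) = csize c + csize d + 2"
| "csize (While b c) = csize c + 2"

text \<open>
  The code depends on the address \<open>n\<close> at which it is placed, so that jumps are absolute.
\<close>

fun compile :: "'s com \<Rightarrow> nat \<Rightarrow> 's instr list" where
  "compile Skip n = []"
| "compile (Inc r) n = [INC r]"
| "compile (Dec r) n = [DEC r]"
| "compile (Out a) n = [OUT a]"
| "compile Move n = [MOVE]"
| "compile (Seq c d) n = compile c n @ compile d (n + csize c)"
| "compile (If b c d) n =
     JF b (n + csize c + 2) # compile c (n + 1) @ JMP (n + csize c + csize d + 2) # compile d (n + csize c + 2)"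
| "compile (While b c) n = JF b (n + csize c + 2) # compile c (n + 1) @ [JMP n]"

lemma length_compile [simp]: "length (compile c n) = csize c"
  by (induction c arbitrary: n) auto

definition code_at :: "'a list \<Rightarrow> nat \<Rightarrow> 'a list \<Rightarrow> bool" where
  "code_at P n xs \<longleftrightarrow> (\<exists>ys zs. P = ys @ xs @ zs \<and> length ys = n)"

lemma code_at_append: "code_at P n (xs @ ys) \<longleftrightarrow> code_at P n xs \<and> code_at P (n + length xs) ys"
proof
  assume "code_at P n (xs @ ys)"
  then obtain us zs where "P = us @ (xs @ ys) @ zs" "length us = n" by (auto simp: code_at_def)
  then have "P = us @ xs @ (ys @ zs) \<and> P = (us @ xs) @ ys @ zs" "length us = n"
      "length (us @ xs) = n + length xs" by auto
  then show "code_at P n xs \<and> code_at P (n + length xs) ys"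
    unfolding code_at_def by blast
next
  assume "code_at P n xs \<and> code_at P (n + length xs) ys"
  then obtain us zs us' zs' where P: "P = us @ xs @ zs" "length us = n" "P = us' @ ys @ zs'"
      "length us' = n + length xs"
    unfolding code_at_def by blast
  then have "us @ xs = us'" by (metis append.assoc append_eq_append_conv length_append)
  then have "P = us @ (xs @ ys) @ zs'" using P(3) by simp
  then show "code_at P n (xs @ ys)" using P unfolding code_at_def by blast
qed

lemma code_at_Cons: "code_at P n (x # ys) \<longleftrightarrow> n < length P \<and> P ! n = x \<and> code_at P (Suc n) ys"
proof -
  have "code_at P n [x] \<longleftrightarrow> n < length P \<and> P ! n = x"
  proof
    assume "n < length P \<and> P ! n = x"
    then have "P = take n P @ [x] @ drop (Suc n) P" "length (take n P) = n"
      by (auto simp: id_take_nth_drop[symmetric])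
    then show "code_at P n [x]" unfolding code_at_def by blast
  qed (auto simp: code_at_def)
  with code_at_append[of P n "[x]" ys] show ?thesis by simp
qed

lemma code_at_length: "code_at P n xs \<Longrightarrow> n + length xs \<le> length P"
  by (auto simp: code_at_def)

definition reaches :: "(nat \<Rightarrow> 's::{finite, zero_neq_one}) \<Rightarrow> 's instr list \<Rightarrow> nat \<times> 's store \<Rightarrow> nat \<times> 's store
    \<Rightarrow> bool" where
  "reaches p P c c' \<longleftrightarrow> (\<exists>t. (pstep p P ^^ t) c = c')"

lemma reaches_refl: "reaches p P c c"
  unfolding reaches_def by (rule exI[of _ 0]) simp

lemma reaches_step: "reaches p P c c' \<Longrightarrow> pstep p P c' = c'' \<Longrightarrow> reaches p P c c''"
  unfolding reaches_def by (metis funpow.simps(2) comp_apply)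

lemma reaches_trans:
  assumes "reaches p P c c'" "reaches p P c' c''" shows "reaches p P c c''"
proof -
  obtain t t' where "(pstep p P ^^ t) c = c'" "(pstep p P ^^ t') c' = c''"
    using assms by (auto simp: reaches_def)
  then have "(pstep p P ^^ (t' + t)) c = c''" by (simp add: funpow_add)
  then show ?thesis unfolding reaches_def by blast
qed

lemma reaches_pstep: "reaches p P (pstep p P c) c' \<Longrightarrow> reaches p P c c'"
  using reaches_trans[OF reaches_step[OF reaches_refl refl]] .

text \<open>
  The surrounding program \<open>P\<close> is arbitrary, because the code of a subcommand is surrounded
  by that of the whole command when the induction hypothesis is used.
\<close>

lemma compile_correct:
  assumes "exec p c s s'" "code_at P n (compile c n)"
  shows "reaches p P (n, s) (n + csize c, s')"
  using assms
proof (induction arbitrary: n)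
  case (Skip s)
  then show ?case by (simp add: reaches_refl)
next
  case (Seq c s s' d s'')
  then show ?case by (fastforce simp: code_at_append add.assoc[symmetric] intro: reaches_trans)
next
  case (IfT b s c s' d)
  have ca: "code_at P (n + 1) (compile c (n + 1))" and n: "n < length P" "P ! n = JF b (n + csize c + 2)"
    and j: "n + 1 + csize c < length P" "P ! (n + 1 + csize c) = JMP (n + csize c + csize d + 2)"
    using IfT.prems by (auto simp: code_at_append code_at_Cons)
  have le: "n + csize c + csize d + 2 \<le> length P"
    using code_at_length[OF IfT.prems] by simp
  have "pstep p P (n, s) = (n + 1, s)" using n IfT.hyps by (simp add: pstep_def)
  then have "reaches p P (n, s) (n + 1 + csize c, s')"
    using IfT.IH[OF ca] by (metis reaches_pstep)
  then show ?case
    by (rule reaches_step) (use j le in \<open>simp add: pstep_def\<close>)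
next
  case (IfF b s d s' c)
  have ca: "code_at P (n + csize c + 2) (compile d (n + csize c + 2))"
    and n: "n < length P" "P ! n = JF b (n + csize c + 2)"
    using IfF.prems by (auto simp: code_at_append code_at_Cons)
  have le: "n + csize c + csize d + 2 \<le> length P"
    using code_at_length[OF IfF.prems] by simp
  have "pstep p P (n, s) = (n + csize c + 2, s)" using n IfF.hyps le by (simp add: pstep_def)
  then show ?case
    using IfF.IH[OF ca] by (metis (no_types, lifting) reaches_pstep add.commute add.left_commute csize.simps(7))
next
  case (WhileF b s c)
  have "n + csize c + 2 \<le> length P" "n < length P" "P ! n = JF b (n + csize c + 2)"
    using code_at_length[OF WhileF.prems] WhileF.prems by (auto simp: code_at_Cons)
  then have "pstep p P (n, s) = (n + csize c + 2, s)" using WhileF.hyps by (simp add: pstep_def)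
  then show ?case by (metis reaches_pstep reaches_refl add.assoc csize.simps(8))
next
  case (WhileT b s c s' s'')
  have ca: "code_at P (n + 1) (compile c (n + 1))" and n: "n < length P" "P ! n = JF b (n + csize c + 2)"
    and j: "n + 1 + csize c < length P" "P ! (n + 1 + csize c) = JMP n"
    using WhileT.prems by (auto simp: code_at_append code_at_Cons)
  have "pstep p P (n, s) = (n + 1, s)" using n WhileT.hyps by (simp add: pstep_def)
  then have "reaches p P (n, s) (n + 1 + csize c, s')"
    using WhileT.IH(1)[OF ca] by (metis reaches_pstep)
  then have "reaches p P (n, s) (n, s')"
    by (rule reaches_step) (use j n in \<open>simp add: pstep_def\<close>)
  then show ?case using WhileT.IH(2)[OF WhileT.prems] by (rule reaches_trans)
qed (auto simp: code_at_Cons pstep_def min_def intro: reaches_refl intro!: reaches_step[OF reaches_refl])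

section \<open>Turing machines\<close>

text \<open>
  The value of a counter is the distance of the head from a cell marked by 1. As tapes are
  recorded relative to their heads, the mark appears at position \<open>- n\<close>.
\<close>

definition counter_tape :: "nat \<Rightarrow> tape" where
  "counter_tape n = (\<lambda>i. if i = - int n then 1 else 0)"

text \<open>
  Here \<open>w ! r = 1\<close> says that the head of tape \<open>r\<close> is on the mark, that is, that counter \<open>r\<close>
  is zero.
\<close>

fun instr_moves :: "'s::{finite, zero_neq_one} instr \<Rightarrow> nat \<Rightarrow> 's \<Rightarrow> nat list \<Rightarrow> nat \<times> direction \<times> (nat \<Rightarrow>
    direction) \<times> 's option" where
  "instr_moves (INC r) n a w = (Suc n, Stay, (\<lambda>_. Stay)(r := Right), None)"
| "instr_moves (DEC r) n a w = (Suc n, Stay, (\<lambda>_. Stay)(r := if w ! r = 1 then Stay else Left), None)"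
| "instr_moves (OUT b) n a w = (Suc n, Stay, (\<lambda>_. Stay), Some b)"
| "instr_moves MOVE n a w = (Suc n, Right, (\<lambda>_. Stay), None)"
| "instr_moves (JMP m) n a w = (m, Stay, (\<lambda>_. Stay), None)"
| "instr_moves (JF (Nonzero r) m) n a w = (if w ! r \<noteq> 1 then Suc n else m, Stay, (\<lambda>_. Stay), None)"
| "instr_moves (JF Input_one m) n a w = (if a = 1 then Suc n else m, Stay, (\<lambda>_. Stay), None)"

text \<open>
  State 0 puts the mark on every work tape, state \<open>q + 1\<close> executes the instruction at
  address \<open>q\<close>, and the last state loops without output.
\<close>

definition program_transition ::
    "'s::{finite, zero_neq_one} instr list \<Rightarrow> nat \<Rightarrow> nat \<Rightarrow> 's \<Rightarrow> nat list
      \<Rightarrow> nat \<times> direction \<times> (nat \<times> direction) list \<times> 's option" where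
  "program_transition P k q a w =
     (if q = 0 then (1, Stay, replicate k (1, Stay), None)
      else if q - 1 < length P then
        (case instr_moves (P ! (q - 1)) (q - 1) a w of (n, d, ds, out) \<Rightarrow>
           (Suc (min (length P) n), d, map (\<lambda>r. (w ! r, ds r)) [0..<k], out))
      else (q, Stay, map (\<lambda>r. (w ! r, Stay)) [0..<k], None))"

definition program_machine :: "'s::{finite, zero_neq_one} instr list \<Rightarrow> nat \<Rightarrow> 's machine" where
  "program_machine P k =
     \<lparr>states = length P + 2, work_tapes = k, symbols = 2, transition = program_transition P k\<rparr>"

lemma machine_program_machine: "machine (program_machine P k)"
proof -
  have "w ! r < 2" if "set w \<subseteq> {..<2}" "r < length w" for w :: "nat list" and r
    using that nth_mem by blast
  then show ?thesis
    by (auto simp: machine_def program_machine_def program_transition_def image_subset_iff split: prod.splits)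
qed

fun register_bound :: "'s instr \<Rightarrow> nat" where
  "register_bound (INC r) = Suc r"
| "register_bound (DEC r) = Suc r"
| "register_bound (JF (Nonzero r) m) = Suc r"
| "register_bound _ = 0"

fun conf :: "nat \<Rightarrow> nat \<times> 's store \<Rightarrow> 's configuration" where
  "conf k (n, R, i, w) =
     \<lparr>state = Suc n, input_pos = i, tapes = map (\<lambda>r. counter_tape (R r)) [0..<k], written = w\<rparr>"

lemma counter_tape_head: "counter_tape n 0 = (if n = 0 then 1 else 0)"
  by (simp add: counter_tape_def)

lemma map2_map_map_upt: "map2 f (map g [0..<k]) (map h [0..<k]) = map (\<lambda>r. f (g r) (h r)) [0..<k]"
  by (rule nth_equalityI) auto

lemma step_program_machine:
  assumes bound: "\<And>x. x \<in> set P \<Longrightarrow> register_bound x \<le> k"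
  shows "step (program_machine P k) p (conf k (n, s)) = conf k (pstep p P (n, s))"
proof -
  obtain R i w where s: "s = (R, i, w)" by (cases s)
  show ?thesis
  proof (cases "n < length P")
    case False
    then show ?thesis
      by (auto simp: s step_def program_machine_def program_transition_def pstep_def map2_map_map_upt
        intro!: nth_equalityI)
  next
    case True
    then have "register_bound (P ! n) \<le> k" by (intro bound nth_mem)
    with True show ?thesis
      apply (cases "(P ! n, n, p i, map (\<lambda>r. counter_tape (R r) 0) [0..<k])" rule: instr_moves.cases)
      apply (auto simp: s step_def program_machine_def program_transition_def pstep_def map2_map_map_upt
        comp_def counter_tape_head intro!: nth_equalityI)
      apply (auto simp: counter_tape_def fun_eq_iff)
      done
  qed
qed

text \<open>
  The machine is one step late, because its first step writes the marks.
\<close>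

lemma output_program_machine:
  assumes bound: "\<And>x. x \<in> set P \<Longrightarrow> register_bound x \<le> k"
  shows "output_after (program_machine P k) p (Suc t) = snd (snd (snd ((pstep p P ^^ t) (0, (\<lambda>_. 0), 0, []))))"
proof -
  let ?s = "(0, (\<lambda>_. 0), 0, []) :: nat \<times> 's store"
  have "counter_tape 0 = (\<lambda>_. 0)(0 := 1)"
    by (auto simp: counter_tape_def)
  then have init: "step (program_machine P k) p (initial (program_machine P k)) = conf k ?s"
    by (auto simp: initial_def step_def program_machine_def program_transition_def map_replicate_const
       intro!: nth_equalityI)
  have step: "step (program_machine P k) p (conf k (n, s)) = conf k (pstep p P (n, s))" for n s
    by (rule step_program_machine[OF bound])
  have "(step (program_machine P k) p ^^ Suc t) (initial (program_machine P k)) = conf k ((pstep p P ^^ t) ?s)"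
  proof (induction t)
    case 0
    show ?case using init by simp
  next
    case (Suc t)
    then show ?case
      using step by (metis funpow.simps(2) comp_apply surj_pair)
  qed
  moreover have "written (conf k c) = snd (snd (snd c))" for c :: "nat \<times> 's store"
    by (cases c) auto
  ultimately show ?thesis
    unfolding output_after_def by simp
qed

text \<open>
  A machine that writes an infinite word repeats a program forever. Its output is known from
  the stores \<open>S i\<close> between the rounds, since output is only ever appended.
\<close>

lemma loop_machine:
  fixes init body :: "'s::{finite, zero_neq_one} com"
  obtains M :: "'s machine" where "machine M"
    "\<And>p q S. exec p init (\<lambda>_. 0, 0, []) (S 0) \<Longrightarrow> (\<And>i. exec p body (S i) (S (Suc i))) \<Longrightarrow>
       (\<And>i. i \<le> length (snd (snd (S i)))) \<Longrightarrow> (\<And>i j. j < length (snd (snd (S i))) \<Longrightarrow> snd (snd (S i)) ! j = q j) \<Longrightarrow>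
       transforms M p q"
proof -
  define n where "n = csize init"
  define P where "P = compile init 0 @ compile body n @ [JMP n]"
  define k where "k = sum_list (map register_bound P)"
  have bound: "register_bound x \<le> k" if "x \<in> set P" for x
    unfolding k_def using that by (intro member_le_sum_list) auto
  show thesis
  proof (rule that[OF machine_program_machine[of P k]])
    fix p q and S :: "nat \<Rightarrow> 's store"
    have out: "output_after (program_machine P k) p (Suc t) =
        snd (snd (snd ((pstep p P ^^ t) (0, (\<lambda>_. 0), 0, []))))" for t
      by (rule output_program_machine[OF bound])
    assume init: "exec p init (\<lambda>_. 0, 0, []) (S 0)" and body: "\<And>i. exec p body (S i) (S (Suc i))"
      and len: "\<And>i. i \<le> length (snd (snd (S i)))"
      and q: "\<And>i j. j < length (snd (snd (S i))) \<Longrightarrow> snd (snd (S i)) ! j = q j"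
    have "code_at P 0 P" unfolding code_at_def by auto
    then have c: "code_at P 0 (compile init 0)" "code_at P n (compile body n)"
      and jmp: "n + csize body < length P" "P ! (n + csize body) = JMP n"
      by (subst (asm) (2) P_def, auto simp: code_at_append code_at_Cons n_def)+
    have "reaches p P (0, (\<lambda>_. 0), 0, []) (n, S i)" for i
    proof (induction i)
      case 0
      show ?case using compile_correct[OF init c(1)] by (simp add: n_def)
    next
      case (Suc i)
      have "reaches p P (n, S i) (n, S (Suc i))"
        by (rule reaches_step[OF compile_correct[OF body c(2)]]) (use jmp in \<open>simp add: pstep_def\<close>)
      with Suc show ?case by (rule reaches_trans)
    qed
    then have "\<exists>t. output_after (program_machine P k) p t = snd (snd (S i))" for i
      using out unfolding reaches_def by (metis snd_conv)
    then show "transforms (program_machine P k) p q"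
      unfolding transforms_def using len q by (metis Suc_le_lessD)
  qed
qed

section \<open>Programs for recursive functions\<close>

lemma exec_Inc': "s' = (R(r := Suc (R r)), i, w) \<Longrightarrow> exec p (Inc r) (R, i, w) s'"
  and exec_Dec': "s' = (R(r := R r - 1), i, w) \<Longrightarrow> exec p (Dec r) (R, i, w) s'"
  and exec_Out': "s' = (R, i, w @ [a]) \<Longrightarrow> exec p (Out a) (R, i, w) s'"
  and exec_Move': "s' = (R, Suc i, w) \<Longrightarrow> exec p Move (R, i, w) s'"
  by (simp_all only: exec.intros)

definition clear :: "nat \<Rightarrow> 's com" where
  "clear r = While (Nonzero r) (Dec r)"

lemma exec_clear: "s' = (R(r := 0), i, w) \<Longrightarrow> exec p (clear r) (R, i, w) s'"
proof -
  have "exec p (clear r) (R(r := R r - 0), i, w) (R(r := R r - R r), i, w)"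
    unfolding clear_def
    by (rule exec_while[of "R r" p "Nonzero r" "\<lambda>k. (R(r := R r - k), i, w)"])
      (auto intro!: exec_Dec')
  then show "s' = (R(r := 0), i, w) \<Longrightarrow> exec p (clear r) (R, i, w) s'" by simp
qed

definition shift :: "nat \<Rightarrow> nat \<Rightarrow> 's com" where
  "shift r s = While (Nonzero r) (Seq (Dec r) (Inc s))"

lemma exec_shift:
  assumes "r \<noteq> s" "s' = (R(r := 0, s := R s + R r), i, w)"
  shows "exec p (shift r s) (R, i, w) s'"
proof -
  let ?S = "\<lambda>k. (R(r := R r - k, s := R s + k), i, w)"
  have "exec p (shift r s) (?S 0) (?S (R r))"
    unfolding shift_def
    by (rule exec_while) (use assms(1) in \<open>auto intro!: exec.Seq[OF exec.Dec] exec_Inc'\<close>)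
  then show ?thesis using assms by (simp add: fun_upd_twist)
qed

text \<open>
  Register \<open>t\<close> is used as an intermediate store, from which \<open>r\<close> is restored.
\<close>

definition copy :: "nat \<Rightarrow> nat \<Rightarrow> nat \<Rightarrow> 's com" where
  "copy r s t = Seq (shift r t) (While (Nonzero t) (Seq (Dec t) (Seq (Inc r) (Inc s))))"

lemma exec_copy:
  assumes "r \<noteq> s" "r \<noteq> t" "s \<noteq> t" "R t = 0" "s' = (R(s := R s + R r), i, w)"
  shows "exec p (copy r s t) (R, i, w) s'"
proof -
  let ?S = "\<lambda>k. (R(t := R r - k, r := k, s := R s + k), i, w)"
  have "exec p (While (Nonzero t) (Seq (Dec t) (Seq (Inc r) (Inc s)))) (?S 0) (?S (R r))"
    by (rule exec_while)
      (use assms(1-3) in \<open>auto simp: fun_eq_iff intro!: exec.Seq[OF exec.Dec] exec.Seq[OF exec.Inc] exec_Inc'\<close>)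
  moreover have "exec p (shift r t) (R, i, w) (?S 0)"
    by (rule exec_shift) (use assms(1-4) in \<open>auto simp: fun_eq_iff\<close>)
  moreover have "?S (R r) = s'"
    using assms by (auto simp: fun_eq_iff)
  ultimately show ?thesis unfolding copy_def by (metis exec.Seq)
qed

lemma prod_decode_0 [simp]: "prod_decode 0 = (0, 0)"
  by (simp add: prod_decode_def prod_decode_aux.simps)

text \<open>
  Cantor pairing enumerates the pairs along the diagonals \<open>m + n = const\<close>; from the end
  \<open>(m, 0)\<close> of one diagonal it proceeds to the start \<open>(0, m + 1)\<close> of the next.
\<close>

lemma prod_decode_Suc:
  "prod_decode (Suc k) =
     (if right k = 0 then (0, Suc (left k)) else (Suc (left k), right k - 1))"
proof -
  obtain m n where k: "k = pair m n" by (metis prod_decode_inverse surj_pair)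
  show ?thesis
  proof (cases n)
    case 0
    then have "Suc k = pair 0 (Suc m)" by (simp add: k prod_encode_def)
    then have "prod_decode (Suc k) = (0, Suc m)" by (simp only: prod_encode_inverse)
    then show ?thesis by (simp add: k 0)
  next
    case (Suc l)
    then have "Suc k = pair (Suc m) l" by (simp add: k prod_encode_def)
    then have "prod_decode (Suc k) = (Suc m, l)" by (simp only: prod_encode_inverse)
    then show ?thesis by (simp add: k Suc)
  qed
qed

text \<open>
  The registers \<open>b + 1\<close> and \<open>b + 2\<close> walk through the pairs in the order of their codes while
  \<open>b\<close> is counted down.
\<close>

definition decode :: "nat \<Rightarrow> 's com" where
  "decode b = While (Nonzero b) (Seq (Dec b)
     (If (Nonzero (b + 2)) (Seq (Dec (b + 2)) (Inc (b + 1))) (Seq (Inc (b + 2)) (shift (b + 1) (b + 2)))))"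

lemma exec_decode:
  assumes "R (b + 1) = 0" "R (b + 2) = 0"
    "s' = (R(b := 0, b + 1 := left (R b), b + 2 := right (R b)), i, w)"
  shows "exec p (decode b) (R, i, w) s'"
proof -
  let ?S = "\<lambda>k. (R(b := R b - k, b + 1 := left k, b + 2 := right k), i, w)"
  have "exec p (decode b) (?S 0) (?S (R b))"
    unfolding decode_def
  proof (rule exec_while)
    fix k assume k: "k < R b"
    show "holds p (Nonzero b) (?S k) \<and> exec p (Seq (Dec b)
     (If (Nonzero (b + 2)) (Seq (Dec (b + 2)) (Inc (b + 1))) (Seq (Inc (b + 2)) (shift (b + 1) (b + 2)))))
       (?S k) (?S (Suc k))"
    proof (cases "right k = 0")
      case True
      then show ?thesis using k
        by (intro conjI exec.Seq[OF exec.Dec] exec.Seq[OF exec.Inc] exec.IfF exec_shift)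
          (auto simp: prod_decode_Suc fun_eq_iff)
    next
      case False
      then show ?thesis using k
        by (intro conjI exec.Seq[OF exec.Dec] exec.IfT exec_Inc')
          (auto simp: prod_decode_Suc fun_eq_iff)
    qed
  qed auto
  moreover have "?S 0 = (R, i, w)" using assms by (auto simp: fun_eq_iff)
  ultimately show ?thesis using assms(3) by simp
qed

text \<open>
  The code of \<open>(m, n)\<close> is \<open>m\<close> plus the triangular number of \<open>m + n\<close>, which is the sum of the
  values that register \<open>b + 1\<close> takes while it is counted down from \<open>m + n\<close>.
\<close>

definition encode :: "nat \<Rightarrow> 's com" where
  "encode b = Seq (copy (b + 1) b (b + 3)) (Seq (shift (b + 2) (b + 1))
     (While (Nonzero (b + 1)) (Seq (copy (b + 1) b (b + 3)) (Dec (b + 1)))))"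

lemma exec_encode:
  assumes "R b = 0" "R (b + 3) = 0"
    "s' = (R(b := pair (R (b + 1)) (R (b + 2)), b + 1 := 0, b + 2 := 0), i, w)"
  shows "exec p (encode b) (R, i, w) s'"
proof -
  define m n where "m = R (b + 1)" and "n = R (b + 2)"
  define S where "S = (\<lambda>k. (R(b := m + (triangle (m + n) - triangle (m + n - k)), b + 1 := m + n - k,
      b + 2 := 0), i, w))"
  have tri: "triangle (m + n - k) = triangle (m + n - Suc k) + (m + n - k)" if "k < m + n" for k
    using that triangle_Suc[of "m + n - Suc k"] by (simp add: Suc_diff_Suc)
  have mono: "triangle (m + n - k) \<le> triangle (m + n)" for k
  proof (induction k)
    case (Suc k) then show ?case using tri[of k] by (cases "k < m + n") auto
  qed simp
  have "exec p (While (Nonzero (b + 1)) (Seq (copy (b + 1) b (b + 3)) (Dec (b + 1)))) (S 0) (S (m + n))"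
  proof (rule exec_while)
    fix k assume k: "k < m + n"
    show "holds p (Nonzero (b + 1)) (S k) \<and> exec p (Seq (copy (b + 1) b (b + 3)) (Dec (b + 1))) (S k) (S
        (Suc k))"
      unfolding S_def using k tri[OF k] mono[of k] assms(2)
      by (auto simp: fun_eq_iff intro!: exec.Seq[OF exec_copy[OF _ _ _ _ refl]] exec_Dec')
  qed (auto simp: S_def)
  moreover have "exec p (copy (b + 1) b (b + 3)) (R, i, w) (R(b := m), i, w)"
    by (rule exec_copy) (use assms in \<open>auto simp: m_def\<close>)
  moreover have "exec p (shift (b + 2) (b + 1)) (R(b := m), i, w) (S 0)"
    by (rule exec_shift) (use assms in \<open>auto simp: m_def n_def S_def fun_eq_iff\<close>)
  moreover have "S (m + n) = s'"
    using assms by (auto simp: S_def fun_eq_iff m_def n_def prod_encode_def)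
  ultimately show ?thesis unfolding encode_def by (metis exec.Seq)
qed

text \<open>
  All registers above \<open>b\<close> are scratch: zero before and zero again afterwards. Everything
  below is left alone, so a program can call another one on a higher register without saving
  anything.
\<close>

definition computes_at :: "nat \<Rightarrow> 's::{finite, zero_neq_one} com \<Rightarrow> (nat \<Rightarrow> nat) \<Rightarrow> bool" where
  "computes_at b c f \<longleftrightarrow>
     (\<forall>p R i w. (\<forall>r>b. R r = 0) \<longrightarrow> exec p c (R, i, w) (R(b := f (R b)), i, w))"

lemma computes_atD:
  "computes_at b c f \<Longrightarrow> (\<And>r. b < r \<Longrightarrow> R r = 0) \<Longrightarrow> s' = (R(b := f (R b)), i, w) \<Longrightarrow> exec p c (R, i, w) s'"
  by (auto simp: computes_at_def)

lemma recursive_computes_at: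
  "recursive f \<Longrightarrow> \<exists>c :: 's::{finite, zero_neq_one} com. computes_at b c f"
proof (induction arbitrary: b rule: recursive.induct)
  case zero
  have "computes_at b (clear b) (\<lambda>x. 0)"
    by (auto simp: computes_at_def intro: exec_clear)
  then show ?case by blast
next
  case Suc
  have "computes_at b (Inc b) Suc"
    by (auto simp: computes_at_def intro: exec.intros)
  then show ?case by blast
next
  case pred
  have "computes_at b (Dec b) (\<lambda>x. x - 1)"
    unfolding computes_at_def by (intro allI impI exec.intros)
  then show ?case by blast
next
  case left
  have "computes_at b (Seq (decode b) (Seq (clear (b + 2)) (shift (b + 1) b))) (\<lambda>x. left x)"
    unfolding computes_at_def
    by (auto simp: fun_eq_iff intro!: exec.Seq[OF exec_decode[OF _ _ refl]] exec.Seq[OF exec_clear[OF refl]]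
        exec_shift)
  then show ?case by blast
next
  case right
  have "computes_at b (Seq (decode b) (Seq (clear (b + 1)) (shift (b + 2) b))) (\<lambda>x. right x)"
    unfolding computes_at_def
    by (auto simp: fun_eq_iff intro!: exec.Seq[OF exec_decode[OF _ _ refl]] exec.Seq[OF exec_clear[OF refl]]
        exec_shift)
  then show ?case by blast
next
  case (pair f g)
  obtain cf cg :: "'s com" where cf: "computes_at (b + 1) cf f" and cg: "computes_at (b + 2) cg g"
    using pair.IH by meson
  let ?c = "Seq (copy b (b + 1) (b + 2)) (Seq cf (Seq (copy b (b + 2) (b + 3)) (Seq cg (Seq (clear b)
      (encode b)))))"
  have "computes_at b ?c (\<lambda>x. pair (f x) (g x))"
    unfolding computes_at_def
    by (auto simp: fun_eq_iff intro!: exec.Seq[OF exec_copy[OF _ _ _ _ refl]] exec.Seq[OF computes_atD[OF cf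
        _ refl]]
        exec.Seq[OF computes_atD[OF cg _ refl]] exec.Seq[OF exec_clear[OF refl]] exec_encode)
  then show ?case by blast
next
  case (comp f g)
  obtain cf cg :: "'s com" where cf: "computes_at b cf f" and cg: "computes_at b cg g"
    using comp.IH by meson
  have "computes_at b (Seq cg cf) (\<lambda>x. f (g x))"
    unfolding computes_at_def
    by (auto intro!: exec.Seq[OF computes_atD[OF cg _ refl]] computes_atD[OF cf])
  then show ?case by blast
next
  case (loop f c a)
  obtain cf cc ca :: "'s com" where cf: "computes_at b cf f" and cc: "computes_at (b + 1) cc c"
      and ca: "computes_at b ca a"
    using loop.IH by meson
  let ?body = "Seq (clear (b + 1)) (Seq cf (Seq (copy b (b + 1) (b + 2)) cc))"
  let ?c = "Seq ca (Seq (copy b (b + 1) (b + 2)) (Seq cc (While (Nonzero (b + 1)) ?body)))"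
  define N where "N = (\<lambda>x. LEAST n. c ((f ^^ n) (a x)) = 0)"
  have "computes_at b ?c (\<lambda>x. (f ^^ N x) (a x))"
    unfolding computes_at_def
  proof (intro allI impI)
    fix p :: "nat \<Rightarrow> 's" and R :: "nat \<Rightarrow> nat" and i :: nat and w :: "'s list"
    assume R: "\<forall>r>b. R r = 0"
    let ?S = "\<lambda>k. (R(b := (f ^^ k) (a (R b)), b + 1 := c ((f ^^ k) (a (R b)))), i, w)"
    have "exec p (While (Nonzero (b + 1)) ?body) (?S 0) (?S (N (R b)))"
    proof (rule exec_while)
      fix k assume "k < N (R b)"
      then have "c ((f ^^ k) (a (R b))) \<noteq> 0" unfolding N_def by (rule not_less_Least)
      then show "holds p (Nonzero (b + 1)) (?S k) \<and> exec p ?body (?S k) (?S (Suc k))"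
        using R by (intro conjI exec.Seq[OF exec_clear[OF refl]] exec.Seq[OF computes_atD[OF cf _ refl]]
          exec.Seq[OF exec_copy[OF _ _ _ _ refl]] computes_atD[OF cc]) (auto simp: fun_eq_iff)
    next
      show "\<not> holds p (Nonzero (b + 1)) (?S (N (R b)))"
        using LeastI_ex[OF loop.hyps(4)] by (simp add: N_def)
    qed
    moreover have "?S (N (R b)) = (R(b := (f ^^ N (R b)) (a (R b))), i, w)"
      using LeastI_ex[OF loop.hyps(4)] R by (simp add: N_def fun_eq_iff)
    ultimately have "exec p (While (Nonzero (b + 1)) ?body) (?S 0) (R(b := (f ^^ N (R b)) (a (R b))), i, w)"
      by simp
    moreover have "exec p cc (R(b := a (R b), b + 1 := a (R b)), i, w) (?S 0)"
      by (rule computes_atD[OF cc]) (use R in \<open>auto simp: fun_eq_iff\<close>)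
    moreover have "exec p (copy b (b + 1) (b + 2)) (R(b := a (R b)), i, w) (R(b := a (R b),
        b + 1 := a (R b)), i, w)"
      by (rule exec_copy) (use R in auto)
    moreover have "exec p ca (R, i, w) (R(b := a (R b)), i, w)"
      by (rule computes_atD[OF ca]) (use R in auto)
    ultimately show "exec p ?c (R, i, w) (R(b := (f ^^ N (R b)) (a (R b))), i, w)"
      by (intro exec.Seq)
  qed
  then show ?case unfolding N_def by blast
qed

section \<open>Words of blocks\<close>

definition blocks :: "(nat \<Rightarrow> nat) \<Rightarrow> nat \<Rightarrow> 's::{finite, zero_neq_one} list" where
  "blocks m i = concat (map (\<lambda>j. 0 # replicate (Suc (m j)) 1) [0..<i])"

text \<open>
  Every block has at least two letters, so position \<open>j\<close> lies within the first \<open>j + 1\<close>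
  blocks. The result is the only word \<open>p\<close> with \<open>codes p m\<close>.
\<close>

definition code_word :: "(nat \<Rightarrow> nat) \<Rightarrow> nat \<Rightarrow> 's::{finite, zero_neq_one}" where
  "code_word m j = blocks m (Suc j) ! j"

definition block_start :: "(nat \<Rightarrow> nat) \<Rightarrow> nat \<Rightarrow> nat" where
  "block_start m i = (\<Sum>j<i. m j + 2)"

lemma block_start_0 [simp]: "block_start m 0 = 0"
  and block_start_Suc [simp]: "block_start m (Suc i) = Suc (Suc (block_start m i + m i))"
  by (simp_all add: block_start_def)

lemma codes_iff_block_start:
  "codes p m \<longleftrightarrow>
     (\<forall>i. p (block_start m i) = 0 \<and> (\<forall>k \<le> m i. p (Suc (block_start m i + k)) = 1))"
  by (simp add: codes_def block_start_def)

lemma blocks_0 [simp]: "blocks m 0 = []"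
  and blocks_Suc: "blocks m (Suc i) = blocks m i @ 0 # replicate (Suc (m i)) 1"
  by (simp_all add: blocks_def)

lemma length_blocks: "length (blocks m i) = block_start m i"
  by (induction i) (simp_all add: blocks_Suc)

lemma le_block_start: "i \<le> block_start m i"
  by (induction i) (auto intro: order_trans)

lemma codes_block_word:
  assumes "codes p m" "j < block_start m i"
  shows "p j = blocks m i ! j"
  using assms(2)
proof (induction i)
  case (Suc i)
  show ?case
  proof (cases "j < block_start m i")
    case True
    then show ?thesis using Suc by (simp add: blocks_Suc nth_append length_blocks)
  next
    case False
    define k where "k = j - block_start m i"
    have j: "j = block_start m i + k" using False by (simp add: k_def)
    have k: "k < m i + 2" using Suc.prems j by simp
    have "p (block_start m i) = 0" "\<forall>k\<le>m i. p (Suc (block_start m i + k)) = 1"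
      using assms(1) unfolding codes_iff_block_start by blast+
    then show ?thesis
      using k unfolding j by (cases k) (auto simp: blocks_Suc nth_append length_blocks nth_Cons')
  qed
qed simp

lemma blocks_nth_eq:
  "j < block_start m i \<Longrightarrow> j < block_start m i' \<Longrightarrow>
    (blocks m i ! j :: 's::{finite, zero_neq_one}) = blocks m i' ! j"
proof (induction i i' rule: linorder_wlog)
  case (le i i')
  have "[0..<i'] = [0..<i] @ [i..<i']"
    using upt_add_eq_append[of 0 i "i' - i"] le(1) by simp
  then have "(blocks m i' :: 's list) = blocks m i @ concat (map (\<lambda>j. 0 # replicate (Suc (m j)) 1) [i..<i'])"
    unfolding blocks_def by (simp only: map_append concat_append)
  then show ?case using le by (simp add: nth_append length_blocks)
qed (simp add: eq_commute)

lemma blocks_nth: "j < block_start m i \<Longrightarrow> blocks m i ! j = code_word m j"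
  unfolding code_word_def by (rule blocks_nth_eq) (use le_block_start[of "Suc j" m] in \<open>simp_all only:
      Suc_le_eq\<close>)

lemma codes_iff: "codes (p :: nat \<Rightarrow> 's::{finite, zero_neq_one}) m \<longleftrightarrow> p = code_word m"
proof
  assume "codes p m"
  then have "p j = code_word m j" for j
    unfolding code_word_def using codes_block_word[of p m j "Suc j"] le_block_start[of "Suc j" m]
    by (simp only: Suc_le_eq)
  then show "p = code_word m" ..
next
  assume p: "p = code_word m"
  show "codes p m"
    unfolding codes_iff_block_start p
  proof (intro allI conjI impI)
    fix i k
    have nth: "(blocks m (Suc i) ! j :: 's) = code_word m j" if "j < block_start m (Suc i)" for j
      using that by (rule blocks_nth)
    have "blocks m (Suc i) ! block_start m i = (0 :: 's)"
      by (simp add: blocks_Suc nth_append length_blocks)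
    then show "code_word m (block_start m i) = (0 :: 's)"
      by (simp add: nth)
    assume "k \<le> m i"
    then have "blocks m (Suc i) ! (Suc (block_start m i + k)) = (1 :: 's)"
      by (simp add: blocks_Suc length_blocks nth_append nth_Cons')
    then show "code_word m (Suc (block_start m i + k)) = (1 :: 's)"
      using \<open>k \<le> m i\<close> by (simp add: nth)
  qed
qed

lemma code_word_block:
  "code_word m (block_start m i) = 0"
  "k \<le> m i \<Longrightarrow> code_word m (Suc (block_start m i + k)) = 1"
  using codes_iff[of "code_word m" m] by (auto simp: codes_iff_block_start)

text \<open>
  A block ends where the next 0 stands; hence the word determines the lengths of its blocks
  one after the other.
\<close>

lemma code_word_inject:
  assumes "(code_word m :: nat \<Rightarrow> 's::{finite, zero_neq_one}) = code_word m'"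
  shows "m = m'"
proof
  fix i
  show "m i = m' i"
  proof (induction i rule: less_induct)
    case (less i)
    have s: "block_start m i = block_start m' i"
      unfolding block_start_def by (rule sum.cong) (use less in auto)
    have shorter: "\<not> n i < n' i"
      if "code_word n = (code_word n' :: nat \<Rightarrow> 's)" "block_start n i = block_start n' i" for n n'
    proof
      assume "n i < n' i"
      then have "(code_word n' (Suc (block_start n' i + Suc (n i))) :: 's) = 1"
        by (intro code_word_block) simp
      moreover have "(code_word n (block_start n (Suc i)) :: 's) = 0"
        by (rule code_word_block)
      ultimately show False using that by simp
    qed
    show ?case using shorter[of m m'] shorter[of m' m] s assms by force
  qed
qed

section \<open>Machines for recursive block functions\<close>

definition emit :: "nat \<Rightarrow> 's::{finite, zero_neq_one} com" where
  "emit r = Seq (Out 0) (Seq (Out 1) (While (Nonzero r) (Seq (Dec r) (Out 1))))"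

lemma exec_emit:
  assumes "s' = (R(r := 0), i, w @ 0 # replicate (Suc (R r)) 1)"
  shows "exec p (emit r) (R, i, w) s'"
proof -
  let ?S = "\<lambda>k. (R(r := R r - k), i, w @ 0 # 1 # replicate k 1)"
  have "exec p (While (Nonzero r) (Seq (Dec r) (Out 1))) (?S 0) (?S (R r))"
    by (rule exec_while)
      (auto intro!: exec.Seq[OF exec.Dec] exec_Out' simp: replicate_append_same)
  then show ?thesis
    unfolding emit_def using assms by (auto intro!: exec.Seq[OF exec.Out])
qed

lemma transforms_blocks:
  fixes init body :: "'s::{finite, zero_neq_one} com"
  obtains M :: "'s machine" where "machine M"
    "\<And>p m R pos. exec p init (\<lambda>_. 0, 0, []) (R 0, pos 0, []) \<Longrightarrow>
       (\<And>i. exec p body (R i, pos i, blocks m i) (R (Suc i), pos (Suc i), blocks m (Suc i))) \<Longrightarrow>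
       transforms M p (code_word m)"
proof -
  obtain M :: "'s machine" where M: "machine M"
    "\<And>p q S. exec p init (\<lambda>_. 0, 0, []) (S 0) \<Longrightarrow> (\<And>i. exec p body (S i) (S (Suc i))) \<Longrightarrow>
       (\<And>i. i \<le> length (snd (snd (S i)))) \<Longrightarrow> (\<And>i j. j < length (snd (snd (S i))) \<Longrightarrow> snd (snd (S i)) ! j = q j) \<Longrightarrow>
       transforms M p q"
    using loop_machine[of init body] by blast
  show thesis
  proof (rule that[OF M(1)])
    fix p :: "nat \<Rightarrow> 's" and m and R :: "nat \<Rightarrow> nat \<Rightarrow> nat" and pos
    assume "exec p init (\<lambda>_. 0, 0, []) (R 0, pos 0, [])"
      and "\<And>i. exec p body (R i, pos i, blocks m i) (R (Suc i), pos (Suc i), blocks m (Suc i))"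
    then show "transforms M p (code_word m)"
      by (intro M(2)[of p "\<lambda>i. (R i, pos i, blocks m i)"]) (auto simp: length_blocks le_block_start blocks_nth)
  qed
qed

primrec skip_blocks :: "nat \<Rightarrow> 's com" where
  "skip_blocks 0 = Skip"
| "skip_blocks (Suc k) = Seq (skip_blocks k) (Seq Move (While Input_one Move))"

lemma exec_skip_blocks:
  "exec (code_word n :: nat \<Rightarrow> 's::{finite, zero_neq_one}) (skip_blocks k) (R, 0, w) (R, block_start n k, w)"
proof (induction k)
  case 0
  then show ?case by (simp add: exec.Skip)
next
  case (Suc k)
  let ?S = "\<lambda>j. (R, Suc (block_start n k + j), w)"
  have "(code_word n (block_start n (Suc k)) :: 's) = 0" by (rule code_word_block)
  then have "exec (code_word n :: nat \<Rightarrow> 's) (While Input_one Move) (?S 0) (?S (Suc (n k)))"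
    by (intro exec_while) (auto simp: code_word_block(2) exec_Move')
  then show ?case
    by (auto intro!: exec.Seq[OF Suc] exec.Seq[OF exec.Move])
qed

text \<open>
  In round \<open>i\<close>, register 1 is set to \<open>\<langle>i, 0\<rangle>\<close>, and its second component is incremented for
  every 1 of the current input block except the first, as a block of value \<open>n\<close> contains
  \<open>n + 1\<close> of them. The shift by \<open>k\<close> blocks lets an operator ask for its argument with a
  higher precision than that of the result.
\<close>

lemma machine_on_codes:
  assumes "recursive F"
  obtains M :: "'s::{finite, zero_neq_one} machine" where "machine M"
    "\<And>p n. codes p n \<Longrightarrow> transforms M p (code_word (\<lambda>i. F (pair i (n (i + k)))))"
proof -
  have "recursive (\<lambda>x. pair x 0)" "recursive (\<lambda>x. pair (left x) (Suc (right x)))"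
    by (intro rec_intros)+
  then obtain start next_pair result :: "'s com" where
    start: "computes_at 1 start (\<lambda>x. pair x 0)" and
    next_pair: "computes_at 1 next_pair (\<lambda>x. pair (left x) (Suc (right x)))" and
    result: "computes_at 1 result F"
    using recursive_computes_at assms by meson
  define body where "body = Seq (copy 0 1 2) (Seq start (Seq Move (Seq Move
    (Seq (While Input_one (Seq next_pair Move)) (Seq result (Seq (emit 1) (Inc 0)))))))"
  obtain M :: "'s machine" where M: "machine M"
    "\<And>p m R pos. exec p (skip_blocks k) (\<lambda>_. 0, 0, []) (R 0, pos 0, []) \<Longrightarrow>
       (\<And>i. exec p body (R i, pos i, blocks m i) (R (Suc i), pos (Suc i), blocks m (Suc i))) \<Longrightarrow>
       transforms M p (code_word m)"
    using transforms_blocks[of "skip_blocks k" body] by auto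
  show thesis
  proof (rule that[OF M(1)])
    fix p :: "nat \<Rightarrow> 's" and n assume "codes p n"
    then have p: "p = code_word n" by (simp add: codes_iff)
    let ?m = "\<lambda>i. F (pair i (n (i + k)))"
    let ?R = "\<lambda>i. (\<lambda>_ :: nat. 0 :: nat)(0 := i)"
    show "transforms M p (code_word ?m)"
    proof (rule M(2)[of p ?R "\<lambda>i. block_start n (i + k)"])
      show "exec p (skip_blocks k) (\<lambda>_. 0, 0, []) (?R 0, block_start n (0 + k), [])"
        unfolding p using exec_skip_blocks[of n k] by (simp add: fun_upd_def)
    next
      fix i
      let ?w = "blocks ?m i"
      let ?S = "\<lambda>j. ((?R i)(1 := pair i j), Suc (Suc (block_start n (i + k) + j)), ?w)"
      have "exec p (While Input_one (Seq next_pair Move)) (?S 0) (?S (n (i + k)))"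
      proof (rule exec_while)
        fix j assume "j < n (i + k)"
        then have one: "(code_word n (Suc (block_start n (i + k) + Suc j)) :: 's) = 1"
          by (intro code_word_block) simp
        show "holds p Input_one (?S j) \<and> exec p (Seq next_pair Move) (?S j) (?S (Suc j))"
          using one unfolding p
          by (intro conjI exec.Seq[OF computes_atD[OF next_pair _ refl]] exec_Move') auto
      next
        have zero: "(code_word n (block_start n (Suc (i + k))) :: 's) = 0"
          by (rule code_word_block)
        show "\<not> holds p Input_one (?S (n (i + k)))"
          using p zero by simp
      qed
      then have loop: "exec p (While Input_one (Seq next_pair Move))
          ((?R i)(1 := pair i 0), Suc (Suc (block_start n (i + k))), ?w)
          ((?R i)(1 := pair i (n (i + k))), block_start n (Suc i + k), ?w)"
        by simp
      have copy: "exec p (copy 0 1 2) (?R i, pos, ?w) ((?R i)(1 := i), pos, ?w)" for pos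
        by (rule exec_copy) auto
      have start: "exec p start ((?R i)(1 := i), pos, ?w) ((?R i)(1 := pair i 0), pos, ?w)" for pos
        by (rule computes_atD[OF start]) auto
      show "exec p body (?R i, block_start n (i + k), ?w)
          (?R (Suc i), block_start n (Suc i + k), blocks ?m (Suc i))"
        unfolding body_def
        by (intro exec.Seq[OF copy] exec.Seq[OF start] exec.Seq[OF exec.Move] exec.Seq[OF loop]
            exec.Seq[OF computes_atD[OF result _ refl]] exec.Seq[OF exec_emit[OF refl]] exec_Inc')
          (auto simp: fun_eq_iff blocks_Suc)
    qed
  qed
qed

definition unary_word :: "nat \<Rightarrow> nat \<Rightarrow> 's::{finite, zero_neq_one}" where
  "unary_word k i = (if i < k then 1 else 0)"

text \<open>
  Register 0 contains \<open>\<langle>k, i\<rangle>\<close> at the beginning of round \<open>i\<close>.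
\<close>

lemma machine_on_unary_words:
  assumes "recursive F"
  obtains M :: "'s::{finite, zero_neq_one} machine" where "machine M"
    "\<And>k. transforms M (unary_word k) (code_word (\<lambda>i. F (pair k i)))"
proof -
  have "recursive (\<lambda>x. pair x 0)" "recursive (\<lambda>x. pair (left x) (Suc (right x)))"
    by (intro rec_intros)+
  then obtain start next_pair result :: "'s com" where
    start: "computes_at 0 start (\<lambda>x. pair x 0)" and
    next_pair: "computes_at 0 next_pair (\<lambda>x. pair (left x) (Suc (right x)))" and
    result: "computes_at 1 result F"
    using recursive_computes_at assms by meson
  define init where "init = Seq (While Input_one (Seq (Inc 0) Move)) start"
  define body where "body = Seq (copy 0 1 2) (Seq result (Seq (emit 1) next_pair))"
  obtain M :: "'s machine" where M: "machine M"
    "\<And>p m R pos. exec p init (\<lambda>_. 0, 0, []) (R 0, pos 0, []) \<Longrightarrow>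
       (\<And>i. exec p body (R i, pos i, blocks m i) (R (Suc i), pos (Suc i), blocks m (Suc i))) \<Longrightarrow>
       transforms M p (code_word m)"
    using transforms_blocks[of init body] by auto
  show thesis
  proof (rule that[OF M(1)])
    fix k
    let ?p = "unary_word k :: nat \<Rightarrow> 's"
    let ?m = "\<lambda>i. F (pair k i)"
    let ?R = "\<lambda>i. (\<lambda>_ :: nat. 0 :: nat)(0 := pair k i)"
    show "transforms M ?p (code_word ?m)"
    proof (rule M(2)[of ?p ?R "\<lambda>i. k"])
      let ?S = "\<lambda>j. ((\<lambda>_ :: nat. 0 :: nat)(0 := j), j, [] :: 's list)"
      have "exec ?p (While Input_one (Seq (Inc 0) Move)) (?S 0) (?S k)"
        by (rule exec_while)
          (auto simp: unary_word_def fun_eq_iff intro!: exec.Seq[OF exec.Inc] exec_Move')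
      moreover have "?S 0 = (\<lambda>_. 0, 0, [])" by auto
      ultimately have "exec ?p (While Input_one (Seq (Inc 0) Move)) (\<lambda>_. 0, 0, []) (?S k)"
        by simp
      then show "exec ?p init (\<lambda>_. 0, 0, []) (?R 0, k, [])"
        unfolding init_def by (rule exec.Seq) (auto intro!: computes_atD[OF start])
    next
      fix i
      show "exec ?p body (?R i, k, blocks ?m i) (?R (Suc i), k, blocks ?m (Suc i))"
        unfolding body_def
        by (intro exec.Seq[OF exec_copy[OF _ _ _ _ refl]] exec.Seq[OF computes_atD[OF result _ refl]]
            exec.Seq[OF exec_emit[OF refl]] computes_atD[OF next_pair])
          (auto simp: fun_eq_iff blocks_Suc)
    qed
  qed
qed

section \<open>Simulating a machine by recursive functions\<close>

lemma written_step_prefix: "\<exists>w. written (step M p c) = written c @ w"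
  by (auto simp: step_def split: prod.splits)

lemma output_after_mono: "t \<le> t' \<Longrightarrow> \<exists>w. output_after M p t' = output_after M p t @ w"
proof (induction t' rule: dec_induct)
  case (step t')
  then show ?case
    using written_step_prefix[of M p "(Defs.step M p ^^ t') (initial M)"] by (auto simp: output_after_def)
qed simp

lemma transforms_nth:
  assumes "transforms M p q" "j < length (output_after M p t)"
  shows "output_after M p t ! j = q j"
proof -
  obtain t' where t': "j < length (output_after M p t')" "output_after M p t' ! j = q j"
    using assms(1) by (auto simp: transforms_def)
  show ?thesis
  proof (cases "t \<le> t'")
    case True
    then show ?thesis using output_after_mono[OF True, of M p] t' assms(2) by (auto simp: nth_append)
  next
    case False
    then have "t' \<le> t" by simp
    then show ?thesis using output_after_mono[of t' t M p] t' assms(2) by (auto simp: nth_append)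
  qed
qed

text \<open>
  Reading a word, \<open>z\<close> counts the zeros and \<open>u\<close> the ones in the block of index \<open>i\<close>; these are
  the ones that are read while \<open>z = i + 1\<close>.
\<close>

fun scan_block :: "nat \<Rightarrow> nat \<times> nat \<Rightarrow> 's::{finite, zero_neq_one} \<Rightarrow> nat \<times> nat" where
  "scan_block i (z, u) a =
     (if a = 0 then Suc z else z, if a = 1 \<and> z = Suc i then Suc u else u)"

lemma code_word_prefix:
  assumes "\<And>j. j < length w \<Longrightarrow> w ! j = (code_word n j :: 's::{finite, zero_neq_one})"
  shows "w = [] \<or> (\<exists>m k. k \<le> Suc (n m) \<and> w = blocks n m @ 0 # replicate k 1)"
  using assms
proof (induction w rule: rev_induct)
  case (snoc a w)
  have a: "a = code_word n (length w)"
    using snoc.prems[of "length w"] by simp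
  have "w ! j = code_word n j" if "j < length w" for j
    using snoc.prems[of j] that by (simp add: nth_append)
  then consider "w = []" | m k where "k \<le> Suc (n m)" "w = blocks n m @ 0 # replicate k 1"
    using snoc.IH by blast
  then show ?case
  proof cases
    case 1
    then have "a = 0" using a code_word_block(1)[of n 0] by simp
    then have "w @ [a] = blocks n 0 @ 0 # replicate 0 1" using 1 by simp
    then show ?thesis by blast
  next
    case (2 m k)
    show ?thesis
    proof (cases "k = Suc (n m)")
      case True
      then have w: "w = blocks n (Suc m)" using 2 by (simp add: blocks_Suc)
      have "a = 0" unfolding a w length_blocks by (rule code_word_block)
      then have "w @ [a] = blocks n (Suc m) @ 0 # replicate 0 1" using w by simp
      then show ?thesis by blast
    next
      case False
      then have k: "k \<le> n m" using 2 by simp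
      have "length w = Suc (block_start n m + k)" using 2 by (simp add: length_blocks)
      then have "a = 1" unfolding a using code_word_block(2)[of k n m] k by simp
      then have "w @ [a] = blocks n m @ 0 # replicate (Suc k) 1"
        using 2 by (simp add: replicate_append_same)
      then show ?thesis using k by (metis Suc_le_mono)
    qed
  qed
qed simp

lemma scan_ones:
  "foldl (scan_block i) (z, u) (replicate k (1 :: 's::{finite, zero_neq_one})) = (z, if z =
      Suc i then u + k else u)"
  by (induction k arbitrary: u) auto

lemma scan_blocks:
  "foldl (scan_block i) (0, 0) (blocks n m :: 's::{finite, zero_neq_one} list) = (m, if m \<le>
      i then 0 else Suc (n i))"
  by (induction m) (auto simp: blocks_Suc scan_ones simp del: replicate_Suc)

text \<open>
  As soon as the zero that starts block \<open>i + 1\<close> has been written, block \<open>i\<close> is complete and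
  its value is known.
\<close>

lemma scan_code_word_prefix:
  assumes "\<And>j. j < length w \<Longrightarrow> w ! j = (code_word n j :: 's::{finite, zero_neq_one})"
  shows "Suc (Suc i) \<le> fst (foldl (scan_block i) (0, 0) w) \<Longrightarrow> snd (foldl (scan_block i) (0, 0) w) = Suc (n i)"
    and "block_start n (Suc (Suc i)) < length w \<Longrightarrow> Suc (Suc i) \<le> fst (foldl (scan_block i) (0, 0) w)"
proof -
  have "(Suc (Suc i) \<le> fst (foldl (scan_block i) (0, 0) w) \<longrightarrow> snd (foldl (scan_block i) (0, 0) w) = Suc (n i)) \<and>
     (block_start n (Suc (Suc i)) < length w \<longrightarrow> Suc (Suc i) \<le> fst (foldl (scan_block i) (0, 0) w))"
  proof (cases "w = []")
    case False
    then obtain m k where k: "k \<le> Suc (n m)" and w: "w = blocks n m @ 0 # replicate k 1"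
      using code_word_prefix[OF assms] by blast
    have fold: "foldl (scan_block i) (0, 0) w = (Suc m, if m < i then 0 else if m = i then k else Suc (n i))"
      by (auto simp: w scan_blocks scan_ones)
    have "length w \<le> block_start n (Suc m)"
      using k by (simp add: w length_blocks)
    moreover have "block_start n (Suc m) \<le> block_start n (Suc (Suc i))" if "m \<le> i"
      unfolding block_start_def by (rule sum_mono2) (use that in auto)
    ultimately have "m \<le> i \<Longrightarrow> length w \<le> block_start n (Suc (Suc i))"
      by (meson order_trans)
    then show ?thesis
      unfolding fold by (cases "m \<le> i") (auto simp del: block_start_Suc)
  qed simp
  then show "Suc (Suc i) \<le> fst (foldl (scan_block i) (0, 0) w) \<Longrightarrow>
      snd (foldl (scan_block i) (0, 0) w) = Suc (n i)"
    and "block_start n (Suc (Suc i)) < length w \<Longrightarrow> Suc (Suc i) \<le> fst (foldl (scan_block i) (0, 0) w)"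
    by blast+
qed

text \<open>
  A number codes the infinite sequence of the left components along its iterated right
  components. The number 0 codes the sequence of zeros, because it is the pair of 0 and 0;
  thus it serves as a blank half tape.
\<close>

definition stack :: "nat \<Rightarrow> nat \<Rightarrow> nat" where
  "stack s i = left ((right ^^ i) s)"

lemma stack_0 [simp]: "stack s 0 = left s"
  and stack_Suc [simp]: "stack s (Suc i) = stack (right s) i"
  by (simp_all add: stack_def funpow_Suc_right del: funpow.simps(2))

lemma stack_zero [simp]: "stack 0 i = 0"
  by (induction i) simp_all

lemma recursive_stack [rec_intros]:
  "recursive f \<Longrightarrow> recursive g \<Longrightarrow> recursive (\<lambda>x. stack (f x) (g x))"
  unfolding stack_def by (intro recursive_left recursive_funpow recursive.right)

primrec tuple :: "nat \<Rightarrow> (nat \<Rightarrow> nat) \<Rightarrow> nat" where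
  "tuple 0 f = 0"
| "tuple (Suc m) f = pair (f 0) (tuple m (\<lambda>i. f (Suc i)))"

lemma stack_tuple [simp]: "i < m \<Longrightarrow> stack (tuple m f) i = f i"
  by (induction m arbitrary: f i) (auto simp: less_Suc_eq_0_disj)

lemma tuple_inject: "tuple m f = tuple m g \<Longrightarrow> i < m \<Longrightarrow> f i = g i"
  by (metis stack_tuple)

lemma tuple_cong: "(\<And>i. i < m \<Longrightarrow> f i = g i) \<Longrightarrow> tuple m f = tuple m g"
proof (induction m arbitrary: f g)
  case (Suc m)
  then have "tuple m (\<lambda>i. f (Suc i)) = tuple m (\<lambda>i. g (Suc i))"
    by (intro Suc.IH) simp
  with Suc.prems[of 0] show ?case by simp
qed simp

lemma recursive_tuple:
  assumes "\<And>i. recursive (\<lambda>x. f x i)" shows "recursive (\<lambda>x. tuple m (f x))"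
  using assms
proof (induction m arbitrary: f)
  case (Suc m)
  show ?case
    by (simp, intro rec_intros Suc.prems Suc.IH)
qed (simp add: recursive.zero)

text \<open>
  A tape is coded by the sequence to the left of the head, the scanned symbol and the
  sequence to the right of the head.
\<close>

definition decode_tape :: "nat \<Rightarrow> tape" where
  "decode_tape c i =
     (if i = 0 then left (right c)
      else if 0 < i then stack (right (right c)) (nat (i - 1)) else stack (left c) (nat (- i - 1)))"

fun direction_code :: "direction \<Rightarrow> nat" where
  "direction_code Left = 0"
| "direction_code Stay = 1"
| "direction_code Right = 2"

text \<open>
  The effect of writing \<open>a\<close> and moving in direction \<open>d\<close>: a move pushes a symbol onto one of
  the two sequences and pops one from the other.
\<close>

definition act_code :: "nat \<Rightarrow> nat \<Rightarrow> nat \<Rightarrow> nat" where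
  "act_code a d c =
     (if d = 0 then pair (right (left c)) (pair (left (left c)) (pair a (right (right c))))
      else if d = 1 then pair (left c) (pair a (right (right c)))
      else pair (pair a (left c)) (right (right c)))"

lemma decode_act_code:
  "decode_tape (act_code a (direction_code d) c) = move_tape d ((decode_tape c)(0 := a))"
proof
  fix i :: int
  have pos: "nat i = Suc (nat (i - 1))" if "0 < i" for i
    using that by (simp add: nat_eq_iff)
  consider "i < - 1" | "i = - 1" | "i = 0" | "i = 1" | "1 < i" by linarith
  then show "decode_tape (act_code a (direction_code d) c) i = move_tape d ((decode_tape c)(0 := a)) i"
    using pos[of "i - 1"] pos[of "- i - 1"] pos[of i] pos[of "- i"]
    by cases (cases d; simp add: act_code_def decode_tape_def fun_upd_def algebra_simps)+
qed

definition moved_position :: "nat \<Rightarrow> nat \<Rightarrow> nat" where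
  "moved_position d i = (if d = 0 then i - 1 else if d = 1 then i else Suc i)"

lemma moved_position: "moved_position (direction_code d) i = move_input d i"
  by (cases d) (auto simp: moved_position_def)

text \<open>
  Letters other than 0 and 1 are identified with no output, as \<open>scan_block\<close> passes over
  them.
\<close>

definition output_code :: "'s::{finite, zero_neq_one} option \<Rightarrow> nat" where
  "output_code out = (if out = Some 0 then 1 else if out = Some 1 then 2 else 0)"

text \<open>
  Only finitely many arguments are meaningful, namely the codes of states, input letters and
  symbols of the machine; elsewhere the value is 0.
\<close>

definition transition_code :: "'s::{finite, zero_neq_one} machine \<Rightarrow> nat \<Rightarrow> nat" where
  "transition_code M x =
     (let S = {(q, a, w). q < states M \<and> length w = work_tapes M \<and> set w \<subseteq> {..<symbols M}};
          key = (\<lambda>(q, a, w). pair q (pair (to_nat a) (tuple (work_tapes M) ((!) w))))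
      in if x \<in> key ` S then
           (case inv_into S key x of (q, a, w) \<Rightarrow>
              case transition M q a w of (q', d, acts, out) \<Rightarrow>
                pair q' (pair (direction_code d)
                  (pair (tuple (work_tapes M) (\<lambda>i. pair (fst (acts ! i)) (direction_code (snd (acts ! i)))))
                    (output_code out))))
         else 0)"

lemma transition_code:
  fixes M :: "'s::{finite, zero_neq_one} machine"
  shows recursive_transition_code: "recursive (transition_code M)"
    and transition_code_key: "q < states M \<Longrightarrow> length w = work_tapes M \<Longrightarrow> set w \<subseteq> {..<symbols M} \<Longrightarrow>
      transition M q a w = (q', d, acts, out) \<Longrightarrow>
      transition_code M (pair q (pair (to_nat a) (tuple (work_tapes M) ((!) w)))) =
        pair q' (pair (direction_code d)
          (pair (tuple (work_tapes M) (\<lambda>i. pair (fst (acts ! i)) (direction_code (snd (acts ! i)))))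
            (output_code out)))"
proof -
  define S where "S = {(q, a :: 's, w). q < states M \<and> length w = work_tapes M \<and> set w \<subseteq> {..<symbols M}}"
  define key where "key = (\<lambda>(q, a :: 's, w). pair q (pair (to_nat a) (tuple (work_tapes M) ((!) w))))"
  have "S \<subseteq> {..<states M} \<times> UNIV \<times> {w. set w \<subseteq> {..<symbols M} \<and> length w = work_tapes M}"
    by (auto simp: S_def)
  moreover have "finite \<dots>"
    by (intro finite_cartesian_product finite_lists_length_eq) auto
  ultimately have "finite S" by (rule finite_subset)
  then show "recursive (transition_code M)"
    by (intro recursive_finite_table[of "key ` S"]) (auto simp: transition_code_def Let_def S_def key_def)
  have inj: "inj_on key S"
  proof (rule inj_onI)
    fix x y assume "x \<in> S" "y \<in> S" "key x = key y"
    moreover obtain q a w q' a' w' where "x = (q, a, w)" "y = (q', a', w')" by (metis prod_cases3)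
    ultimately show "x = y"
      by (auto simp: S_def key_def intro!: nth_equalityI dest: tuple_inject)
  qed
  assume "q < states M" "length w = work_tapes M" "set w \<subseteq> {..<symbols M}"
      and t: "transition M q a w = (q', d, acts, out)"
  then have s: "(q, a, w) \<in> S" by (simp add: S_def)
  have inv: "inv_into S key (key (q, a, w)) = (q, a, w)"
    by (rule inv_into_f_f[OF inj s])
  have "transition_code M (key (q, a, w)) =
        pair q' (pair (direction_code d)
          (pair (tuple (work_tapes M) (\<lambda>i. pair (fst (acts ! i)) (direction_code (snd (acts ! i)))))
            (output_code out)))"
    unfolding transition_code_def Let_def S_def[symmetric] key_def[symmetric] inv
    using s by (simp add: t)
  then show "transition_code M (pair q (pair (to_nat a) (tuple (work_tapes M) ((!) w)))) =
        pair q' (pair (direction_code d)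
          (pair (tuple (work_tapes M) (\<lambda>i. pair (fst (acts ! i)) (direction_code (snd (acts ! i)))))
            (output_code out)))"
    by (simp add: key_def)
qed

text \<open>
  The number \<open>y\<close> has the form \<open>\<langle>\<langle>state, \<langle>head, tapes\<rangle>\<rangle>, \<langle>z, u\<rangle>\<rangle>\<close>, where \<open>z\<close> and \<open>u\<close> are the
  counters of \<open>scan_block\<close> on the output so far; the output itself is not stored. The bound
  on the symbols is an invariant that keeps the arguments of the transition function
  meaningful.
\<close>

definition represents :: "'s::{finite, zero_neq_one} machine \<Rightarrow> nat \<Rightarrow> nat \<Rightarrow> 's configuration \<Rightarrow> bool" where
  "represents M i y c \<longleftrightarrow>
     left (left y) = state c \<and> state c < states M \<and>
     left (right (left y)) = input_pos c \<and>
     tapes c = map (\<lambda>r. decode_tape (stack (right (right (left y))) r)) [0..<work_tapes M] \<and>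
     (\<forall>t\<in>set (tapes c). \<forall>j. t j < symbols M) \<and>
     prod_decode (right y) = foldl (scan_block i) (0, 0) (written c)"

definition step_code :: "'s::{finite, zero_neq_one} machine \<Rightarrow> nat \<Rightarrow> nat \<Rightarrow> nat \<Rightarrow> nat" where
  "step_code M i a y =
     (let q = left (left y); T = right (right (left y));
          v = transition_code M (pair q (pair a (tuple (work_tapes M) (\<lambda>r. left (right (stack T r))))));
          z = left (right y); u = right (right y); b = right (right (right v))
      in pair (pair (left v) (pair (moved_position (left (right v)) (left (right (left y))))
            (tuple (work_tapes M) (\<lambda>r. act_code (left (stack (left (right (right v))) r))
               (right (stack (left (right (right v))) r)) (stack T r)))))
          (pair (if b = 1 then Suc z else z) (if b = 2 then if z = Suc i then Suc u else u else u)))"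

lemma scan_output_code:
  "foldl (scan_block i) (z, u) (case out of None \<Rightarrow> [] | Some a \<Rightarrow> [a]) =
     (if output_code out = 1 then Suc z else z, if output_code out = 2 then
         if z = Suc i then Suc u else u else u)"
  by (auto simp: output_code_def split: option.split)

lemma represents_step:
  fixes M :: "'s::{finite, zero_neq_one} machine"
  assumes M: "machine M" and rep: "represents M i y c"
  shows "represents M i (step_code M i (to_nat (p (input_pos c))) y) (step M p c)"
proof -
  define T where "T = right (right (left y))"
  define w where "w = map (\<lambda>t. t 0) (tapes c)"
  define a where "a = p (input_pos c)"
  obtain q' d acts out where tr: "transition M (state c) a w = (q', d, acts, out)"
    by (metis prod_cases4)
  have tapes: "tapes c = map (\<lambda>r. decode_tape (stack T r)) [0..<work_tapes M]"
    and q: "state c < states M" "left (left y) = state c" and pos: "left (right (left y)) = input_pos c"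
    and sym: "\<forall>t\<in>set (tapes c). \<forall>j. t j < symbols M"
    and scan: "prod_decode (right y) = foldl (scan_block i) (0, 0) (written c)"
    using rep by (auto simp: represents_def T_def)
  have w: "length w = work_tapes M" "set w \<subseteq> {..<symbols M}"
    using sym by (auto simp: w_def) (simp add: tapes)
  have ok: "q' < states M" "length acts = work_tapes M" "fst ` set acts \<subseteq> {..<symbols M}"
  proof -
    have "(case transition M q a w of (q', d, acts, out) \<Rightarrow>
        q' < states M \<and> length acts = work_tapes M \<and> fst ` set acts \<subseteq> {..<symbols M})"
      if "q < states M" "length w = work_tapes M" "set w \<subseteq> {..<symbols M}" for q a w
      using M that unfolding machine_def by simp
    from this[OF q(1) w, of a]
    show "q' < states M" "length acts = work_tapes M" "fst ` set acts \<subseteq> {..<symbols M}"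
      by (simp_all add: tr)
  qed
  have "tuple (work_tapes M) (\<lambda>r. left (right (stack T r))) = tuple (work_tapes M) ((!) w)"
    by (rule tuple_cong) (simp add: w_def tapes decode_tape_def)
  then have v: "transition_code M (pair (left (left y)) (pair (to_nat a) (tuple (work_tapes M) (\<lambda>r. left
      (right (stack T r)))))) =
     pair q' (pair (direction_code d)
          (pair (tuple (work_tapes M) (\<lambda>i. pair (fst (acts ! i)) (direction_code (snd (acts ! i)))))
            (output_code out)))"
    using transition_code_key[OF q(1) w tr] by (simp add: q)
  have st: "step M p c =
      \<lparr>state = q', input_pos = move_input d (input_pos c),
       tapes = map2 (\<lambda>t (a, d'). move_tape d' (t(0 := a))) (tapes c) acts,
       written = written c @ (case out of None \<Rightarrow> [] | Some a \<Rightarrow> [a])\<rparr>"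
    by (simp add: step_def a_def[symmetric] w_def[symmetric] tr)
  have tapes': "tapes (step M p c) = map (\<lambda>r. move_tape (snd (acts ! r)) ((decode_tape (stack T r))(0 := fst
      (acts ! r)))) [0..<work_tapes M]"
    using ok(2) by (auto simp: st tapes split_beta intro!: nth_equalityI)
  have range: "t j < symbols M" if t: "t \<in> set (tapes (step M p c))" for t j
  proof -
    obtain r where r: "r < work_tapes M" "t = move_tape (snd (acts ! r)) ((decode_tape (stack T r))(0 := fst
        (acts ! r)))"
      using t unfolding tapes' by auto
    have "decode_tape (stack T r) j < symbols M" for j
      using sym r(1) by (simp add: tapes)
    moreover have "fst (acts ! r) < symbols M" using ok r(1) by (metis imageI lessThan_iff nth_mem subsetD)
    ultimately show ?thesis unfolding r(2) by (cases "snd (acts ! r)") auto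
  qed
  have codes: "tapes (step M p c) =
      map (\<lambda>r. decode_tape (stack (tuple (work_tapes M) (\<lambda>r. act_code (fst (acts ! r))
        (direction_code (snd (acts ! r))) (stack T r))) r)) [0..<work_tapes M]"
    unfolding tapes' by (rule map_cong) (simp_all add: decode_act_code)
  define T' where "T' = tuple (work_tapes M) (\<lambda>r. act_code (fst (acts ! r)) (direction_code (snd (acts !
      r))) (stack T r))"
  have T': "tuple (work_tapes M) (\<lambda>r. act_code (left (stack (tuple (work_tapes M)
        (\<lambda>i. pair (fst (acts ! i)) (direction_code (snd (acts ! i))))) r))
        (right (stack (tuple (work_tapes M) (\<lambda>i. pair (fst (acts ! i)) (direction_code (snd (acts ! i)))))
            r)) (stack T r)) = T'"
    unfolding T'_def by (rule tuple_cong) simp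
  obtain z u where zu: "prod_decode (right y) = (z, u)" by fastforce
  define zu' where "zu' =
     (if output_code out = 1 then Suc z else z, if output_code out = 2 then
         if z = Suc i then Suc u else u else u)"
  have scan': "foldl (scan_block i) (0, 0) (written (step M p c)) = zu'"
    by (simp add: st scan[symmetric] zu scan_output_code zu'_def)
  have "step_code M i (to_nat a) y = pair (pair q' (pair (move_input d (input_pos c)) T')) (prod_encode zu')"
    unfolding step_code_def Let_def T_def[symmetric] v
    by (simp add: T' zu zu'_def moved_position pos)
  then have code: "left (left (step_code M i (to_nat a) y)) = q'"
      "left (right (left (step_code M i (to_nat a) y))) = move_input d (input_pos c)"
      "right (right (left (step_code M i (to_nat a) y))) = T'"
      "prod_decode (right (step_code M i (to_nat a) y)) = zu'"
    by simp_all
  show ?thesis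
    unfolding represents_def a_def[symmetric] code scan'
  proof (intro conjI refl)
    show "tapes (step M p c) = map (\<lambda>r. decode_tape (stack T' r)) [0..<work_tapes M]"
      unfolding codes T'_def ..
    show "\<forall>t\<in>set (tapes (step M p c)). \<forall>j. t j < symbols M"
      using range by blast
    show "q' = state (step M p c)" "state (step M p c) < states M"
        "move_input d (input_pos c) = input_pos (step M p c)"
      using ok(1) by (simp_all only: st configuration.select_convs)
  qed
qed

lemma represents_initial:
  assumes "machine M" shows "represents M i 0 (initial M)"
proof -
  have "decode_tape 0 = (\<lambda>_. 0)" by (auto simp: decode_tape_def)
  then show ?thesis
    using assms by (auto simp: represents_def initial_def machine_def map_replicate_const)
qed

text \<open>
  To find the value of block \<open>i\<close> for the input word with index \<open>k\<close>, simulate the machine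
  until \<open>i + 2\<close> zeros have been written. This happens because the output is infinite, and
  then \<open>u\<close> is the number of ones in block \<open>i\<close>, one more than its value.
\<close>

lemma recursive_machine_output:
  fixes M :: "'s::{finite, zero_neq_one} machine"
  assumes M: "machine M" and transforms: "\<And>k. transforms M (input k) (code_word (n k))"
    and input: "recursive (\<lambda>x. to_nat (input (left x) (right x)))"
  shows "recursive (\<lambda>x. n (left x) (right x))"
proof -
  define next_code where "next_code = (\<lambda>x (t :: nat) y. step_code M (right x) (to_nat (input (left x) (left
      (right (left y))))) y)"
  define run where "run = (\<lambda>x. rec_nat 0 (next_code x))"
  have run: "represents M (right x) (run x t) ((step M (input (left x)) ^^ t) (initial M))" for x t
  proof (induction t)
    case 0
    show ?case by (simp add: run_def represents_initial M)
  next
    case (Suc t)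
    from represents_step[OF M Suc, of "input (left x)"] Suc show ?case
      by (simp add: run_def next_code_def represents_def)
  qed
  have rec_next: "recursive (\<lambda>w. next_code (left (left w)) (left (right w)) (right (right w)))"
    unfolding next_code_def step_code_def Let_def act_code_def moved_position_def
    by (intro rec_intros recursive_tuple recursive.comp[OF recursive_transition_code] recursive_binary[OF
        input])
  have rec_run: "recursive (\<lambda>z. run (left z) (right z))"
    unfolding run_def by (rule recursive_rec_nat[OF rec_next]) (intro rec_intros)+
  define h where "h = (\<lambda>x t. Suc (Suc (right x)) - left (right (run x t)))"
  have scan: "prod_decode (right (run x t)) = foldl (scan_block (right x)) (0,
      0) (output_after M (input (left x)) t)" for x t
    using run[of x t] by (simp add: represents_def output_after_def)
  note prefix = transforms_nth[OF transforms]
  have ex: "\<exists>t. h x t = 0" for x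
  proof -
    let ?l = "block_start (n (left x)) (Suc (Suc (right x)))"
    obtain t where "?l < length (output_after M (input (left x)) t)"
      using transforms[of "left x"] unfolding transforms_def by blast
    with scan_code_word_prefix(2)[OF prefix] have "h x t = 0"
      by (simp add: h_def scan)
    then show ?thesis ..
  qed
  have "right (right (run x (LEAST t. h x t = 0))) - 1 = n (left x) (right x)" for x
  proof -
    have "h x (LEAST t. h x t = 0) = 0" by (rule LeastI_ex[OF ex])
    then show ?thesis
      using scan_code_word_prefix(1)[OF prefix] by (simp add: h_def scan)
  qed
  moreover have "recursive (\<lambda>x. right (right (run x (LEAST t. h x t = 0))) - 1)"
  proof -
    have "recursive (\<lambda>x. LEAST t. h x t = 0)"
      by (rule recursive_Least[OF _ ex]) (unfold h_def, intro rec_intros rec_run)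
    then show ?thesis
      by (intro rec_intros recursive_binary[OF rec_run])
  qed
  ultimately show ?thesis by simp
qed

section \<open>Arithmetic on codes\<close>

text \<open>
  The code \<open>\<langle>i, \<langle>j, k\<rangle>\<rangle>\<close> stands for \<open>(i - j) / (k + 1)\<close>. Products of denominators are thus
  stored as \<open>(k + 1) * (k' + 1) - 1 = k * k' + k + k'\<close>, and no subtraction of natural
  numbers occurs.
\<close>

definition rat_add :: "nat \<Rightarrow> nat \<Rightarrow> nat" where
  "rat_add a b =
     pair (left a * Suc (right (right b)) + left b * Suc (right (right a)))
      (pair (left (right a) * Suc (right (right b)) + left (right b) * Suc (right (right a)))
        (right (right a) * right (right b) + right (right a) + right (right b)))"

definition rat_mult :: "nat \<Rightarrow> nat \<Rightarrow> nat" where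
  "rat_mult a b =
     pair (left a * left b + left (right a) * left (right b))
      (pair (left a * left (right b) + left (right a) * left b)
        (right (right a) * right (right b) + right (right a) + right (right b)))"

definition rat_minus :: "nat \<Rightarrow> nat" where
  "rat_minus a = pair (left (right a)) (pair (left a) (right (right a)))"

lemma rat_num_pair: "rat_num (pair i (pair j k)) = (real i - real j) / (real k + 1)"
  by (simp add: rat_num_def)

lemma code_triple:
  obtains i j k where "a = pair i (pair j k)"
  by (metis prod_decode_inverse surj_pair)

lemma rat_num_add: "rat_num (rat_add a b) = rat_num a + rat_num b"
proof -
  obtain i j k where a: "a = pair i (pair j k)" by (rule code_triple)
  obtain i' j' k' where b: "b = pair i' (pair j' k')" by (rule code_triple)
  have k: "real k + 1 > 0" "real k' + 1 > 0" by simp_all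
  have "real (k * k' + k + k') + 1 = (real k + 1) * (real k' + 1)" by (simp add: algebra_simps)
  then show ?thesis
    using k unfolding a b rat_add_def by (simp add: rat_num_pair) (simp add: field_simps)
qed

lemma rat_num_mult: "rat_num (rat_mult a b) = rat_num a * rat_num b"
proof -
  obtain i j k where a: "a = pair i (pair j k)" by (rule code_triple)
  obtain i' j' k' where b: "b = pair i' (pair j' k')" by (rule code_triple)
  have "real (k * k' + k + k') + 1 = (real k + 1) * (real k' + 1)" by (simp add: algebra_simps)
  then show ?thesis
    unfolding a b rat_mult_def by (simp add: rat_num_pair) (simp add: algebra_simps)
qed

lemma rat_num_minus: "rat_num (rat_minus a) = - rat_num a"
  by (rule code_triple[of a]) (simp add: rat_minus_def rat_num_pair minus_divide_left)

lemma recursive_rat [rec_intros]: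
  assumes "recursive f" "recursive g"
  shows "recursive (\<lambda>x. rat_add (f x) (g x))" "recursive (\<lambda>x. rat_mult (f x) (g x))"
    "recursive (\<lambda>x. rat_minus (f x))"
  unfolding rat_add_def rat_mult_def rat_minus_def by (intro rec_intros assms)+

lemma scalar_num_0 [simp]: "scalar_num 0 = (0 :: 'f::rc_field)"
  using rat_num_pair[of 0 0 0] by (simp add: scalar_num_def prod_encode_def)

text \<open>
  The operations are only claimed to exist, since they differ between the real and the
  complex case.
\<close>

lemma scalar_num_arithmetic:
  obtains add mult :: "nat \<Rightarrow> nat \<Rightarrow> nat" where
    "recursive (\<lambda>x. add (left x) (right x))"
    "\<And>a b. (scalar_num (add a b) :: 'f::rc_field) = scalar_num a + scalar_num b"
    "recursive (\<lambda>x. mult (left x) (right x))"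
    "\<And>a b. (scalar_num (mult a b) :: 'f) = scalar_num a * scalar_num b"
proof (cases "imag_unit = (0::'f)")
  case True
  show thesis
    by (rule that[of rat_add rat_mult])
      (auto simp: True scalar_num_def rat_num_add rat_num_mult intro!: rec_intros)
next
  case False
  then have i: "imag_unit * imag_unit = (- 1 :: 'f)"
    using imag_unit_cases by blast
  then have i': "imag_unit * (imag_unit * z) = - z" for z :: 'f
    by (metis mult.assoc mult_minus1)
  show thesis
    by (rule that[of "\<lambda>a b. pair (rat_add (left a) (left b)) (rat_add (right a) (right b))"
      "\<lambda>a b. pair (rat_add (rat_mult (left a) (left b)) (rat_minus (rat_mult (right a) (right b))))
         (rat_add (rat_mult (left a) (right b)) (rat_mult (right a) (left b)))"])
     (auto simp: False scalar_num_def rat_num_add rat_num_mult rat_num_minus algebra_simps i i' split_beta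
         intro!: rec_intros)
qed

lemma scalar_num_1: obtains u where "scalar_num u = (1 :: 'f::rc_field)"
proof (cases "imag_unit = (0::'f)")
  case True
  then show thesis
    using that[of "pair 1 (pair 0 0)"] by (simp add: scalar_num_def rat_num_pair)
next
  case False
  then show thesis
    using that[of "pair (pair 1 (pair 0 0)) (pair 0 (pair 0 0))"] by (simp add: scalar_num_def rat_num_pair)
qed

lemma left_le: "left x \<le> x" and right_le: "right x \<le> x"
  by (metis le_prod_encode_1 prod.collapse prod_decode_inverse)
    (metis le_prod_encode_2 prod.collapse prod_decode_inverse)

lemma abs_rat_num_le: "\<bar>rat_num a\<bar> \<le> real a"
proof -
  obtain i j k where a: "a = pair i (pair j k)" by (rule code_triple)
  have "i \<le> a" "j \<le> a"
    unfolding a using le_prod_encode_1[of i] le_prod_encode_2[of _ i] le_prod_encode_1[of j k]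
        by (auto intro: order_trans)
  then have "\<bar>real i - real j\<bar> \<le> real a" by linarith
  moreover have "\<bar>real i - real j\<bar> / (real k + 1) \<le> \<bar>real i - real j\<bar> / 1"
    by (intro divide_left_mono) auto
  ultimately show ?thesis by (simp add: a rat_num_pair)
qed

lemma norm_imag_unit:
  assumes "imag_unit \<noteq> (0 :: 'f::rc_field)"
  shows "norm (imag_unit :: 'f) = 1"
proof -
  have "norm (imag_unit * imag_unit :: 'f) = 1"
    using assms imag_unit_cases by auto
  then have "(norm (imag_unit :: 'f))\<^sup>2 = 1"
    by (simp add: norm_mult power2_eq_square)
  then show ?thesis by (simp add: power2_eq_1_iff)  (metis norm_ge_zero not_one_le_zero neg_0_le_iff_le)
qed

text \<open>
  A crude estimate, but one that is read off the code without any computation. It tells how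
  precisely a vector must be known before it is multiplied by the scalar.
\<close>

lemma norm_scalar_num_le: "norm (scalar_num a :: 'f::rc_field) \<le> 2 * real a"
proof (cases "imag_unit = (0::'f)")
  case True
  then show ?thesis using abs_rat_num_le[of a] by (simp add: scalar_num_def)
next
  case False
  then have "norm (scalar_num a :: 'f) \<le> \<bar>rat_num (left a)\<bar> + \<bar>rat_num (right a)\<bar>"
    using norm_triangle_ineq[of "of_real (rat_num (left a)) :: 'f" "of_real (rat_num (right a)) * imag_unit"]
    by (simp add: scalar_num_def False split_beta norm_mult norm_imag_unit)
  also have "\<dots> \<le> real (left a) + real (right a)"
    by (intro add_mono abs_rat_num_le)
  also have "\<dots> \<le> 2 * real a" using left_le[of a] right_le[of a] by linarith
  finally show ?thesis .
qed

section \<open>Codes of finite linear combinations\<close>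

text \<open>
  The code of the coefficient of \<open>e j\<close> in the vector with code \<open>x\<close>. The last entry of a
  Cantor tuple is not the left half of a pair, whence the case \<open>j = left x\<close>; beyond it
  stands the code 0 of the scalar 0, so that vectors of different lengths can be added.
\<close>

definition coefficient :: "nat \<Rightarrow> nat \<Rightarrow> nat" where
  "coefficient x j =
     (if j = left x then (right ^^ j) (right x) else if j \<le> left x then stack (right x) j else 0)"

lemma untuple_nth: "j \<le> k \<Longrightarrow> untuple k t ! j = (if j = k then (right ^^ j) t else stack t j)"
proof (induction k arbitrary: t j)
  case (Suc k)
  then show ?case
    by (cases j) (auto simp: split_beta funpow_Suc_right simp del: funpow.simps(2))
qed simp

lemma span_num_coefficient:
  assumes "\<And>x. smul 0 x = 0" "left x \<le> N"
  shows "span_num smul e x = (\<Sum>j\<le>N. smul (scalar_num (coefficient x j)) (e j))"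
proof -
  have "span_num smul e x = (\<Sum>j\<le>left x. smul (scalar_num (coefficient x j)) (e j))"
    unfolding span_num_def split_beta by (rule sum.cong) (auto simp: untuple_nth coefficient_def)
  also have "\<dots> = (\<Sum>j\<le>N. smul (scalar_num (coefficient x j)) (e j))"
    by (rule sum.mono_neutral_left) (use assms in \<open>auto simp: coefficient_def\<close>)
  finally show ?thesis .
qed

lemma coefficient_le: "coefficient x j \<le> x"
proof -
  have "(right ^^ j) y \<le> y" for y
    by (induction j) (auto intro: order_trans[OF right_le])
  then have "(right ^^ j) (right x) \<le> x"
    by (rule order_trans) (rule right_le)
  then show ?thesis
    unfolding coefficient_def stack_def by (auto intro: order_trans[OF left_le])
qed

lemma recursive_coefficient [rec_intros]:
  assumes "recursive f" "recursive g"
  shows "recursive (\<lambda>x. coefficient (f x) (g x))"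
  unfolding coefficient_def by (intro rec_intros recursive_funpow recursive.right assms)

text \<open>
  The tuple is built from its last entry \<open>c N\<close> backwards.
\<close>

definition vector_code :: "nat \<Rightarrow> (nat \<Rightarrow> nat) \<Rightarrow> nat" where
  "vector_code N c = pair N (rec_nat (c N) (\<lambda>s y. pair (c (N - Suc s)) y) N)"

lemma span_num_vector_code:
  "span_num smul e (vector_code N c) = (\<Sum>j\<le>N. smul (scalar_num (c j)) (e j))"
proof -
  define T where "T = rec_nat (c N) (\<lambda>s y. pair (c (N - Suc s)) y)"
  have "untuple s (T s) ! j = c (N - s + j)" if "j \<le> s" "s \<le> N" for s j
    using that
  proof (induction s arbitrary: j)
    case (Suc s)
    then show ?case by (cases j) (auto simp: T_def Suc_diff_Suc)
  qed (simp add: T_def)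
  from this[OF _ order_refl] show ?thesis
    by (simp add: span_num_def vector_code_def T_def[symmetric])
qed

lemma recursive_vector_code:
  assumes N: "recursive N" and c: "recursive (\<lambda>z. c (left z) (right z))"
  shows "recursive (\<lambda>x. vector_code (N x) (c x))"
proof -
  have "recursive (\<lambda>x. rec_nat (c x (N x)) (\<lambda>s y. pair (c x (N x - Suc s)) y) (N x))"
    by (rule recursive_rec_nat[where h = "\<lambda>x s y. pair (c x (N x - Suc s)) y"])
      (intro rec_intros recursive_binary[OF c] recursive.comp[OF N] N)+
  then show ?thesis
    unfolding vector_code_def by (intro rec_intros N)
qed

text \<open>
  In the argument \<open>x = \<langle>i, n\<rangle>\<close>, the vector code \<open>n\<close> provides the coefficients, while \<open>i\<close> is
  left free for the precision of the vectors \<open>a x j\<close> that are combined.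
\<close>

lemma recursive_linear_combination:
  fixes smul :: "'f::rc_field \<Rightarrow> 'h::real_normed_vector \<Rightarrow> 'h"
  assumes "vector_space smul"
    and a: "recursive (\<lambda>z. a (left z) (right z))"
  obtains F where "recursive F"
    "\<And>x. span_num smul e (F x) =
      (\<Sum>j\<le>left (right x). smul (scalar_num (coefficient (right x) j)) (span_num smul e (a x j)))"
proof -
  interpret vector_space smul by fact
  obtain add mult where
    add: "recursive (\<lambda>x. add (left x) (right x))" "\<And>a b. (scalar_num (add a b) :: 'f) =
        scalar_num a + scalar_num b" and
    mult: "recursive (\<lambda>x. mult (left x) (right x))"
        "\<And>a b. (scalar_num (mult a b) :: 'f) = scalar_num a * scalar_num b"
    using scalar_num_arithmetic[where 'f = 'f] by blast
  \<comment> \<open>any common upper bound of the lengths will do, and the sum is recursive\<close>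
  define N where "N = (\<lambda>x. \<Sum>j<Suc (left (right x)). left (a x j))"
  define c where "c = (\<lambda>x l. rec_nat 0 (\<lambda>j y. add y (mult (coefficient (right x) j) (coefficient (a x j)
      l))) (Suc (left (right x))))"
  have N: "recursive N"
    unfolding N_def by (intro rec_intros a)
  have c: "recursive (\<lambda>z. c (left z) (right z))"
    unfolding c_def
    by (rule recursive_rec_nat[where h = "\<lambda>z j y. add y (mult (coefficient (right (left z)) j) (coefficient
        (a (left z) j) (right z)))"])
      (intro rec_intros recursive_binary[OF add(1)] recursive_binary[OF mult(1)] recursive_binary[OF a])+
  have scalar_rec: "(scalar_num (rec_nat 0 (\<lambda>j y. add y (mult (u j) (v j))) n) :: 'f) =
      (\<Sum>j<n. scalar_num (u j) * scalar_num (v j))" for u v n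
    by (induction n) (simp_all add: add(2) mult(2))
  have scalar: "(scalar_num (c x l) :: 'f) = (\<Sum>j\<le>left (right x). scalar_num (coefficient (right x) j) *
      scalar_num (coefficient (a x j) l))" for x l
    unfolding c_def scalar_rec lessThan_Suc_atMost ..
  show thesis
  proof (rule that[OF recursive_vector_code[OF N c]])
    fix x
    have le: "left (a x j) \<le> N x" if "j \<le> left (right x)" for j
      unfolding N_def using that by (intro member_le_sum) auto
    have "span_num smul e (vector_code (N x) (c x)) =
        (\<Sum>l\<le>N x. \<Sum>j\<le>left (right x). smul (scalar_num (coefficient (right x) j)) (smul (scalar_num
            (coefficient (a x j) l)) (e l)))"
      by (simp add: span_num_vector_code scalar scale_sum_left)
    also have "\<dots> = (\<Sum>j\<le>left (right x). smul (scalar_num (coefficient (right x) j))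
        (\<Sum>l\<le>N x. smul (scalar_num (coefficient (a x j) l)) (e l)))"
      by (subst sum.swap) (simp add: scale_sum_right)
    also have "\<dots> = (\<Sum>j\<le>left (right x). smul (scalar_num (coefficient (right x) j)) (span_num smul e (a x j)))"
      using le by (intro sum.cong refl) (simp add: span_num_coefficient[of smul, where N = "N x"])
    finally show "span_num smul e (vector_code (N x) (c x)) = \<dots>" .
  qed
qed

lemma recursive_unit_code:
  fixes smul :: "'f::rc_field \<Rightarrow> 'h::real_normed_vector \<Rightarrow> 'h"
  assumes "vector_space smul"
  obtains u where "recursive u" "\<And>k. span_num smul e (u k) = e k"
proof -
  interpret vector_space smul by fact
  obtain one where one: "scalar_num one = (1 :: 'f)" by (rule scalar_num_1)
  show thesis
  proof (rule that[of "\<lambda>k. vector_code k (\<lambda>j. if j = k then one else 0)"])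
    show "recursive (\<lambda>k. vector_code k (\<lambda>j. if j = k then one else 0))"
      by (intro recursive_vector_code rec_intros)
    fix k
    have "(\<Sum>j\<le>k. smul (scalar_num (if j = k then one else 0)) (e j)) = (\<Sum>j\<le>k. if j = k then e k else 0)"
      by (intro sum.cong) (auto simp: one)
    then show "span_num smul e (vector_code k (\<lambda>j. if j = k then one else 0)) = e k"
      by (simp add: span_num_vector_code)
  qed
qed

text \<open>
  The constant sequence of a code is a Cauchy name; its word is periodic with period
  \<open>c + 2\<close>.
\<close>

lemma code_word_const:
  "code_word (\<lambda>_. c) j = (if \<exists>i<Suc j. i * (c + 2) = j then 0 else 1 :: 's::{finite, zero_neq_one})"
proof -
  have start: "block_start (\<lambda>_. c) i = i * (c + 2)" for i
    by (simp add: block_start_def)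
  define i r where "i = j div (c + 2)" and "r = j mod (c + 2)"
  have j: "j = i * (c + 2) + r" by (simp only: i_def r_def div_mult_mod_eq)
  have r: "r < c + 2" by (simp add: r_def)
  show ?thesis
  proof (cases r)
    case 0
    then have "code_word (\<lambda>_. c) j = (0 :: 's)"
      using code_word_block(1)[of "\<lambda>_. c" i] by (simp add: start j)
    moreover have "\<exists>i<Suc j. i * (c + 2) = j" using j 0 by (intro exI[of _ i]) auto
    ultimately show ?thesis by simp
  next
    case (Suc r')
    have "code_word (\<lambda>_. c) (Suc (block_start (\<lambda>_. c) i + r')) = (1 :: 's)"
      by (rule code_word_block) (use r Suc in simp)
    moreover have "Suc (block_start (\<lambda>_. c) i + r') = j" by (simp only: start j Suc)
    moreover have "\<nexists>i'. i' * (c + 2) = j"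
      using Suc unfolding r_def by (metis mod_mult_self2_is_0 nat.distinct(1))
    ultimately show ?thesis by simp
  qed
qed

lemma recursive_constant_name:
  assumes "recursive u"
  shows "recursive (\<lambda>x. to_nat (code_word (\<lambda>_. u (left x)) (right x) :: 's::{finite, zero_neq_one}))"
proof -
  have "to_nat (code_word (\<lambda>_. c) j :: 's) =
      (if (\<Sum>i<Suc j. if i * (c + 2) = j then 1 else 0 :: nat) = 0 then to_nat (1 :: 's) else to_nat (0 ::
          's))" for c j
    unfolding code_word_const by (auto simp del: sum.lessThan_Suc)
  then show ?thesis
    by (simp only:) (intro rec_intros recursive.comp[OF assms])
qed

section \<open>Cauchy names\<close>

definition fast_cauchy :: "(nat \<Rightarrow> 'x::metric_space) \<Rightarrow> (nat \<Rightarrow> nat) \<Rightarrow> 'x \<Rightarrow> bool" where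
  "fast_cauchy \<alpha> n x \<longleftrightarrow>
     (\<forall>i j. i < j \<longrightarrow> dist (\<alpha> (n i)) (\<alpha> (n j)) < 1 / 2 ^ i) \<and> (\<lambda>i. \<alpha> (n i)) \<longlonglongrightarrow> x"

lemma cauchy_name_code_word: "cauchy_name \<alpha> p x \<longleftrightarrow> (\<exists>n. p = code_word n \<and> fast_cauchy \<alpha> n x)"
  by (simp add: cauchy_name_def fast_cauchy_def codes_iff)

lemma cauchy_rep_eq_Some: "cauchy_rep \<alpha> p = Some x \<longleftrightarrow> (\<exists>n. p = code_word n \<and> fast_cauchy \<alpha> n x)"
proof -
  have unique: "x = y" if "cauchy_name \<alpha> p x" "cauchy_name \<alpha> p y" for x y
    using that unfolding cauchy_name_code_word
    by (metis code_word_inject fast_cauchy_def LIMSEQ_unique)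
  have "cauchy_rep \<alpha> p = Some x \<longleftrightarrow> cauchy_name \<alpha> p x"
    unfolding cauchy_rep_def using unique by (auto intro: theI the_equality[symmetric])
  then show ?thesis by (simp add: cauchy_name_code_word)
qed

lemma fast_cauchy_dist:
  assumes "fast_cauchy \<alpha> n x"
  shows "dist (\<alpha> (n i)) x \<le> 1 / 2 ^ i"
proof (rule LIMSEQ_le_const2)
  show "(\<lambda>j. dist (\<alpha> (n i)) (\<alpha> (n j))) \<longlonglongrightarrow> dist (\<alpha> (n i)) x"
    using assms by (intro tendsto_dist tendsto_const) (simp add: fast_cauchy_def)
  show "\<exists>N. \<forall>j\<ge>N. dist (\<alpha> (n i)) (\<alpha> (n j)) \<le> 1 / 2 ^ i"
    using assms unfolding fast_cauchy_def by (intro exI[of _ "Suc i"]) (auto intro: less_imp_le)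
qed

text \<open>
  Two additional bits absorb the triangle inequality between any two terms.
\<close>

lemma fast_cauchyI:
  assumes "\<And>i. dist (\<alpha> (n i)) x < 1 / 2 ^ (i + 2)"
  shows "fast_cauchy \<alpha> n x"
  unfolding fast_cauchy_def
proof (intro conjI allI impI)
  fix i j :: nat assume "i < j"
  have "dist (\<alpha> (n i)) (\<alpha> (n j)) \<le> dist (\<alpha> (n i)) x + dist (\<alpha> (n j)) x"
    by (rule dist_triangle2)
  also have "\<dots> < 1 / 2 ^ (i + 2) + 1 / 2 ^ (j + 2)"
    by (intro add_strict_mono assms)
  also have "\<dots> \<le> 1 / 2 ^ (i + 2) + 1 / 2 ^ (i + 2)"
    using \<open>i < j\<close> by (intro add_left_mono divide_left_mono power_increasing) auto
  also have "\<dots> \<le> 1 / 2 ^ i" by (simp add: field_simps)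
  finally show "dist (\<alpha> (n i)) (\<alpha> (n j)) < 1 / 2 ^ i" .
next
  have "(\<lambda>i. dist (\<alpha> (n i)) x) \<longlonglongrightarrow> 0"
  proof (rule tendsto_sandwich[OF _ _ tendsto_const LIMSEQ_power_zero[of "1/2 :: real"]])
    have "dist (\<alpha> (n i)) x \<le> (1 / 2) ^ i" for i
    proof -
      have "(1::real) / 2 ^ (i + 2) \<le> (1 / 2) ^ i" by (simp add: field_simps)
      then show ?thesis using assms[of i] by linarith
    qed
    then show "\<forall>\<^sub>F i in sequentially. dist (\<alpha> (n i)) x \<le> (1 / 2) ^ i" by simp
  qed auto
  then show "(\<lambda>i. \<alpha> (n i)) \<longlonglongrightarrow> x"
    by (rule tendsto_dist_iff[THEN iffD2])
qed

lemma nat_rep_eq_Some: "nat_rep (p :: nat \<Rightarrow> 's::{finite, zero_neq_one}) = Some k \<longleftrightarrow> p = unary_word k"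
proof -
  have inj: "k = l" if "(unary_word k :: nat \<Rightarrow> 's) = unary_word l" for k l
  proof -
    have "i < k \<longleftrightarrow> i < l" for i
      using fun_cong[OF that, of i] by (auto simp: unary_word_def split: if_splits)
    then show ?thesis by (metis linorder_neqE_nat less_irrefl)
  qed
  then have the: "(THE l. (unary_word k :: nat \<Rightarrow> 's) = unary_word l) = k" for k
    by (intro the_equality) auto
  have word: "unary_word n = (\<lambda>i. if i < n then 1 else 0)" for n
    by (auto simp: unary_word_def)
  show ?thesis
    unfolding nat_rep_def word[symmetric]
    using the by (cases "\<exists>n. p = unary_word n") auto
qed

text \<open>
  From left to right the machine for \<open>g\<close> is simulated on the words \<open>1^k 0^\<omega>\<close>; from right to
  left a machine for \<open>F\<close> is used. After this, sequences are handled without machines.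
\<close>

lemma computable_sequence_cauchy_rep:
  "computable_sequence (cauchy_rep \<alpha> :: (nat \<Rightarrow> 's::{finite, zero_neq_one}) \<rightharpoonup> 'x::metric_space) g \<longleftrightarrow>
     (\<exists>F. recursive F \<and> (\<forall>k. fast_cauchy \<alpha> (\<lambda>i. F (pair k i)) (g k)))"
proof
  assume "computable_sequence (cauchy_rep \<alpha> :: (nat \<Rightarrow> 's) \<rightharpoonup> 'x) g"
  then obtain G :: "(nat \<Rightarrow> 's) \<rightharpoonup> (nat \<Rightarrow> 's)" and M where M: "machine M"
    and G: "\<And>p q. G p = Some q \<Longrightarrow> transforms M p q"
    and rep: "\<And>p. p \<in> dom ((Some \<circ> g) \<circ>\<^sub>m nat_rep) \<Longrightarrow> (cauchy_rep \<alpha> \<circ>\<^sub>m G) p = ((Some \<circ> g) \<circ>\<^sub>m nat_rep) p"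
    unfolding computable_sequence_def computable_map_def computable_word_function_def by blast
  have "\<exists>n. transforms M (unary_word k) (code_word n) \<and> fast_cauchy \<alpha> n (g k)" for k
  proof -
    have "nat_rep (unary_word k :: nat \<Rightarrow> 's) = Some k" by (simp add: nat_rep_eq_Some)
    then have "(cauchy_rep \<alpha> \<circ>\<^sub>m G) (unary_word k) = Some (g k)"
      using rep[of "unary_word k"] by (simp add: dom_def)
    then obtain q where "G (unary_word k) = Some q" "cauchy_rep \<alpha> q = Some (g k)"
      by (auto simp: map_comp_Some_iff)
    then show ?thesis using G by (auto simp: cauchy_rep_eq_Some)
  qed
  then obtain n where n: "\<And>k. transforms M (unary_word k) (code_word (n k))" "\<And>k. fast_cauchy \<alpha> (n k) (g k)"
    by metis
  have "to_nat (unary_word k i :: 's) = (if Suc i \<le> k then to_nat (1 :: 's) else to_nat (0 :: 's))" for k i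
    by (auto simp: unary_word_def)
  then have "recursive (\<lambda>x. to_nat (unary_word (left x) (right x) :: 's))"
    by (simp only:) (intro rec_intros)
  from recursive_machine_output[OF M n(1) this]
  have "recursive (\<lambda>x. n (left x) (right x))" .
  with n(2) show "\<exists>F. recursive F \<and> (\<forall>k. fast_cauchy \<alpha> (\<lambda>i. F (pair k i)) (g k))"
    by (intro exI[of _ "\<lambda>x. n (left x) (right x)"]) simp
next
  assume "\<exists>F. recursive F \<and> (\<forall>k. fast_cauchy \<alpha> (\<lambda>i. F (pair k i)) (g k))"
  then obtain F where F: "recursive F" "\<And>k. fast_cauchy \<alpha> (\<lambda>i. F (pair k i)) (g k)" by blast
  obtain M :: "'s machine" where M: "machine M"
    "\<And>k. transforms M (unary_word k) (code_word (\<lambda>i. F (pair k i)))"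
    using machine_on_unary_words[OF F(1)] by blast
  define G :: "(nat \<Rightarrow> 's) \<rightharpoonup> (nat \<Rightarrow> 's)" where
    "G p = map_option (\<lambda>k. code_word (\<lambda>i. F (pair k i))) (nat_rep p)" for p
  have "computable_word_function G"
    unfolding computable_word_function_def
    by (intro exI[of _ M]) (auto simp: M G_def nat_rep_eq_Some)
  moreover have "(cauchy_rep \<alpha> \<circ>\<^sub>m G) p = ((Some \<circ> g) \<circ>\<^sub>m nat_rep) p"
      if p: "p \<in> dom ((Some \<circ> g) \<circ>\<^sub>m nat_rep)" for p
  proof -
    obtain k where k: "nat_rep p = Some k" using p by (auto simp: map_comp_Some_iff)
    have "cauchy_rep \<alpha> (code_word (\<lambda>i. F (pair k i)) :: nat \<Rightarrow> 's) = Some (g k)"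
      using F(2) by (auto simp: cauchy_rep_eq_Some)
    then show ?thesis by (simp add: map_comp_def G_def k)
  qed
  ultimately show "computable_sequence (cauchy_rep \<alpha> :: (nat \<Rightarrow> 's) \<rightharpoonup> 'x) g"
    unfolding computable_sequence_def computable_map_def by blast
qed

lemma computable_map_cauchy_repI:
  fixes \<alpha> :: "nat \<Rightarrow> 'x::metric_space" and \<beta> :: "nat \<Rightarrow> 'y::metric_space"
  assumes F: "recursive F"
    and V: "\<And>n x. fast_cauchy \<alpha> n x \<Longrightarrow> fast_cauchy \<beta> (\<lambda>i. F (pair i (n (i + k)))) (V x)"
  shows "computable_map (cauchy_rep \<alpha> :: (nat \<Rightarrow> 's::{finite, zero_neq_one}) \<rightharpoonup> 'x) (cauchy_rep \<beta>) (Some \<circ> V)"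
proof -
  obtain M :: "'s machine" where M: "machine M"
    "\<And>p n. codes p n \<Longrightarrow> transforms M p (code_word (\<lambda>i. F (pair i (n (i + k)))))"
    by (rule machine_on_codes[OF F, of k]) blast
  define G :: "(nat \<Rightarrow> 's) \<rightharpoonup> (nat \<Rightarrow> 's)" where
    "G p = (if \<exists>n. codes p n then Some (code_word (\<lambda>i. F (pair i ((SOME n. codes p n) (i + k))))) else
        None)" for p
  have G: "G (code_word n) = Some (code_word (\<lambda>i. F (pair i (n (i + k)))))" for n
  proof -
    have "(SOME n'. codes (code_word n :: nat \<Rightarrow> 's) n') = n"
      by (rule some_equality) (auto simp: codes_iff dest: code_word_inject)
    then show ?thesis by (auto simp: G_def codes_iff)
  qed
  have "transforms M p q" if "G p = Some q" for p q
  proof -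
    have "\<exists>n. codes p n" using that by (auto simp: G_def split: if_splits)
    then obtain n where n: "codes p n" ..
    then show ?thesis using that M(2)[OF n] G[of n] by (simp add: codes_iff)
  qed
  then have "computable_word_function G"
    unfolding computable_word_function_def using M(1) by blast
  moreover have "(cauchy_rep \<beta> \<circ>\<^sub>m G) p = ((Some \<circ> V) \<circ>\<^sub>m cauchy_rep \<alpha>) p"
      if p: "p \<in> dom ((Some \<circ> V) \<circ>\<^sub>m cauchy_rep \<alpha>)" for p
  proof -
    obtain x where x: "cauchy_rep \<alpha> p = Some x" using p by (auto simp: map_comp_Some_iff)
    then obtain n where n: "p = code_word n" "fast_cauchy \<alpha> n x" by (auto simp: cauchy_rep_eq_Some)
    have "cauchy_rep \<beta> (code_word (\<lambda>i. F (pair i (n (i + k)))) :: nat \<Rightarrow> 's) = Some (V x)"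
      using V[OF n(2)] by (auto simp: cauchy_rep_eq_Some)
    moreover have "((Some \<circ> V) \<circ>\<^sub>m cauchy_rep \<alpha>) p = Some (V x)" by (simp add: map_comp_def x)
    ultimately show ?thesis by (simp add: map_comp_def G n(1))
  qed
  ultimately show ?thesis unfolding computable_map_def by blast
qed

lemma computable_map_cauchy_repE:
  fixes \<alpha> :: "nat \<Rightarrow> 'x::metric_space" and \<beta> :: "nat \<Rightarrow> 'y::metric_space"
  assumes "computable_map (cauchy_rep \<alpha> :: (nat \<Rightarrow> 's::{finite, zero_neq_one}) \<rightharpoonup> 'x) (cauchy_rep \<beta>) (Some \<circ> V)"
  obtains M :: "'s::{finite, zero_neq_one} machine" where "machine M"
    "\<And>n x. fast_cauchy \<alpha> n x \<Longrightarrow> \<exists>m. transforms M (code_word n) (code_word m) \<and> fast_cauchy \<beta> m (V x)"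
proof -
  obtain G :: "(nat \<Rightarrow> 's) \<rightharpoonup> (nat \<Rightarrow> 's)" and M where M: "machine M"
    and G: "\<And>p q. G p = Some q \<Longrightarrow> transforms M p q"
    and rep: "\<And>p. p \<in> dom ((Some \<circ> V) \<circ>\<^sub>m cauchy_rep \<alpha>) \<Longrightarrow>
        (cauchy_rep \<beta> \<circ>\<^sub>m G) p = ((Some \<circ> V) \<circ>\<^sub>m cauchy_rep \<alpha>) p"
    using assms unfolding computable_map_def computable_word_function_def by blast
  show thesis
  proof (rule that[OF M])
    fix n x assume "fast_cauchy \<alpha> n x"
    then have "cauchy_rep \<alpha> (code_word n :: nat \<Rightarrow> 's) = Some x" by (auto simp: cauchy_rep_eq_Some)
    then have "(cauchy_rep \<beta> \<circ>\<^sub>m G) (code_word n) = Some (V x)"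
      using rep[of "code_word n"] by (simp add: dom_def)
    then obtain q where "G (code_word n) = Some q" "cauchy_rep \<beta> q = Some (V x)"
      by (auto simp: map_comp_Some_iff)
    then show "\<exists>m. transforms M (code_word n) (code_word m) \<and> fast_cauchy \<beta> m (V x)"
      using G by (auto simp: cauchy_rep_eq_Some)
  qed
qed

section \<open>Continuity of computable operators\<close>

lemma input_pos_le: "input_pos ((step M p ^^ t) (initial M)) \<le> t"
proof (induction t)
  case (Suc t)
  have "move_input d i \<le> Suc i" for d i by (cases d) auto
  then have "input_pos (step M p c) \<le> Suc (input_pos c)" for c
    by (simp add: step_def split: prod.split)
  then show ?case using Suc by (auto intro: order_trans)
qed (simp add: initial_def)

lemma output_after_local:
  assumes "\<And>j. j < t \<Longrightarrow> p j = p' j"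
  shows "output_after M p t = output_after M p' t"
proof -
  have "(step M p ^^ t) (initial M) = (step M p' ^^ t) (initial M)"
    using assms
  proof (induction t)
    case (Suc t)
    have "p (input_pos ((step M p ^^ t) (initial M))) = p' (input_pos ((step M p ^^ t) (initial M)))"
      using input_pos_le[of t M p] by (intro Suc.prems) simp
    moreover have "(step M p ^^ t) (initial M) = (step M p' ^^ t) (initial M)"
      using Suc by simp
    moreover have "step M p c = step M p' c" if "p (input_pos c) = p' (input_pos c)" for c
      by (simp add: step_def that)
    ultimately show ?case by simp
  qed simp
  then show ?thesis by (simp add: output_after_def)
qed

lemma code_word_cong:
  assumes "\<And>i. i \<le> j \<Longrightarrow> n i = n' i"
  shows "(code_word n j :: 's::{finite, zero_neq_one}) = code_word n' j"
proof -
  have "i \<le> Suc j \<Longrightarrow> (blocks n i :: 's list) = blocks n' i" for i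
    by (induction i) (simp_all add: blocks_Suc assms)
  from this[OF order_refl] show ?thesis by (simp add: code_word_def)
qed

text \<open>
  The block of index 0 ends before the zero at position \<open>m 0 + 2\<close>, so it is determined by
  the letters up to this position.
\<close>

lemma first_code_eq:
  assumes agree: "\<And>j. j \<le> Suc (Suc (m 0)) \<Longrightarrow> (code_word m j :: 's::{finite, zero_neq_one}) = code_word m' j"
  shows "m 0 = m' 0"
proof -
  have end0: "(code_word n (Suc (Suc (n 0))) :: 's) = 0" for n
    using code_word_block(1)[of n 1] by simp
  have one: "(code_word n (Suc (Suc k)) :: 's) = 1" if "k < n 0" for n k
    using code_word_block(2)[of "Suc k" n 0] that by simp
  show ?thesis
  proof (rule linorder_cases[of "m 0" "m' 0"])
    assume "m 0 < m' 0"
    then show ?thesis using agree[of "Suc (Suc (m 0))"] end0[of m] one[of "m 0" m'] by simp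
  next
    assume "m' 0 < m 0"
    then show ?thesis using agree[of "Suc (Suc (m' 0))"] end0[of m'] one[of "m' 0" m] by simp
  qed
qed

text \<open>
  On the name \<open>\<langle>0, 0, \<dots>\<rangle>\<close> of the zero vector, the machine has written the first block after
  some number \<open>t\<close> of steps, having read at most \<open>t\<close> letters. A vector of norm less than
  \<open>1 / 2 ^ (t + 2)\<close> has a name whose first \<open>t\<close> blocks are those of the zero vector. On this
  name the machine writes the same first block, so one vector is within distance 1 of both
  images. So \<open>V\<close> is bounded by 2 on a ball, and by linearity it is bounded.
\<close>

lemma computable_linear_bounded:
  fixes \<alpha> :: "nat \<Rightarrow> 'x::real_normed_vector" and \<beta> :: "nat \<Rightarrow> 'y::real_normed_vector"
  assumes comp: "computable_map (cauchy_rep \<alpha> :: (nat \<Rightarrow> 's::{finite,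
      zero_neq_one}) \<rightharpoonup> 'x) (cauchy_rep \<beta>) (Some \<circ> V)"
    and lin: "linear V" and \<alpha>0: "\<alpha> 0 = 0" and dense: "closure (range \<alpha>) = UNIV"
  shows "bounded_linear V"
proof -
  interpret linear V by fact
  obtain M :: "'s machine" where M: "machine M"
    "\<And>n x. fast_cauchy \<alpha> n x \<Longrightarrow> \<exists>m. transforms M (code_word n) (code_word m) \<and> fast_cauchy \<beta> m (V x)"
    by (rule computable_map_cauchy_repE[OF comp]) blast
  have "fast_cauchy \<alpha> (\<lambda>_. 0) 0" by (rule fast_cauchyI) (simp add: \<alpha>0)
  then obtain m where m: "transforms M (code_word (\<lambda>_. 0)) (code_word m)" "fast_cauchy \<beta> m (V 0)"
    using M(2) by blast
  obtain t where t: "Suc (Suc (m 0)) < length (output_after M (code_word (\<lambda>_. 0)) t)"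
    using m(1) unfolding transforms_def by blast
  have small: "norm (V x) \<le> 2" if x: "norm x < 1 / 2 ^ (t + 2)" for x
  proof -
    have "\<exists>a. dist (\<alpha> a) x < 1 / 2 ^ (i + 2)" for i
    proof -
      have "x \<in> closure (range \<alpha>)" by (simp add: dense)
      then show ?thesis unfolding closure_approachable
          by (metis divide_pos_pos rangeE zero_less_numeral zero_less_one zero_less_power)
    qed
    then obtain a where a: "\<And>i. dist (\<alpha> (a i)) x < 1 / 2 ^ (i + 2)" by metis
    \<comment> \<open>a block has at least two letters, so the first \<open>t\<close> blocks cover the first \<open>t\<close> letters\<close>
    define n where "n i = (if i < t then 0 else a i)" for i
    have "fast_cauchy \<alpha> n x"
    proof (rule fast_cauchyI)
      fix i
      have "norm x < 1 / 2 ^ (i + 2)" if "i < t"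
      proof -
        have "(1::real) / 2 ^ (t + 2) \<le> 1 / 2 ^ (i + 2)"
          using that by (intro divide_left_mono power_increasing) auto
        then show ?thesis using x by linarith
      qed
      then show "dist (\<alpha> (n i)) x < 1 / 2 ^ (i + 2)"
        using a[of i] by (auto simp: n_def \<alpha>0)
    qed
    then obtain m' where m': "transforms M (code_word n) (code_word m')" "fast_cauchy \<beta> m' (V x)"
      using M(2) by blast
    have "(code_word n j :: 's) = code_word (\<lambda>_. 0) j" if "j < t" for j
      by (rule code_word_cong) (use that in \<open>simp add: n_def\<close>)
    then have out: "output_after M (code_word n) t = output_after M (code_word (\<lambda>_. 0)) t"
      by (rule output_after_local)
    have "(code_word m j :: 's) = code_word m' j" if "j \<le> Suc (Suc (m 0))" for j
      using transforms_nth[OF m(1), of j t] transforms_nth[OF m'(1), of j t] out t that by simp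
    then have "m 0 = m' 0" by (rule first_code_eq)
    have "norm (V x) = dist (V x) (V 0)" by (simp add: zero)
    also have "\<dots> \<le> dist (\<beta> (m' 0)) (V x) + dist (\<beta> (m 0)) (V 0)"
      using dist_triangle3[of "V x" "V 0" "\<beta> (m' 0)"] \<open>m 0 = m' 0\<close> by simp
    also have "\<dots> \<le> 2"
      using fast_cauchy_dist[OF m(2), of 0] fast_cauchy_dist[OF m'(2), of 0] by simp
    finally show ?thesis .
  qed
  define c where "c = 1 / (2 :: real) ^ (t + 3)"
  have c: "0 < c" "c < 1 / 2 ^ (t + 2)" by (simp_all add: c_def field_simps power_add)
  show ?thesis
  proof (rule bounded_linear_intro)
    fix x
    show "norm (V x) \<le> norm x * (2 / c)"
    proof (cases "x = 0")
      case False
      let ?y = "(c / norm x) *\<^sub>R x"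
      have "norm ?y = c" using False c by simp
      then have "norm (V ?y) \<le> 2" using c by (intro small) simp
      then have "c / norm x * norm (V x) \<le> 2" using c by (simp add: scale)
      then show ?thesis using False c by (simp add: field_simps)
    qed (simp add: zero)
  qed (simp_all add: add scale)
qed

section \<open>Hilbert space geometry\<close>

context hilbert_space
begin

lemma ip_add_right: "ip x (y + z) = ip x y + ip x z"
  by (metis ip_add_left ip_conj conj_add)

lemma ip_scale_right: "ip x (smul a y) = conjugate a * ip x y"
  by (metis ip_scale_left ip_conj conj_mult)

lemma norm_ip_commute: "norm (ip x y) = norm (ip y x)"
  by (metis ip_conj norm_conj)

lemma ip_diff_left: "ip (x - y) z = ip x z - ip y z"
  by (metis ip_add_left add_diff_cancel diff_add_cancel)

lemma ip_diff_right: "ip z (x - y) = ip z x - ip z y"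
  by (metis ip_add_right add_diff_cancel diff_add_cancel)

lemma norm_ip_self: "norm (ip x x) = (norm x)\<^sup>2"
  by (simp add: ip_self del: of_real_power)

lemma norm_smul: "norm (smul a x) = norm a * norm x"
proof -
  have "ip (smul a x) (smul a x) = (a * conjugate a) * ip x x"
    by (simp add: ip_scale_left ip_scale_right mult.assoc)
  then have "norm (ip (smul a x) (smul a x)) = (norm a)\<^sup>2 * (norm x)\<^sup>2"
    by (simp add: norm_mult norm_conj norm_ip_self power2_eq_square)
  then have "(norm (smul a x))\<^sup>2 = (norm a * norm x)\<^sup>2"
    by (simp add: norm_ip_self power_mult_distrib)
  then show ?thesis by simp
qed

text \<open>
  The usual argument: \<open>x - a y\<close> with \<open>a = \<langle>x, y\<rangle> / \<parallel>y\<parallel>\<^sup>2\<close> is orthogonal to \<open>y\<close>, and its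
  squared norm \<open>\<parallel>x\<parallel>\<^sup>2 - \<bar>\<langle>x, y\<rangle>\<bar>\<^sup>2 / \<parallel>y\<parallel>\<^sup>2\<close> is nonnegative. The computation takes place in
  the scalar field, and only its result is compared with real numbers.
\<close>

lemma cauchy_schwarz: "norm (ip x y) \<le> norm x * norm y"
proof (cases "y = 0")
  case True
  have "ip x 0 = 0" using ip_diff_right[of x 0 0] by simp
  then show ?thesis using True by simp
next
  case False
  define N where "N = (norm y)\<^sup>2"
  define b where "b = ip x y"
  define a where "a = b / of_real N"
  have N: "0 < N" "(of_real N :: 'f) \<noteq> 0" using False by (simp_all add: N_def)
  have cr: "conjugate (of_real r :: 'f) = of_real r" for r
    using conj_re_im[of r 0] by simp
  have yx: "ip y x = conjugate b" unfolding b_def by (rule ip_conj)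
  have "a * of_real N = b" using N by (simp add: a_def)
  then have ca: "conjugate a * of_real N = conjugate b" by (metis conj_mult cr)
  have "ip (x - smul a y) (x - smul a y) =
      ip x x - conjugate a * b - a * conjugate b + a * (conjugate a * of_real N)"
    by (simp add: ip_diff_left ip_diff_right ip_scale_left ip_scale_right yx ip_self[of y]
        N_def[symmetric] b_def[symmetric] algebra_simps del: of_real_power)
  also have "\<dots> = ip x x - conjugate a * b"
    by (simp add: ca)
  also have "conjugate a * b = of_real ((norm b)\<^sup>2 / N)"
  proof -
    have "conjugate a * b * of_real N = b * conjugate b" by (metis ca mult.commute mult.left_commute)
    then have "conjugate a * b * of_real N = of_real ((norm b)\<^sup>2)" by (simp only: mult_conj_self)
    then show ?thesis using N by (simp add: field_simps del: of_real_power)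
  qed
  finally have "of_real ((norm (x - smul a y))\<^sup>2) = (of_real ((norm x)\<^sup>2 - (norm b)\<^sup>2 / N) :: 'f)"
    by (simp only: ip_self of_real_diff)
  then have "(norm (x - smul a y))\<^sup>2 = (norm x)\<^sup>2 - (norm b)\<^sup>2 / N"
    by (simp only: of_real_eq_iff)
  then have "(norm b)\<^sup>2 / N \<le> (norm x)\<^sup>2"
    by (metis diff_ge_0_iff_ge zero_le_power2)
  then have "(norm b)\<^sup>2 \<le> (norm x * norm y)\<^sup>2"
    using N(1) by (simp add: field_simps N_def power_mult_distrib)
  then show ?thesis
    unfolding b_def by (rule power2_le_imp_le) simp
qed

lemma bounded_linear_ip: "bounded_linear (\<lambda>x. ip x y)"
proof (rule bounded_linear_intro[where K = "norm y"])
  fix r x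
  show "ip (r *\<^sub>R x) y = r *\<^sub>R ip x y"
    by (metis scale_of_real ip_scale_left scaleR_conv_of_real)
qed (simp_all add: ip_add_left cauchy_schwarz)

lemma ip_sum_left: "ip (\<Sum>i\<in>S. h i) y = (\<Sum>i\<in>S. ip (h i) y)"
  using linear_sum[OF bounded_linear.linear[OF bounded_linear_ip[of y]]] .

lemma ip_eqI:
  assumes "\<And>z. ip x z = ip y z" shows "x = y"
proof -
  have "ip (x - y) (x - y) = 0" using assms by (simp add: ip_diff_left)
  then have "norm (ip (x - y) (x - y)) = 0" by simp
  then show ?thesis by (simp add: norm_ip_self)
qed

section \<open>Bessel sequences and duality\<close>

text \<open>
  With \<open>y\<close> the sum on the left, \<open>\<parallel>y\<parallel>\<^sup>2 = (\<Sum>i\<in>S. c\<^sub>i \<langle>f\<^sub>i, y\<rangle>)\<close>. The Cauchy-Schwarz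
  inequality for finite sums and the Bessel bound for \<open>y\<close> leave a factor \<open>\<parallel>y\<parallel>\<close> on both
  sides.
\<close>

lemma bessel_sum_le:
  assumes summable: "\<And>x. summable (\<lambda>i. (norm (ip x (f i)))\<^sup>2)"
    and bound: "\<And>x. (\<Sum>i. (norm (ip x (f i)))\<^sup>2) \<le> B * (norm x)\<^sup>2" and "0 \<le> B" and "finite S"
  shows "norm (\<Sum>i\<in>S. smul (c i) (f i)) \<le> sqrt B * L2_set (\<lambda>i. norm (c i)) S"
proof -
  let ?y = "\<Sum>i\<in>S. smul (c i) (f i)"
  have "(norm ?y)\<^sup>2 = norm (\<Sum>i\<in>S. c i * ip (f i) ?y)"
    by (simp add: norm_ip_self[symmetric] ip_sum_left ip_scale_left)
  also have "\<dots> \<le> (\<Sum>i\<in>S. \<bar>norm (c i)\<bar> * \<bar>norm (ip ?y (f i))\<bar>)"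
    by (rule order_trans[OF norm_sum]) (simp add: norm_mult norm_ip_commute[of ?y])
  also have "\<dots> \<le> L2_set (\<lambda>i. norm (c i)) S * L2_set (\<lambda>i. norm (ip ?y (f i))) S"
    by (rule L2_set_mult_ineq)
  also have "L2_set (\<lambda>i. norm (ip ?y (f i))) S \<le> sqrt B * norm ?y"
  proof -
    have "(\<Sum>i\<in>S. (norm (ip ?y (f i)))\<^sup>2) \<le> B * (norm ?y)\<^sup>2"
      using sum_le_suminf[OF summable \<open>finite S\<close>, of ?y] bound[of ?y] by simp
    then have "L2_set (\<lambda>i. norm (ip ?y (f i))) S \<le> sqrt (B * (norm ?y)\<^sup>2)"
      unfolding L2_set_def by (rule real_sqrt_le_mono)
    then show ?thesis by (simp add: real_sqrt_mult)
  qed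
  finally have "norm ?y * norm ?y \<le> (sqrt B * L2_set (\<lambda>i. norm (c i)) S) * norm ?y"
    by (simp add: power2_eq_square mult_left_mono mult.assoc mult.left_commute)
  then show ?thesis
    using \<open>0 \<le> B\<close> by (cases "norm ?y = 0") (auto simp: mult_le_cancel_right)
qed

lemma bessel_summable:
  assumes summable: "\<And>x. summable (\<lambda>i. (norm (ip x (f i)))\<^sup>2)"
    and bound: "\<And>x. (\<Sum>i. (norm (ip x (f i)))\<^sup>2) \<le> B * (norm x)\<^sup>2" and B: "0 \<le> B"
    and c: "summable (\<lambda>i. (norm (c i))\<^sup>2)"
  shows "summable (\<lambda>i. smul (c i) (f i))"
  unfolding summable_Cauchy
proof (intro allI impI)
  fix e :: real assume e: "0 < e"
  define d where "d = e / (sqrt B + 1)"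
  have "0 < sqrt B + 1" using B by (simp add: add_nonneg_pos)
  then have d: "0 < d" "d * (sqrt B + 1) = e" using e by (simp_all add: d_def)
  then obtain N where N: "\<And>m n. N \<le> m \<Longrightarrow> norm (\<Sum>i\<in>{m..<n}. (norm (c i))\<^sup>2) < d\<^sup>2"
    using c unfolding summable_Cauchy by (meson zero_less_power)
  show "\<exists>N. \<forall>m\<ge>N. \<forall>n. norm (\<Sum>i\<in>{m..<n}. smul (c i) (f i)) < e"
  proof (intro exI[of _ N] allI impI)
    fix m n assume "N \<le> m"
    from N[OF this, of n] have "L2_set (\<lambda>i. norm (c i)) {m..<n} < sqrt (d\<^sup>2)"
      unfolding L2_set_def by (intro real_sqrt_less_mono) (simp add: abs_of_nonneg sum_nonneg)
    then have L: "L2_set (\<lambda>i. norm (c i)) {m..<n} < d" using d by simp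
    have "norm (\<Sum>i\<in>{m..<n}. smul (c i) (f i)) \<le> sqrt B * L2_set (\<lambda>i. norm (c i)) {m..<n}"
      by (rule bessel_sum_le[OF summable bound B]) simp
    also have "\<dots> \<le> sqrt B * d" using L B by (intro mult_left_mono) auto
    also have "\<dots> < e" using d by (simp add: algebra_simps)
    finally show "norm (\<Sum>i\<in>{m..<n}. smul (c i) (f i)) < e" .
  qed
qed

lemma bessel_suminf_le:
  assumes summable: "\<And>x. summable (\<lambda>i. (norm (ip x (f i)))\<^sup>2)"
    and bound: "\<And>x. (\<Sum>i. (norm (ip x (f i)))\<^sup>2) \<le> B * (norm x)\<^sup>2" and B: "0 \<le> B"
  shows "norm (\<Sum>i. smul (coord c i) (f i)) \<le> sqrt B * norm c"
proof (rule LIMSEQ_le_const2)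
  show "(\<lambda>n. norm (\<Sum>i<n. smul (coord c i) (f i))) \<longlonglongrightarrow> norm (\<Sum>i. smul (coord c i) (f i))"
    by (intro tendsto_norm summable_LIMSEQ bessel_summable[OF summable bound B] summable_coord)
  have "norm (\<Sum>i<n. smul (coord c i) (f i)) \<le> sqrt B * norm c" for n
  proof -
    have "norm (\<Sum>i<n. smul (coord c i) (f i)) \<le> sqrt B * L2_set (\<lambda>i. norm (coord c i)) {..<n}"
      by (rule bessel_sum_le[OF summable bound B]) simp
    also have "\<dots> \<le> sqrt B * norm c"
      using B by (intro mult_left_mono L2_set_coord_le) simp
    finally show ?thesis .
  qed
  then show "\<exists>N. \<forall>n\<ge>N. norm (\<Sum>i<n. smul (coord c i) (f i)) \<le> sqrt B * norm c" by blast
qed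

text \<open>
  The series converges because \<open>g\<close> is a Bessel sequence. Its inner product with any \<open>z\<close> is
  the complex conjugate, term by term, of the expansion of \<open>\<langle>z, x\<rangle>\<close> given by the assumed
  duality at \<open>z\<close>.
\<close>

lemma dual_frame_swap:
  assumes f: "frame ip f" and g: "frame ip g"
    and dual: "\<And>x. (\<lambda>i. smul (ip x (g i)) (f i)) sums x"
  shows "(\<lambda>i. smul (ip x (f i)) (g i)) sums x"
proof -
  obtain B where B: "0 \<le> B" "\<And>x. summable (\<lambda>i. (norm (ip x (g i)))\<^sup>2)"
    "\<And>x. (\<Sum>i. (norm (ip x (g i)))\<^sup>2) \<le> B * (norm x)\<^sup>2"
    using g unfolding frame_def by (meson less_imp_le)
  have "summable (\<lambda>i. (norm (ip x (f i)))\<^sup>2)" using f unfolding frame_def by blast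
  then have summable: "summable (\<lambda>i. smul (ip x (f i)) (g i))"
    by (rule bessel_summable[OF B(2,3,1)])
  have "(\<Sum>i. smul (ip x (f i)) (g i)) = x"
  proof (rule ip_eqI)
    fix z
    have left: "(\<lambda>i. ip (smul (ip x (f i)) (g i)) z) sums ip (\<Sum>i. smul (ip x (f i)) (g i)) z"
      by (rule bounded_linear.sums[OF bounded_linear_ip summable_sums[OF summable]])
    have "(\<lambda>i. ip (smul (ip z (g i)) (f i)) x) sums ip z x"
      by (rule bounded_linear.sums[OF bounded_linear_ip dual])
    then have "(\<lambda>i. conjugate (ip (smul (ip z (g i)) (f i)) x)) sums conjugate (ip z x)"
      by (rule bounded_linear.sums[OF bounded_linear_conj])
    moreover have "conjugate (ip (smul (ip z (g i)) (f i)) x) = ip (smul (ip x (f i)) (g i)) z" for i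
      by (simp add: ip_scale_left conj_mult ip_conj[symmetric])
    ultimately have "(\<lambda>i. ip (smul (ip x (f i)) (g i)) z) sums ip x z"
      by (simp add: ip_conj[symmetric])
    with left show "ip (\<Sum>i. smul (ip x (f i)) (g i)) z = ip x z"
      by (rule sums_unique2)
  qed
  with summable_sums[OF summable] show ?thesis by simp
qed

end

section \<open>Square-summable sequences\<close>

lemma vector_space_ell2: "vector_space (scale_ell2 :: 'f::rc_field \<Rightarrow> _)"
  by (rule hilbert_space.axioms(1)[OF hilbert_space_ell2])

lemmas module_ell2 = vector_space_ell2[unfolded module_iff_vector_space[symmetric]]

lemma coord_sum: "coord (\<Sum>i\<in>S. h i) j = (\<Sum>i\<in>S. coord (h i) j)"
  by (induction S rule: infinite_finite_induct) (simp_all add: zero_ell2.rep_eq plus_ell2.rep_eq)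

lemma coord_partial_sum:
  "coord (\<Sum>i<n. scale_ell2 (c i) (unit_ell2 i)) j = (if j < n then c j else 0)"
proof -
  have "coord (\<Sum>i<n. scale_ell2 (c i) (unit_ell2 i)) j = (\<Sum>i<n. if j = i then c i else 0)"
    unfolding coord_sum scale_ell2.rep_eq unit_ell2.rep_eq by (intro sum.cong) auto
  then show ?thesis by simp
qed

lemma ell2_unit_sums:
  fixes c :: "'f::rc_field ell2"
  shows "(\<lambda>i. scale_ell2 (coord c i) (unit_ell2 i)) sums c"
  unfolding sums_def
proof (rule LIMSEQ_I)
  fix r :: real assume "0 < r"
  then obtain N where N: "\<And>n. N \<le> n \<Longrightarrow> norm (\<Sum>i. (norm (coord c (i + n)))\<^sup>2) < r\<^sup>2"
    using suminf_exist_split[OF _ summable_coord[of c], of "r\<^sup>2"] by auto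
  have "norm ((\<Sum>i<n. scale_ell2 (coord c i) (unit_ell2 i)) - c) < r" if "N \<le> n" for n
  proof -
    let ?d = "(\<Sum>i<n. scale_ell2 (coord c i) (unit_ell2 i)) - c"
    have d: "coord ?d i = (if i < n then 0 else - coord c i)" for i
      by (simp add: minus_ell2.rep_eq coord_partial_sum)
    have "(\<Sum>i. (norm (coord ?d i))\<^sup>2) = (\<Sum>i. (norm (coord ?d (i + n)))\<^sup>2) + (\<Sum>i<n. (norm (coord ?d i))\<^sup>2)"
      by (rule suminf_split_initial_segment[OF summable_coord])
    also have "\<dots> = (\<Sum>i. (norm (coord c (i + n)))\<^sup>2)" by (simp add: d)
    also have "\<dots> < r\<^sup>2" using N[OF that] unfolding real_norm_def abs_less_iff by blast
    finally have "sqrt (\<Sum>i. (norm (coord ?d i))\<^sup>2) < sqrt (r\<^sup>2)" by (rule real_sqrt_less_mono)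
    then show ?thesis unfolding norm_ell2_def using \<open>0 < r\<close> by simp
  qed
  then show "\<exists>no. \<forall>n\<ge>no. norm ((\<Sum>i<n. scale_ell2 (coord c i) (unit_ell2 i)) - c) < r" by blast
qed

lemma rat_num_dense:
  assumes "0 < (\<delta> :: real)" obtains a where "\<bar>rat_num a - r\<bar> < \<delta>"
proof -
  obtain k where k: "1 / (real k + 1) < \<delta>"
    using reals_Archimedean[OF assms] by (auto simp: inverse_eq_divide add.commute)
  define z where "z = \<lfloor>r * (real k + 1)\<rfloor>"
  have z: "of_int z \<le> r * (real k + 1)" "r * (real k + 1) < of_int z + 1"
    unfolding z_def by linarith+
  have diff: "real (nat z) - real (nat (- z)) = of_int z" by (cases "0 \<le> z") auto
  have "\<bar>of_int z / (real k + 1) - r\<bar> \<le> 1 / (real k + 1)"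
  proof -
    have "of_int z / (real k + 1) - r = (of_int z - r * (real k + 1)) / (real k + 1)"
      by (simp add: field_simps)
    moreover have "\<bar>of_int z - r * (real k + 1)\<bar> \<le> 1" using z by linarith
    ultimately show ?thesis by (simp add: divide_right_mono)
  qed
  then show thesis
    using k that[of "pair (nat z) (pair (nat (- z)) k)"] by (simp add: rat_num_pair diff)
qed

lemma scalar_num_dense:
  assumes "0 < (\<delta> :: real)" obtains a where "norm (scalar_num a - (z :: 'f::rc_field)) < \<delta>"
proof -
  obtain u v where z: "z = of_real u + of_real v * imag_unit" using re_im_exhaust by blast
  have "0 < \<delta> / 2" using assms by simp
  then obtain a b where a: "\<bar>rat_num a - u\<bar> < \<delta> / 2" and b: "\<bar>rat_num b - v\<bar> < \<delta> / 2"
    using rat_num_dense by metis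
  show thesis
  proof (cases "imag_unit = (0::'f)")
    case True
    then have "scalar_num a - z = of_real (rat_num a - u)" by (simp add: scalar_num_def z)
    then have "norm (scalar_num a - z) < \<delta>" using a assms by (simp only: norm_of_real)
    then show thesis by (rule that)
  next
    case False
    have "scalar_num (pair a b) - z = of_real (rat_num a - u) + of_real (rat_num b - v) * imag_unit"
      using False by (simp add: scalar_num_def z algebra_simps)
    then have "norm (scalar_num (pair a b) - z) \<le> \<bar>rat_num a - u\<bar> + \<bar>rat_num b - v\<bar>"
      using norm_triangle_ineq[of "of_real (rat_num a - u) :: 'f" "of_real (rat_num b - v) * imag_unit"]
      by (simp only: norm_mult norm_of_real norm_imag_unit[OF False] mult_1_right)
    then have "norm (scalar_num (pair a b) - z) < \<delta>" using a b by linarith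
    then show thesis by (rule that)
  qed
qed

lemma norm_scale_unit: "norm (scale_ell2 a (unit_ell2 i)) = norm (a :: 'f::rc_field)"
proof -
  have "(\<lambda>j. (norm (coord (scale_ell2 a (unit_ell2 i)) j))\<^sup>2) = (\<lambda>j. if j = i then (norm a)\<^sup>2 else 0)"
    by (auto simp: scale_ell2.rep_eq unit_ell2.rep_eq)
  then have "norm (scale_ell2 a (unit_ell2 i)) = sqrt (\<Sum>j. if j = i then (norm a)\<^sup>2 else 0)"
    by (simp only: norm_ell2_def)
  also have "\<dots> = norm a" using sums_unique[OF sums_single[of i "\<lambda>_. (norm a)\<^sup>2"]] by simp
  finally show ?thesis .
qed

lemma scale_ell2_diff_left: "scale_ell2 (a - b) c = scale_ell2 a c - scale_ell2 b c"
  by transfer (simp add: left_diff_distrib)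

text \<open>
  Truncate a square-summable sequence and replace the remaining coordinates by rational
  ones.
\<close>

lemma span_num_ell2_dense: "closure (range (span_num scale_ell2 (unit_ell2 :: nat \<Rightarrow> 'f::rc_field ell2))) = UNIV"
proof -
  have "c \<in> closure (range (span_num scale_ell2 unit_ell2))" for c :: "'f ell2"
    unfolding closure_approachable
  proof (intro allI impI)
    fix r :: real assume r: "0 < r"
    then obtain N where N: "\<And>n. N \<le> n \<Longrightarrow> norm ((\<Sum>i<n. scale_ell2 (coord c i) (unit_ell2 i)) - c) < r / 2"
      using LIMSEQ_D[OF ell2_unit_sums[of c, unfolded sums_def], of "r / 2"] by auto
    define \<delta> where "\<delta> = r / (2 * (real N + 1))"
    have \<delta>: "0 < \<delta>" "(real N + 1) * \<delta> = r / 2" using r by (simp_all add: \<delta>_def field_simps)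
    have "\<exists>a. norm (scalar_num a - coord c i) < \<delta>" for i
      using scalar_num_dense[OF \<delta>(1)] by blast
    then obtain a where a: "\<And>i. norm (scalar_num (a i) - coord c i) < \<delta>"
      by metis
    have "span_num scale_ell2 unit_ell2 (vector_code N a) - (\<Sum>i<Suc N. scale_ell2 (coord c i) (unit_ell2 i)) =
        (\<Sum>i\<le>N. scale_ell2 (scalar_num (a i) - coord c i) (unit_ell2 i))"
      by (simp only: span_num_vector_code lessThan_Suc_atMost sum_subtractf scale_ell2_diff_left)
    then have "norm (span_num scale_ell2 unit_ell2 (vector_code N a) - (\<Sum>i<Suc N. scale_ell2 (coord c i)
        (unit_ell2 i)))
        \<le> (\<Sum>i\<le>N. norm (scalar_num (a i) - coord c i))"
      by (simp only:) (rule order_trans[OF norm_sum], simp add: norm_scale_unit)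
    also have "\<dots> \<le> (\<Sum>i\<le>N. \<delta>)" using a by (intro sum_mono less_imp_le)
    also have "\<dots> = r / 2" using \<delta>(2) by (simp add: algebra_simps)
    finally have "norm (span_num scale_ell2 unit_ell2 (vector_code N a) - c) < r"
      using N[of "Suc N"] norm_triangle_ineq[of "span_num scale_ell2 unit_ell2 (vector_code N a) - (\<Sum>i<Suc
          N. scale_ell2 (coord c i) (unit_ell2 i))"
        "(\<Sum>i<Suc N. scale_ell2 (coord c i) (unit_ell2 i)) - c"] by simp
    then show "\<exists>y\<in>range (span_num scale_ell2 unit_ell2). dist y c < r"
      by (auto simp: dist_norm)
  qed
  then show ?thesis by blast
qed

section \<open>Left inverses of the analysis operator\<close>

lemma (in hilbert_space) bounded_linear_of_scalar_linear:
  assumes "Vector_Spaces.linear scale_ell2 smul V"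
  shows "linear V"
proof (rule linearI)
  fix x y and r :: real
  show "V (x + y) = V x + V y" using assms by (simp add: Vector_Spaces.linear_iff)
  have "V (scale_ell2 (of_real r) x) = smul (of_real r) (V x)" using assms
      by (simp add: Vector_Spaces.linear_iff)
  then show "V (r *\<^sub>R x) = r *\<^sub>R V x"
    by (simp add: hilbert_space.scale_of_real[OF hilbert_space_ell2] scale_of_real)
qed

lemma (in hilbert_space) synthesis_sums:
  assumes lin: "Vector_Spaces.linear scale_ell2 smul V" and V: "bounded_linear V"
  shows "(\<lambda>i. smul (coord c i) (V (unit_ell2 i))) sums V c"
proof -
  have "V (scale_ell2 a x) = smul a (V x)" for a x using lin by (simp add: Vector_Spaces.linear_iff)
  then show ?thesis
    using bounded_linear.sums[OF V ell2_unit_sums[of c]] by simp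
qed

text \<open>
  For the upper bound, let \<open>c\<close> be the truncation of \<open>(\<langle>x, g\<^sub>k\<rangle>)\<close> at \<open>N\<close>, where
  \<open>g\<^sub>k = V \<delta>\<^sub>k\<close>. Then \<open>\<parallel>c\<parallel>\<^sup>2 = \<langle>V c, x\<rangle> \<le> C \<parallel>c\<parallel> \<parallel>x\<parallel>\<close>, so \<open>\<parallel>c\<parallel> \<le> C \<parallel>x\<parallel>\<close> for all \<open>N\<close>. For the
  lower bound, pair the expansion \<open>x = (\<Sum>k. \<langle>x, f\<^sub>k\<rangle> g\<^sub>k)\<close> with \<open>x\<close>: by the Cauchy-Schwarz
  inequality in \<open>\<ell>\<^sup>2\<close>, \<open>\<parallel>x\<parallel>\<^sup>2\<close> is at most \<open>\<surd>B \<parallel>x\<parallel>\<close> times the norm of \<open>(\<langle>x, g\<^sub>k\<rangle>)\<close>.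
\<close>

lemma (in hilbert_space) frame_of_left_inverse:
  assumes lin: "Vector_Spaces.linear scale_ell2 smul V" and V: "bounded_linear V"
    and f: "frame ip f" and inv: "\<And>x. V (analysis ip f x) = x"
  shows "frame ip (\<lambda>k. V (unit_ell2 k))"
    and "(\<lambda>i. smul (ip x (f i)) (V (unit_ell2 i))) sums x"
proof -
  define g where "g k = V (unit_ell2 k)" for k
  have Vc: "(\<lambda>i. smul (coord c i) (g i)) sums V c" for c
    unfolding g_def by (rule synthesis_sums[OF lin V])
  have reconstruct: "(\<lambda>i. smul (ip x (f i)) (g i)) sums x" for x
    using Vc[of "analysis ip f x"] by (simp add: coord_analysis[OF f] inv)
  then show "(\<lambda>i. smul (ip x (f i)) (V (unit_ell2 i))) sums x"
    by (simp add: g_def)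
  obtain C where C: "0 < C" "\<And>c. norm (V c) \<le> norm c * C"
    using bounded_linear.pos_bounded[OF V] by blast
  have partial: "(\<Sum>k<N. (norm (ip x (g k)))\<^sup>2) \<le> C\<^sup>2 * (norm x)\<^sup>2" for x N
  proof -
    define S where "S = (\<Sum>k<N. (norm (ip x (g k)))\<^sup>2)"
    define c where "c = (\<Sum>k<N. scale_ell2 (ip x (g k)) (unit_ell2 k))"
    have coord: "coord c = (\<lambda>j. if j < N then ip x (g j) else 0)"
      unfolding c_def by (rule ext) (rule coord_partial_sum)
    have "S = (\<Sum>i. (norm (coord c i))\<^sup>2)"
      unfolding S_def coord
      using suminf_finite[of "{..<N}" "\<lambda>i. (norm (if i < N then ip x (g i) else 0))\<^sup>2"] by simp
    then have norm_c: "norm c = sqrt S" by (simp add: norm_ell2_def)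
    have "V c = (\<Sum>k<N. smul (ip x (g k)) (g k))"
    proof -
      have "(\<lambda>i. smul (coord c i) (g i)) sums (\<Sum>k<N. smul (coord c k) (g k))"
        by (rule sums_finite) (auto simp: coord)
      moreover have "(\<Sum>k<N. smul (coord c k) (g k)) = (\<Sum>k<N. smul (ip x (g k)) (g k))"
        by (rule sum.cong) (auto simp: coord)
      ultimately show ?thesis using sums_unique2[OF Vc[of c]] by simp
    qed
    then have "ip (V c) x = (\<Sum>k<N. ip x (g k) * conjugate (ip x (g k)))"
      by (simp add: ip_sum_left ip_scale_left ip_conj[symmetric])
    also have "\<dots> = of_real S"
      by (simp only: mult_conj_self S_def of_real_sum)
    finally have "norm (ip (V c) x) = \<bar>S\<bar>" by (simp only: norm_of_real)
    moreover have "0 \<le> S" by (simp add: S_def sum_nonneg)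
    ultimately have "S \<le> norm (V c) * norm x" using cauchy_schwarz[of "V c" x] by simp
    also have "\<dots> \<le> (sqrt S * C) * norm x"
      using C(2)[of c] by (intro mult_right_mono) (simp_all add: norm_c)
    finally have le: "sqrt S * sqrt S \<le> sqrt S * (C * norm x)"
      using \<open>0 \<le> S\<close> by (simp add: mult.assoc)
    have "sqrt S \<le> C * norm x"
    proof (cases "S = 0")
      case False
      then show ?thesis
        using mult_left_le_imp_le[OF le] \<open>0 \<le> S\<close> by simp
    qed (use C(1) in simp)
    then have "(sqrt S)\<^sup>2 \<le> (C * norm x)\<^sup>2"
      by (rule power_mono) (simp add: S_def sum_nonneg)
    then show ?thesis by (simp add: S_def sum_nonneg power_mult_distrib)
  qed
  have summable: "summable (\<lambda>k. (norm (ip x (g k)))\<^sup>2)" for x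
    by (rule summableI_nonneg_bounded[OF _ partial]) simp
  have upper: "(\<Sum>k. (norm (ip x (g k)))\<^sup>2) \<le> C\<^sup>2 * (norm x)\<^sup>2" for x
    by (rule suminf_le_const[OF summable partial])
  obtain B where B: "0 < B" "\<And>x. summable (\<lambda>i. (norm (ip x (f i)))\<^sup>2)"
      "\<And>x. (\<Sum>i. (norm (ip x (f i)))\<^sup>2) \<le> B * (norm x)\<^sup>2"
    using f unfolding frame_def by blast
  have lower: "1 / B * (norm x)\<^sup>2 \<le> (\<Sum>k. (norm (ip x (g k)))\<^sup>2)" for x
  proof -
    define S where "S = (\<Sum>k. (norm (ip x (g k)))\<^sup>2)"
    have S: "0 \<le> S" unfolding S_def by (intro suminf_nonneg summable) simp
    have "(\<lambda>i. ip (smul (ip x (f i)) (g i)) x) sums ip x x"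
      by (rule bounded_linear.sums[OF bounded_linear_ip reconstruct])
    then have "(\<lambda>N. norm (\<Sum>i<N. ip (smul (ip x (f i)) (g i)) x)) \<longlonglongrightarrow> norm (ip x x)"
      unfolding sums_def by (rule tendsto_norm)
    moreover have "norm (\<Sum>i<N. ip (smul (ip x (f i)) (g i)) x) \<le> sqrt B * norm x * sqrt S" for N
    proof -
      have "norm (\<Sum>i<N. ip (smul (ip x (f i)) (g i)) x) \<le> (\<Sum>i<N. \<bar>norm (ip x (f i))\<bar> * \<bar>norm (ip x (g i))\<bar>)"
        by (rule order_trans[OF norm_sum]) (simp add: ip_scale_left norm_mult norm_ip_commute[of x "g _"])
      also have "\<dots> \<le> L2_set (\<lambda>i. norm (ip x (f i))) {..<N} * L2_set (\<lambda>i. norm (ip x (g i))) {..<N}"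
        by (rule L2_set_mult_ineq)
      also have "\<dots> \<le> sqrt (B * (norm x)\<^sup>2) * sqrt S"
      proof (intro mult_mono)
        show "L2_set (\<lambda>i. norm (ip x (f i))) {..<N} \<le> sqrt (B * (norm x)\<^sup>2)"
          unfolding L2_set_def
          by (intro real_sqrt_le_mono order_trans[OF sum_le_suminf[OF B(2)] B(3)]) auto
        show "L2_set (\<lambda>i. norm (ip x (g i))) {..<N} \<le> sqrt S"
          unfolding L2_set_def S_def
          by (intro real_sqrt_le_mono sum_le_suminf summable) auto
      qed (use B(1) in auto)
      finally show ?thesis by (simp add: real_sqrt_mult)
    qed
    ultimately have "norm (ip x x) \<le> sqrt B * norm x * sqrt S"
      by (intro LIMSEQ_le_const2) blast+
    then have "norm x * norm x \<le> (sqrt B * sqrt S) * norm x"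
      by (simp add: norm_ip_self power2_eq_square mult.assoc mult.left_commute mult.commute)
    then have "norm x \<le> sqrt B * sqrt S"
      using B(1) S by (cases "norm x = 0") (auto simp: mult_le_cancel_right)
    then have "(norm x)\<^sup>2 \<le> (sqrt B * sqrt S)\<^sup>2" by (rule power_mono) simp
    then have "(norm x)\<^sup>2 \<le> B * S" using B(1) S by (simp add: power_mult_distrib)
    then show ?thesis using B(1) by (simp add: S_def field_simps)
  qed
  have "frame ip g"
    unfolding frame_def
    by (rule exI[of _ "1 / B"], intro conjI exI[of _ "C\<^sup>2"]) (use B(1) C(1) summable lower upper in auto)
  then show "frame ip (\<lambda>k. V (unit_ell2 k))" by (simp add: g_def[abs_def])
qed

section \<open>Computability of the synthesis operator\<close>

text \<open>
  If \<open>m\<close> codes a rational vector \<open>c'\<close> of finite support, then \<open>V c'\<close> is a finite linear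
  combination of the vectors \<open>V \<delta>\<^sub>j\<close>, and replacing each of these by a sufficiently precise
  approximation gives a vector whose code is a recursive function of \<open>m\<close> and the precision.
  For arbitrary \<open>c\<close>, take \<open>c'\<close> from the name of \<open>c\<close>, far enough to the right to make up for
  the bound \<open>C\<close> of \<open>V\<close>.
\<close>

lemma (in hilbert_space) computable_synthesis:
  assumes lin: "Vector_Spaces.linear scale_ell2 smul V" and V: "bounded_linear V"
    and g: "computable_sequence (hilbert_rep smul e :: (nat \<Rightarrow> 's::{finite,
        zero_neq_one}) \<rightharpoonup> 'h) (\<lambda>k. V (unit_ell2 k))"
  shows "computable_map (hilbert_rep scale_ell2 unit_ell2 :: (nat \<Rightarrow> 's) \<rightharpoonup> 'f ell2) (hilbert_rep smul e)
      (Some \<circ> V)"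
proof -
  obtain C where C: "0 < C" "\<And>c. norm (V c) \<le> norm c * C"
    using bounded_linear.pos_bounded[OF V] by blast
  obtain k where k: "8 * C \<le> 2 ^ k"
    using real_arch_pow[of 2 "8 * C"] by (auto intro: less_imp_le)
  obtain G where G: "recursive G" "\<And>j. fast_cauchy (span_num smul e) (\<lambda>i. G (pair j i)) (V (unit_ell2 j))"
    using g unfolding hilbert_rep_def computable_sequence_cauchy_rep by blast
  \<comment> \<open>\<open>l \<langle>i, m\<rangle>\<close> bounds the sum of the norms of all coefficients in \<open>m\<close>; as \<open>l \<le> 2 ^ l\<close>, that many more bits
      suffice\<close>
  define l where "l x = (right x + 1) * (2 * right x)" for x
  define a where "a x j = G (pair j (l x + left x + 3))" for x j
  have "recursive (\<lambda>z. a (left z) (right z))"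
    unfolding a_def l_def by (intro recursive.comp[OF G(1)] rec_intros)
  then obtain F where F: "recursive F"
    "\<And>x. span_num smul e (F x) =
      (\<Sum>j\<le>left (right x). smul (scalar_num (coefficient (right x) j)) (span_num smul e (a x j)))"
    using recursive_linear_combination[OF vector_space_axioms, of a e] by blast
  have lin': "V (x + y) = V x + V y" "V (scale_ell2 b x) = smul b (V x)" for x y b
    using lin by (simp_all add: Vector_Spaces.linear_iff)
  have approx: "dist (span_num smul e (F (pair i m))) (V (span_num scale_ell2 unit_ell2 m)) \<le>
      1 / 2 ^ (i + 3)" for i m
  proof -
    let ?q = "\<lambda>j. scalar_num (coefficient m j) :: 'f"
    let ?g = "\<lambda>j. span_num smul e (a (pair i m) j)"
    have "span_num scale_ell2 unit_ell2 m = (\<Sum>j\<le>left m. scale_ell2 (?q j) (unit_ell2 j))"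
      by (rule span_num_coefficient) (simp_all add: module.scale_zero_left[OF module_ell2])
    then have "V (span_num scale_ell2 unit_ell2 m) = (\<Sum>j\<le>left m. smul (?q j) (V (unit_ell2 j)))"
      by (simp add: linear_sum[OF bounded_linear.linear[OF V]] lin'(2))
    then have "span_num smul e (F (pair i m)) - V (span_num scale_ell2 unit_ell2 m) =
        (\<Sum>j\<le>left m. smul (?q j) (?g j - V (unit_ell2 j)))"
      by (simp add: F(2) sum_subtractf scale_right_diff_distrib)
    then have "dist (span_num smul e (F (pair i m))) (V (span_num scale_ell2 unit_ell2 m))
        \<le> (\<Sum>j\<le>left m. norm (?q j) * dist (?g j) (V (unit_ell2 j)))"
      unfolding dist_norm by (simp only:) (rule order_trans[OF norm_sum], simp add: norm_smul)
    also have "\<dots> \<le> (\<Sum>j\<le>left m. (2 * real m) * (1 / 2 ^ (l (pair i m) + i + 3)))"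
    proof (intro sum_mono mult_mono)
      fix j
      show "norm (?q j) \<le> 2 * real m"
        by (rule order_trans[OF norm_scalar_num_le]) (simp add: coefficient_le)
      show "dist (?g j) (V (unit_ell2 j)) \<le> 1 / 2 ^ (l (pair i m) + i + 3)"
        using fast_cauchy_dist[OF G(2)] by (simp add: a_def)
    qed auto
    also have "\<dots> = (real (left m) + 1) * (2 * real m) / 2 ^ (l (pair i m) + i + 3)"
      by simp
    also have "\<dots> \<le> real (l (pair i m)) / 2 ^ (l (pair i m) + i + 3)"
    proof (intro divide_right_mono)
      have "(real (left m) + 1) * (2 * real m) \<le> (real m + 1) * (2 * real m)"
        using left_le[of m] by (intro mult_right_mono) auto
      also have "\<dots> = real (l (pair i m))" by (simp add: l_def algebra_simps)
      finally show "(real (left m) + 1) * (2 * real m) \<le> real (l (pair i m))" .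
    qed simp
    also have "\<dots> \<le> 2 ^ l (pair i m) / 2 ^ (l (pair i m) + i + 3)"
      by (intro divide_right_mono) (simp_all add: less_imp_le of_nat_less_two_power)
    also have "\<dots> = 1 / 2 ^ (i + 3)" by (simp add: power_add)
    finally show ?thesis .
  qed
  have "fast_cauchy (span_num smul e) (\<lambda>i. F (pair i (n (i + Suc k)))) (V c)"
    if n: "fast_cauchy (span_num scale_ell2 unit_ell2) n c" for n c
  proof (rule fast_cauchyI)
    fix i
    let ?c = "span_num scale_ell2 unit_ell2 (n (i + Suc k))"
    have "dist (V ?c) (V c) = norm (V (?c - c))"
      by (simp add: dist_norm linear_diff[OF bounded_linear.linear[OF V]])
    also have "\<dots> \<le> norm (?c - c) * C" by (rule C(2))
    also have "\<dots> \<le> 1 / 2 ^ (i + Suc k) * (2 ^ k / 8)"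
      using fast_cauchy_dist[OF n, of "i + Suc k"] k C(1) by (intro mult_mono) (auto simp: dist_norm)
    also have "\<dots> = 1 / 2 ^ (i + 4)" by (simp add: power_add)
    also have "\<dots> < 1 / 2 ^ (i + 3)" by (intro divide_strict_left_mono power_strict_increasing) auto
    finally have "dist (V ?c) (V c) < 1 / 2 ^ (i + 3)" .
    moreover have "(1::real) / 2 ^ (i + 3) + 1 / 2 ^ (i + 3) = 1 / 2 ^ (i + 2)" by (simp add: power_add)
    ultimately show "dist (span_num smul e (F (pair i (n (i + Suc k))))) (V c) < 1 / 2 ^ (i + 2)"
      using approx[of i "n (i + Suc k)"] dist_triangle[of "span_num smul e (F (pair i (n (i + Suc k))))"
          "V c" "V ?c"]
      by linarith
  qed
  then show ?thesis
    unfolding hilbert_rep_def by (rule computable_map_cauchy_repI[OF F(1)])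
qed

text \<open>
  The sequence that repeats the code of \<open>\<delta>\<^sub>k\<close> is a name of \<open>\<delta>\<^sub>k\<close>, and its letters are
  recursive in \<open>k\<close> and the position. So the output of the machine for \<open>V\<close> on these names is
  recursive as well.
\<close>

lemma computable_sequence_image_units:
  fixes e :: "nat \<Rightarrow> 'h::real_normed_vector"
  assumes "computable_map (hilbert_rep scale_ell2 unit_ell2 :: (nat \<Rightarrow> 's::{finite,
      zero_neq_one}) \<rightharpoonup> 'f::rc_field ell2)
    (hilbert_rep smul e) (Some \<circ> V)"
  shows "computable_sequence (hilbert_rep smul e :: (nat \<Rightarrow> 's) \<rightharpoonup> 'h) (\<lambda>k. V (unit_ell2 k))"
proof -
  obtain M :: "'s machine" where M: "machine M"
    "\<And>n x. fast_cauchy (span_num scale_ell2 (unit_ell2 :: nat \<Rightarrow> 'f ell2)) n x \<Longrightarrow>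
       \<exists>m. transforms M (code_word n) (code_word m) \<and> fast_cauchy (span_num smul e) m (V x)"
    using computable_map_cauchy_repE[OF assms[unfolded hilbert_rep_def]] by blast
  obtain u where u: "recursive u" "\<And>k. span_num scale_ell2 unit_ell2 (u k) = (unit_ell2 k :: 'f ell2)"
    using recursive_unit_code[OF vector_space_ell2] by blast
  have "fast_cauchy (span_num scale_ell2 unit_ell2) (\<lambda>_. u k) (unit_ell2 k :: 'f ell2)" for k
    by (rule fast_cauchyI) (simp add: u(2))
  then have "\<exists>m. transforms M (code_word (\<lambda>_. u k)) (code_word m) \<and>
      fast_cauchy (span_num smul e) m (V (unit_ell2 k))" for k
    by (rule M(2))
  then obtain m where m: "\<And>k. transforms M (code_word (\<lambda>_. u k)) (code_word (m k))"
      "\<And>k. fast_cauchy (span_num smul e) (m k) (V (unit_ell2 k))"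
    by metis
  from recursive_machine_output[OF M(1) m(1) recursive_constant_name[OF u(1)]]
  have "recursive (\<lambda>x. m (left x) (right x))" .
  then show ?thesis
    unfolding hilbert_rep_def computable_sequence_cauchy_rep
    by (intro exI[of _ "\<lambda>x. m (left x) (right x)"]) (simp add: m(2))
qed

theorem theorem3p29:
  fixes smul :: "'f::rc_field \<Rightarrow> 'h::banach \<Rightarrow> 'h"
    and ip :: "'h \<Rightarrow> 'h \<Rightarrow> 'f"
    and e f g :: "nat \<Rightarrow> 'h"
  assumes "computable_hilbert_space TYPE('s::{finite, zero_neq_one}) smul ip e"
    and "computable_frame TYPE('s) smul ip e f"
  shows "computable_dual_frame TYPE('s) smul ip e f g \<longleftrightarrow>
    (\<exists>V :: 'f ell2 \<Rightarrow> 'h.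
       computable_operator TYPE('s) scale_ell2 unit_ell2 smul e V \<and>
       (\<forall>x. V (analysis ip f x) = x) \<and>
       g = (\<lambda>k. V (unit_ell2 k)))"
proof
  interpret hilbert_space smul ip
    using assms(1) by (simp add: computable_hilbert_space_def)
  have f: "frame ip f" using assms(2) by (simp add: computable_frame_def)
  {
    assume "computable_dual_frame TYPE('s) smul ip e f g"
    then have seq: "computable_sequence (hilbert_rep smul e :: (nat \<Rightarrow> 's) \<rightharpoonup> 'h) g"
      and g: "frame ip g" and dual: "\<And>x. (\<lambda>i. smul (ip x (g i)) (f i)) sums x"
      by (simp_all add: computable_dual_frame_def computable_frame_def)
    obtain B where B: "0 \<le> B" "\<And>x. summable (\<lambda>i. (norm (ip x (g i)))\<^sup>2)"
      "\<And>x. (\<Sum>i. (norm (ip x (g i)))\<^sup>2) \<le> B * (norm x)\<^sup>2"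
      using g unfolding frame_def by (meson less_imp_le)
    define V where "V c = (\<Sum>i. smul (coord c i) (g i))" for c :: "'f ell2"
    have summable: "summable (\<lambda>i. smul (coord c i) (g i))" for c :: "'f ell2"
      by (rule bessel_summable[OF B(2,3,1) summable_coord])
    have add: "V (c + d) = V c + V d" for c d
      by (simp add: V_def plus_ell2.rep_eq scale_left_distrib suminf_add[OF summable summable])
    have scale: "V (scale_ell2 a c) = smul a (V c)" for a c
    proof -
      have "bounded_linear (smul a)"
        by (rule bounded_linear_intro[where K = "norm a"])
          (simp_all add: scale_right_distrib norm_smul mult.commute scale_left_commute flip: scale_of_real)
      then show ?thesis
        using bounded_linear.suminf[OF _ summable, of "smul a" c] by (simp add: V_def scale_ell2.rep_eq)
    qed
    have lin: "Vector_Spaces.linear scale_ell2 smul V"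
      by (simp add: Vector_Spaces.linear_iff vector_space_ell2 vector_space_axioms add scale)
    have V: "bounded_linear V"
      using bounded_linear_of_scalar_linear[OF lin] bessel_suminf_le[OF B(2,3,1)]
      by (intro bounded_linear.intro bounded_linear_axioms.intro) (auto simp: V_def mult.commute)
    have unit: "V (unit_ell2 k) = g k" for k
    proof -
      have "(\<lambda>i. smul (coord (unit_ell2 k) i) (g i)) = (\<lambda>i. if i = k then g i else 0)"
        by (auto simp: unit_ell2.rep_eq)
      then show ?thesis
        unfolding V_def using sums_unique[OF sums_single[of k g]] by simp
    qed
    have "V (analysis ip f x) = x" for x
      using sums_unique[OF dual_frame_swap[OF f g dual, of x]] by (simp add: V_def coord_analysis[OF f])
    moreover have "computable_operator TYPE('s) scale_ell2 unit_ell2 smul e V"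
      unfolding computable_operator_def using lin computable_synthesis[OF lin V] seq by (simp add: unit)
    ultimately show "\<exists>V. computable_operator TYPE('s) scale_ell2 unit_ell2 smul e V \<and>
       (\<forall>x. V (analysis ip f x) = x) \<and> g = (\<lambda>k. V (unit_ell2 k))"
      using unit by (intro exI[of _ V]) auto
  next
    assume "\<exists>V. computable_operator TYPE('s) scale_ell2 unit_ell2 smul e V \<and>
       (\<forall>x. V (analysis ip f x) = x) \<and> g = (\<lambda>k. V (unit_ell2 k))"
    then obtain V where lin: "Vector_Spaces.linear scale_ell2 smul V"
      and comp: "computable_map (hilbert_rep scale_ell2 unit_ell2 :: (nat \<Rightarrow> 's) \<rightharpoonup> 'f ell2) (hilbert_rep smul
          e) (Some \<circ> V)"
      and inv: "\<And>x. V (analysis ip f x) = x" and g: "g = (\<lambda>k. V (unit_ell2 k))"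
      by (auto simp: computable_operator_def)
    have "span_num scale_ell2 unit_ell2 0 = (0 :: 'f ell2)"
      by (simp add: span_num_def module.scale_zero_left[OF module_ell2])
    then have V: "bounded_linear V"
      using computable_linear_bounded[OF comp[unfolded hilbert_rep_def] bounded_linear_of_scalar_linear[OF lin]]
        span_num_ell2_dense by blast
    note frame = frame_of_left_inverse[OF lin V f inv]
    have "(\<lambda>i. smul (ip x (g i)) (f i)) sums x" for x
      using frame by (intro dual_frame_swap[OF _ f]) (simp_all add: g)
    moreover have "frame ip g" using frame(1) by (simp add: g)
    ultimately show "computable_dual_frame TYPE('s) smul ip e f g"
      using computable_sequence_image_units[OF comp]
          by (simp add: computable_dual_frame_def computable_frame_def g)
  }
qed

end
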